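(* Let $X$ be a proper geodesic Gromov hyperbolic space, and let $\Gamma$ be a group acting properly discontinuously, isometrically and non-elementarily on $X$. Let $G<\Gamma$ be an infinite normal subgroup of infinite index. Then $$\mathrm{Hdim}(\Lambda G)=\mathrm{Hdim}(\Lambda^{nc}G)\ge \frac{\omega_G}{\epsilon},$$ where Hausdorff dimension is taken with respect to a visual metric $\rho_\epsilon$ on $\partial X$ with parameter $\epsilon$.
   Context: Visual metric: for a $\delta$-hyperbolic proper geodesic space $X$ with basepoint $o$ there is $\epsilon_0>0$ such that for every $\epsilon\in(0,\epsilon_0)$ there is a metric $\rho_\epsilon$ on the Gromov boundary $\partial X$ with $\rho_\epsilon(\xi,\eta)\asymp e^{-\epsilon\, d(o,[\xi,\eta])}$ for all $\xi\neq\eta$, with implicit constants depending only on $\delta$; $\epsilon$ is called its parameter. Critical exponent: $\omega_G=\limsup_{n\to\infty}\frac1n\log\#\{g\in G: d(o,go)\le n\}$. The limit set $\Lambda G\subset \partial X$ is the set of accumulation points of $Go$. A limit point $\xi$ is conical if there exist $g_n\in G$ and $R>0$ with $g_no\to\xi$ and all $g_no$ in the $R$-neighborhood of a geodesic ray $[o,\xi)$; $\Lambda^{nc}G$ is the set of non-conical limit points. The action is non-elementary if $|\Lambda\Gamma|\ge 3$. *)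

theory Defs
  imports "HOL-Analysis.Analysis" "HOL-Algebra.Coset"
begin

definition gromov_product :: "'a::metric_space \<Rightarrow> 'a \<Rightarrow> 'a \<Rightarrow> real" where
  "gromov_product w x y = (dist w x + dist w y - dist x y) / 2"

definition gromov_hyperbolic :: "real \<Rightarrow> 'a::metric_space itself \<Rightarrow> bool" where
  "gromov_hyperbolic d _ \<longleftrightarrow> d \<ge> 0 \<and>
     (\<forall>w x y z::'a. gromov_product w x z \<ge> min (gromov_product w x y) (gromov_product w y z) - d)"

definition geodesic_space :: "'a::metric_space itself \<Rightarrow> bool" where
  "geodesic_space _ \<longleftrightarrow> (\<forall>x y::'a. \<exists>\<gamma>::real \<Rightarrow> 'a. \<gamma> 0 = x \<and> \<gamma> (dist x y) = y \<and>
      (\<forall>s\<in>{0..dist x y}. \<forall>t\<in>{0..dist x y}. dist (\<gamma> s) (\<gamma> t) = \<bar>s - t\<bar>))"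

definition conv_at_infinity :: "'a::metric_space \<Rightarrow> (nat \<Rightarrow> 'a) \<Rightarrow> bool" where
  "conv_at_infinity p x \<longleftrightarrow>
     (\<forall>M. \<exists>N. \<forall>m\<ge>N. \<forall>n\<ge>N. gromov_product p (x m) (x n) \<ge> M)"

definition seq_equiv :: "'a::metric_space \<Rightarrow> (nat \<Rightarrow> 'a) \<Rightarrow> (nat \<Rightarrow> 'a) \<Rightarrow> bool" where
  "seq_equiv p x y \<longleftrightarrow>
     (\<forall>M. \<exists>N. \<forall>m\<ge>N. \<forall>n\<ge>N. gromov_product p (x m) (y n) \<ge> M)"

definition bdry_class :: "'a::metric_space \<Rightarrow> (nat \<Rightarrow> 'a) \<Rightarrow> (nat \<Rightarrow> 'a) set" where
  "bdry_class p x = {y. conv_at_infinity p y \<and> seq_equiv p x y}"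

definition gromov_boundary :: "'a::metric_space \<Rightarrow> (nat \<Rightarrow> 'a) set set" where
  "gromov_boundary p = {bdry_class p x | x. conv_at_infinity p x}"

definition converges_to_bdry :: "'a::metric_space \<Rightarrow> (nat \<Rightarrow> 'a) \<Rightarrow> (nat \<Rightarrow> 'a) set \<Rightarrow> bool" where
  "converges_to_bdry p x \<xi> \<longleftrightarrow> \<xi> \<in> gromov_boundary p \<and> x \<in> \<xi>"

definition geodesic_ray :: "'a::metric_space \<Rightarrow> (real \<Rightarrow> 'a) \<Rightarrow> (nat \<Rightarrow> 'a) set \<Rightarrow> bool" where
  "geodesic_ray p \<gamma> \<xi> \<longleftrightarrow> \<gamma> 0 = p \<and>
     (\<forall>s\<ge>0. \<forall>t\<ge>0. dist (\<gamma> s) (\<gamma> t) = \<bar>s - t\<bar>) \<and>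
     converges_to_bdry p (\<lambda>n. \<gamma> (real n)) \<xi>"

definition geodesic_line :: "'a::metric_space \<Rightarrow> (real \<Rightarrow> 'a) \<Rightarrow> (nat \<Rightarrow> 'a) set \<Rightarrow> (nat \<Rightarrow> 'a) set \<Rightarrow> bool" where
  "geodesic_line p \<gamma> \<xi> \<eta> \<longleftrightarrow>
     (\<forall>s t. dist (\<gamma> s) (\<gamma> t) = \<bar>s - t\<bar>) \<and>
     converges_to_bdry p (\<lambda>n. \<gamma> (- real n)) \<xi> \<and>
     converges_to_bdry p (\<lambda>n. \<gamma> (real n)) \<eta>"

definition isometric_action :: "('g, 'm) monoid_scheme \<Rightarrow> ('g \<Rightarrow> 'a::metric_space \<Rightarrow> 'a) \<Rightarrow> bool" where
  "isometric_action \<Gamma> act \<longleftrightarrow> group \<Gamma> \<and>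
     act \<one>\<^bsub>\<Gamma>\<^esub> = id \<and>
     (\<forall>g\<in>carrier \<Gamma>. \<forall>h\<in>carrier \<Gamma>. act (g \<otimes>\<^bsub>\<Gamma>\<^esub> h) = act g \<circ> act h) \<and>
     (\<forall>g\<in>carrier \<Gamma>. \<forall>x y. dist (act g x) (act g y) = dist x y)"

definition properly_discontinuous :: "('g, 'm) monoid_scheme \<Rightarrow> ('g \<Rightarrow> 'a::metric_space \<Rightarrow> 'a) \<Rightarrow> bool" where
  "properly_discontinuous \<Gamma> act \<longleftrightarrow>
     (\<forall>K. compact K \<longrightarrow> finite {g \<in> carrier \<Gamma>. act g ` K \<inter> K \<noteq> {}})"

definition limit_set :: "'a::metric_space \<Rightarrow> ('g \<Rightarrow> 'a \<Rightarrow> 'a) \<Rightarrow> 'g set \<Rightarrow> (nat \<Rightarrow> 'a) set set" where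
  "limit_set p act H = {\<xi>. \<exists>g. (\<forall>n. g n \<in> H) \<and> converges_to_bdry p (\<lambda>n. act (g n) p) \<xi>}"

definition conical_limit_set :: "'a::metric_space \<Rightarrow> ('g \<Rightarrow> 'a \<Rightarrow> 'a) \<Rightarrow> 'g set \<Rightarrow> (nat \<Rightarrow> 'a) set set" where
  "conical_limit_set p act H = {\<xi> \<in> limit_set p act H. \<exists>g R \<gamma>. R > 0 \<and> (\<forall>n. g n \<in> H) \<and>
      converges_to_bdry p (\<lambda>n. act (g n) p) \<xi> \<and> geodesic_ray p \<gamma> \<xi> \<and>
      (\<forall>n. \<exists>t\<ge>0. dist (act (g n) p) (\<gamma> t) \<le> R)}"

definition nonconical_limit_set :: "'a::metric_space \<Rightarrow> ('g \<Rightarrow> 'a \<Rightarrow> 'a) \<Rightarrow> 'g set \<Rightarrow> (nat \<Rightarrow> 'a) set set" where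
  "nonconical_limit_set p act H = limit_set p act H - conical_limit_set p act H"

definition critical_exponent :: "'a::metric_space \<Rightarrow> ('g \<Rightarrow> 'a \<Rightarrow> 'a) \<Rightarrow> 'g set \<Rightarrow> ereal" where
  "critical_exponent p act H =
     limsup (\<lambda>n::nat. ereal (ln (real (card {g \<in> H. dist p (act g p) \<le> real n})) / real n))"

definition metric_on :: "'b set \<Rightarrow> ('b \<Rightarrow> 'b \<Rightarrow> real) \<Rightarrow> bool" where
  "metric_on B \<rho> \<longleftrightarrow> (\<forall>x\<in>B. \<forall>y\<in>B. \<rho> x y \<ge> 0 \<and> (\<rho> x y = 0 \<longleftrightarrow> x = y) \<and> \<rho> x y = \<rho> y x) \<and>
     (\<forall>x\<in>B. \<forall>y\<in>B. \<forall>z\<in>B. \<rho> x z \<le> \<rho> x y + \<rho> y z)"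

definition visual_metric :: "'a::metric_space \<Rightarrow> real \<Rightarrow> real \<Rightarrow> ((nat \<Rightarrow> 'a) set \<Rightarrow> (nat \<Rightarrow> 'a) set \<Rightarrow> real) \<Rightarrow> bool" where
  "visual_metric p \<epsilon> C \<rho> \<longleftrightarrow> \<epsilon> > 0 \<and> C \<ge> 1 \<and> metric_on (gromov_boundary p) \<rho> \<and>
     (\<forall>\<xi>\<in>gromov_boundary p. \<forall>\<eta>\<in>gromov_boundary p. \<forall>\<gamma>. \<xi> \<noteq> \<eta> \<and> geodesic_line p \<gamma> \<xi> \<eta> \<longrightarrow>
        (let D = Inf (range (\<lambda>t. dist p (\<gamma> t))) in
          exp (- \<epsilon> * D) / C \<le> \<rho> \<xi> \<eta> \<and> \<rho> \<xi> \<eta> \<le> C * exp (- \<epsilon> * D)))"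

definition rdiam :: "('b \<Rightarrow> 'b \<Rightarrow> real) \<Rightarrow> 'b set \<Rightarrow> ereal" where
  "rdiam \<rho> U = Sup {ereal (\<rho> x y) | x y. x \<in> U \<and> y \<in> U}"

definition hausdorff_approx :: "('b \<Rightarrow> 'b \<Rightarrow> real) \<Rightarrow> 'b set \<Rightarrow> real \<Rightarrow> real \<Rightarrow> 'b set \<Rightarrow> ennreal" where
  "hausdorff_approx \<rho> B s d A =
     (INF U \<in> {U :: nat \<Rightarrow> 'b set. (\<forall>i. U i \<subseteq> B \<and> rdiam \<rho> (U i) \<le> ereal d) \<and> A \<subseteq> (\<Union>i. U i)}.
        (\<Sum>i. ennreal (real_of_ereal (rdiam \<rho> (U i)) powr s)))"

definition hausdorff_measure :: "('b \<Rightarrow> 'b \<Rightarrow> real) \<Rightarrow> 'b set \<Rightarrow> real \<Rightarrow> 'b set \<Rightarrow> ennreal" where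
  "hausdorff_measure \<rho> B s A = (SUP d \<in> {0<..}. hausdorff_approx \<rho> B s d A)"

definition hausdorff_dim :: "('b \<Rightarrow> 'b \<Rightarrow> real) \<Rightarrow> 'b set \<Rightarrow> 'b set \<Rightarrow> ereal" where
  "hausdorff_dim \<rho> B A = Inf {ereal s | s. s > 0 \<and> hausdorff_measure \<rho> B s A = 0}"

end

theory Submission
  imports Defs
begin

text \<open>
  Write \<open>o\<close> for the base point. Conical limit points are covered infinitely often by the shadows of the
  orbit points, so the convergence of the Poincare series bounds the dimension of the conical limit set by
  \<open>\<omega>/\<epsilon>\<close>; it remains to find a large set of non-conical limit points.

  Choose in \<open>H\<close> a large separated set \<open>A\<close> of elements of nearly equal length, and consider the infinite
  words \<open>a\<^sub>0 t\<^sub>0 a\<^sub>1 t\<^sub>1 \<dots>\<close> with arbitrary \<open>a\<^sub>i \<in> A\<close>. The fixed transitions \<open>t\<^sub>i\<close> make all these words local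
  quasigeodesics, and modulo \<open>H\<close> they follow a path escaping from the identity coset in the infinite group
  \<open>\<Gamma>/H\<close>. As elements of \<open>A\<close> have bounded length, the rays thereby leave every neighbourhood of the orbit
  of \<open>H\<close>, so that their end points are not conical. The escaping path moves so slowly that the transitions
  do not affect the exponential growth of the tree of words, whose boundary is a Cantor set of dimension
  close to \<open>\<omega>/\<epsilon>\<close>.
\<close>

section \<open>Hyperbolic spaces and their boundary\<close>

text \<open>Normality enters twice. A conjugate stays in \<open>H\<close> while starting along the
  conjugating element, so \<open>H\<close> has elements in every direction available to
  \<open>\<Gamma>\<close>; and the distance from an orbit point to the orbit of \<open>H\<close>
  depends only on the coset, so a path in \<open>\<Gamma>/H\<close> controls it.

  That path cannot always have bounded steps: \<open>\<Gamma>\<close> need not be finitely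
  generated, and when \<open>\<Gamma>/H\<close> is locally finite, bounded steps remain in a finite
  subgroup. A long step, however, could come back to the orbit of \<open>H\<close> halfway; what has
  to tend to infinity is the sum of the depths at its two ends minus its length.

  Concatenating two letters may require a correction between them. Three directions, of which a
  given point is close to at most one, provide finitely many corrections; selecting the letters of
  \<open>A\<close> that share one costs a constant factor, which growth at a slightly larger
  exponent absorbs. Likewise the dimensions are compared strictly above the critical exponent, where
  the Poincare series converges.\<close>

abbreviation gp :: "'a::metric_space \<Rightarrow> 'a \<Rightarrow> 'a \<Rightarrow> real" where
  "gp \<equiv> gromov_product"

lemma gp_commute: "gp w x y = gp w y x"
  by (simp add: gromov_product_def dist_commute)

lemma gp_nonneg: "0 \<le> gp w x y"
  unfolding gromov_product_def using dist_triangle[of x y w] by (simp add: dist_commute)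

lemma gp_le_dist: "gp w x y \<le> dist w x"
  unfolding gromov_product_def using dist_triangle[of w y x] by (simp add: dist_commute)

lemma gp_le_dist': "gp w x y \<le> dist w y"
  using gp_le_dist[of w y x] by (simp add: gp_commute)

lemma gp_self [simp]: "gp w x x = dist w x"
  by (simp add: gromov_product_def)

lemma gp_flip: "gp w x y + gp x w y = dist w x"
  unfolding gromov_product_def by (simp add: dist_commute field_simps)

lemma gp_change_base: "gp w x y \<le> gp w' x y + dist w w'"
  unfolding gromov_product_def using dist_triangle[of w x w'] dist_triangle[of w y w'] by (simp add: field_simps)

lemma gp_change_point: "gp w x y \<le> gp w x' y + dist x x'"
  unfolding gromov_product_def using dist_triangle[of w x x'] dist_triangle[of x' y x]
  by (simp add: dist_commute field_simps)

lemma dist_eq_gp: "dist x y = dist w x + dist w y - 2 * gp w x y"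
  by (simp add: gromov_product_def field_simps)

text \<open>Tychonoff in place of Arzela-Ascoli. The index set may be all of \<open>real\<close>,
  where the product is not metrizable; a cluster point still approximates finitely many coordinates
  at a time, which is enough to pass distances to the limit.\<close>

lemma ex_pointwise_cluster_function:
  fixes f :: "nat \<Rightarrow> 'i \<Rightarrow> 'b::metric_space"
  assumes K: "\<And>i. compact (K i)" and f: "\<And>n i. f n i \<in> K i"
  shows "\<exists>g. \<forall>I e N. finite I \<longrightarrow> e > 0 \<longrightarrow> (\<exists>n\<ge>N. \<forall>i\<in>I. dist (f n i) (g i) < e)"
proof -
  have "compact (Pi\<^sub>E UNIV K)"
    using compactin_PiE[of "\<lambda>_. euclidean" UNIV K] K by (simp add: euclidean_product_topology)
  moreover have "eventually (\<lambda>h. h \<in> Pi\<^sub>E UNIV K) (filtermap f sequentially)"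
    using f by (simp add: eventually_filtermap PiE_iff)
  ultimately obtain g where g: "inf (nhds g) (filtermap f sequentially) \<noteq> bot"
    unfolding compact_filter by (metis filtermap_bot_iff sequentially_bot)
  have "\<exists>n\<ge>N. \<forall>i\<in>I. dist (f n i) (g i) < e" if "finite I" "e > 0" for I N and e :: real
  proof -
    let ?U = "Pi\<^sub>E UNIV (\<lambda>i. if i \<in> I then ball (g i) e else UNIV)"
    have "open ?U"
      using that(1) by (intro open_PiE) (auto intro: finite_subset[OF _ that(1)] split: if_splits)
    moreover have "g \<in> ?U" using that by auto
    ultimately have U: "eventually (\<lambda>h. h \<in> ?U) (nhds g)"
      by (rule eventually_nhds_in_open)
    have "\<exists>\<^sub>F h in filtermap f sequentially. h \<in> ?U"
    proof (rule ccontr)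
      assume "\<not> ?thesis"
      then have "eventually (\<lambda>h. h \<notin> ?U) (filtermap f sequentially)"
        by (simp add: frequently_def)
      with U have "eventually (\<lambda>h. False) (inf (nhds g) (filtermap f sequentially))"
        unfolding eventually_inf by fast
      with g show False by (simp add: eventually_False)
    qed
    then have "\<exists>\<^sub>F n in sequentially. f n \<in> ?U"
      by (simp add: frequently_def eventually_filtermap)
    then obtain n where "n \<ge> N" "f n \<in> ?U"
      unfolding frequently_sequentially by blast
    then show ?thesis
      by (intro exI[of _ n]) (force simp: PiE_iff dist_commute split: if_splits)
  qed
  then show ?thesis by blast
qed

text \<open>Properness of the space is the class \<open>heine_borel\<close>: closed balls are
  compact.\<close>

locale hyperbolic_space =
  fixes p :: "'a::heine_borel" and \<delta> :: real
  assumes geodesic: "geodesic_space TYPE('a)"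
    and hyperbolic: "gromov_hyperbolic \<delta> TYPE('a)"
begin

lemma delta_nonneg: "\<delta> \<ge> 0"
  using hyperbolic by (simp add: gromov_hyperbolic_def)

lemma hyp: "min (gp w x y) (gp w y z) - \<delta> \<le> gp w x z" for x :: 'a
  using hyperbolic by (simp add: gromov_hyperbolic_def)

lemma hyp3: "min (gp w x y) (min (gp w y z) (gp w z u)) - 2 * \<delta> \<le> gp w x u" for x :: 'a
  using hyp[of w x y u] hyp[of w y z u] delta_nonneg by linarith

lemma four_points:
  "dist x y + dist w z \<le> max (dist x z + dist w y) (dist y z + dist w x) + 2 * \<delta>" for x :: 'a
  using hyp[of w x z y] unfolding gromov_product_def
  by (auto simp: dist_commute max_def min_def field_simps split: if_splits)

section \<open>Local-to-global principle for chains of points\<close>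

context
  fixes x :: "nat \<Rightarrow> 'a" and n :: nat and K :: real
  assumes local: "\<And>i. i + 2 \<le> n \<Longrightarrow> gp (x (Suc i)) (x i) (x (Suc (Suc i))) \<le> K"
    and step: "\<And>i. i < n \<Longrightarrow> 2 * K + 4 * \<delta> + 1 \<le> dist (x i) (x (Suc i))"
begin

text \<open>The bound does not deteriorate with \<open>d\<close>. By \<open>gp_flip\<close> the
  products at the two ends of a step add up to its length, so a product of at most
  \<open>K + \<delta>\<close> at one end is at least \<open>K + 3 * \<delta> + 1\<close> at the
  other; there \<open>hyp\<close> transfers the local bound \<open>K\<close> from the previous point
  to \<open>x i\<close> at the cost of one \<open>\<delta>\<close>.\<close>

lemma chain_forward:
  "i + d + 2 \<le> n \<Longrightarrow> gp (x (Suc (i + d))) (x i) (x (Suc (Suc (i + d)))) \<le> K + \<delta>"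
proof (induction d)
  case 0
  then show ?case using local[of i] delta_nonneg by force
next
  case (Suc d)
  let ?j = "Suc (i + d)"
  have 1: "gp (x ?j) (x i) (x (Suc ?j)) \<le> K + \<delta>" using Suc by simp
  have "gp (x (Suc ?j)) (x i) (x ?j) + gp (x ?j) (x i) (x (Suc ?j)) = dist (x ?j) (x (Suc ?j))"
    using gp_flip[of "x (Suc ?j)" "x ?j" "x i"] by (simp add: gp_commute dist_commute)
  moreover have "2 * K + 4 * \<delta> + 1 \<le> dist (x ?j) (x (Suc ?j))" using step Suc.prems by simp
  moreover have "gp (x (Suc ?j)) (x ?j) (x (Suc (Suc ?j))) \<le> K" using local[of ?j] Suc.prems by simp
  moreover note hyp[of "x (Suc ?j)" "x ?j" "x i" "x (Suc (Suc ?j))"] 1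
  ultimately show ?case using delta_nonneg by (simp add: gp_commute min_def split: if_splits)
qed

lemma chain_backward:
  "j + d + 2 \<le> n \<Longrightarrow> gp (x (Suc j)) (x j) (x (j + d + 2)) \<le> K + \<delta>"
proof (induction d arbitrary: j)
  case 0
  then show ?case using local[of j] delta_nonneg by force
next
  case (Suc d)
  let ?k = "x (Suc j + d + 2)"
  have 1: "gp (x (Suc (Suc j))) (x (Suc j)) ?k \<le> K + \<delta>" using Suc.IH[of "Suc j"] Suc.prems by simp
  have "gp (x (Suc j)) (x (Suc (Suc j))) ?k + gp (x (Suc (Suc j))) (x (Suc j)) ?k
      = dist (x (Suc j)) (x (Suc (Suc j)))"
    using gp_flip[of "x (Suc j)" "x (Suc (Suc j))" "?k"] by simp
  moreover have "2 * K + 4 * \<delta> + 1 \<le> dist (x (Suc j)) (x (Suc (Suc j)))" using step Suc.prems by simp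
  moreover have "gp (x (Suc j)) (x j) (x (Suc (Suc j))) \<le> K" using local[of j] Suc.prems by simp
  moreover note hyp[of "x (Suc j)" "x j" ?k "x (Suc (Suc j))"] 1
  ultimately show ?case using delta_nonneg by (simp add: gp_commute min_def split: if_splits)
qed

lemma chain_gp:
  assumes "i < j" "j < k" "k \<le> n"
  shows "gp (x j) (x i) (x k) \<le> K + 2 * \<delta>"
proof -
  have f: "gp (x j) (x i) (x (Suc j)) \<le> K + \<delta>"
    using chain_forward[of i "j - i - 1"] assms by simp
  show ?thesis
  proof (cases "k = Suc j")
    case True
    then show ?thesis using f delta_nonneg by force
  next
    case False
    have "gp (x (Suc j)) (x j) (x k) \<le> K + \<delta>"
    proof -
      have "j + (k - j - 2) + 2 = k" using assms False by simp
      then show ?thesis using chain_backward assms(3) by metis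
    qed
    moreover have "gp (x j) (x (Suc j)) (x k) + gp (x (Suc j)) (x j) (x k) = dist (x j) (x (Suc j))"
      using gp_flip[of "x j" "x (Suc j)" "x k"] by simp
    moreover have "2 * K + 4 * \<delta> + 1 \<le> dist (x j) (x (Suc j))" using step assms by simp
    moreover note hyp[of "x j" "x i" "x k" "x (Suc j)"] f
    ultimately show ?thesis using delta_nonneg by (simp add: gp_commute min_def split: if_splits)
  qed
qed

text \<open>The step length exceeds twice the turning bound \<open>K + 2 * \<delta>\<close> of
  \<open>chain_gp\<close> by 1; this is the origin of the constant
  \<open>2 * K + 4 * \<delta> + 1\<close>.\<close>

lemma chain_dist_Suc:
  assumes "i < j" "j < n"
  shows "dist (x i) (x j) + 1 \<le> dist (x i) (x (Suc j))"
  using chain_gp[of i j "Suc j"] step[of j] dist_eq_gp[of "x i" "x (Suc j)" "x j"] assms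
  by (simp add: dist_commute)

lemma chain_dist_first:
  assumes "0 < j" "j \<le> n"
  shows "dist (x 0) (x 1) + (real j - 1) \<le> dist (x 0) (x j)"
  using assms
proof (induction j)
  case (Suc j)
  then show ?case using chain_dist_Suc[of 0 j] by (cases "j = 0") auto
qed simp

end

section \<open>Boundary points as equivalence classes of sequences\<close>

lemma seq_equiv_sym: "seq_equiv p x y \<Longrightarrow> seq_equiv p y x"
  unfolding seq_equiv_def by (metis gp_commute)

lemma seq_equiv_trans:
  assumes "seq_equiv p x y" "seq_equiv p y z"
  shows "seq_equiv p x z"
  unfolding seq_equiv_def
proof
  fix M
  obtain N1 where N1: "\<And>m n. m \<ge> N1 \<Longrightarrow> n \<ge> N1 \<Longrightarrow> gp p (x m) (y n) \<ge> M + \<delta>"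
    using assms(1) unfolding seq_equiv_def by metis
  obtain N2 where N2: "\<And>m n. m \<ge> N2 \<Longrightarrow> n \<ge> N2 \<Longrightarrow> gp p (y m) (z n) \<ge> M + \<delta>"
    using assms(2) unfolding seq_equiv_def by metis
  have "gp p (x m) (z n) \<ge> M" if "m \<ge> max N1 N2" "n \<ge> max N1 N2" for m n
    using N1[of m "max N1 N2"] N2[of "max N1 N2" n] hyp[of p "x m" "y (max N1 N2)" "z n"] that
    by simp
  then show "\<exists>N. \<forall>m\<ge>N. \<forall>n\<ge>N. gp p (x m) (z n) \<ge> M" by blast
qed

lemma conv_iff_seq_equiv: "conv_at_infinity p x \<longleftrightarrow> seq_equiv p x x"
  by (simp add: conv_at_infinity_def seq_equiv_def)

lemma bdry_class_eq:
  assumes "seq_equiv p x y"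
  shows "bdry_class p x = bdry_class p y"
  using assms seq_equiv_sym seq_equiv_trans unfolding bdry_class_def by blast

lemma boundary_eq_class:
  assumes "\<xi> \<in> gromov_boundary p" "x \<in> \<xi>"
  shows "\<xi> = bdry_class p x"
  using assms bdry_class_eq unfolding gromov_boundary_def by (auto simp: bdry_class_def)

lemma boundary_mem_iff:
  assumes "\<xi> \<in> gromov_boundary p" "x \<in> \<xi>"
  shows "y \<in> \<xi> \<longleftrightarrow> conv_at_infinity p y \<and> seq_equiv p x y"
  using boundary_eq_class[OF assms] by (auto simp: bdry_class_def)

lemma boundary_eq_iff:
  assumes "\<xi> \<in> gromov_boundary p" "x \<in> \<xi>" "\<eta> \<in> gromov_boundary p" "y \<in> \<eta>"
  shows "\<xi> = \<eta> \<longleftrightarrow> seq_equiv p x y"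
  using assms boundary_eq_class bdry_class_eq boundary_mem_iff by metis

lemma boundary_conv: "\<xi> \<in> gromov_boundary p \<Longrightarrow> x \<in> \<xi> \<Longrightarrow> conv_at_infinity p x"
  using boundary_mem_iff by blast

lemma conv_converges_to_bdry:
  "conv_at_infinity p x \<Longrightarrow> converges_to_bdry p x (bdry_class p x)"
  by (auto simp: converges_to_bdry_def gromov_boundary_def bdry_class_def conv_iff_seq_equiv)

lemma boundary_nonempty: "\<xi> \<in> gromov_boundary p \<Longrightarrow> \<exists>x. x \<in> \<xi>"
  unfolding gromov_boundary_def using conv_converges_to_bdry unfolding converges_to_bdry_def by blast

text \<open>One pair of late indices with a small product bounds all late pairs: products within
  each sequence are at least \<open>M + 2 * \<delta>\<close> there, so by \<open>hyp3\<close> a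
  larger mixed product would carry over to that pair.\<close>

lemma not_seq_equiv_bounded:
  assumes "conv_at_infinity p x" "conv_at_infinity p y" "\<not> seq_equiv p x y"
  shows "\<exists>K N. \<forall>m\<ge>N. \<forall>n\<ge>N. gp p (x m) (y n) \<le> K"
proof -
  obtain M where M: "\<And>N. \<exists>m\<ge>N. \<exists>n\<ge>N. gp p (x m) (y n) < M"
    using assms(3) unfolding seq_equiv_def by (meson not_le)
  obtain N1 where N1: "\<And>m n. m \<ge> N1 \<Longrightarrow> n \<ge> N1 \<Longrightarrow> gp p (x m) (x n) \<ge> M + 2 * \<delta>"
    using assms(1) unfolding conv_at_infinity_def by metis
  obtain N2 where N2: "\<And>m n. m \<ge> N2 \<Longrightarrow> n \<ge> N2 \<Longrightarrow> gp p (y m) (y n) \<ge> M + 2 * \<delta>"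
    using assms(2) unfolding conv_at_infinity_def by metis
  obtain m0 n0 where mn: "m0 \<ge> max N1 N2" "n0 \<ge> max N1 N2" "gp p (x m0) (y n0) < M"
    using M by blast
  have "gp p (x m) (y n) \<le> M + 2 * \<delta>" if "m \<ge> max N1 N2" "n \<ge> max N1 N2" for m n
    using N1[of m0 m] N2[of n n0] mn that hyp3[of p "x m0" "x m" "y n" "y n0"]
    by (simp add: min_def split: if_splits)
  then show ?thesis by blast
qed

lemma conv_dist_at_top:
  assumes "conv_at_infinity p x"
  shows "\<exists>N. \<forall>n\<ge>N. M \<le> dist p (x n)"
  using assms unfolding conv_at_infinity_def by (metis gp_le_dist order_trans)

lemma seq_equiv_subseq:
  assumes "seq_equiv p x y" "strict_mono r" "strict_mono s"
  shows "seq_equiv p (x \<circ> r) (y \<circ> s)"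
  using assms unfolding seq_equiv_def comp_def
  by (metis strict_mono_imp_increasing order_trans)

text \<open>The point \<open>z\<close> is the foot of the projection of \<open>w\<close> to a geodesic from \<open>x\<close> to \<open>y\<close>.\<close>

lemma dist_geodesic_le_gp:
  fixes x :: 'a
  assumes "dist x z + dist z y = dist x y" "dist x z = gp x w y"
  shows "dist w z \<le> gp w x y + 2 * \<delta>"
proof -
  have "gp w x z = gp w z y" "gp w x z + gp w z y = dist w z + gp w x y"
    using assms unfolding gromov_product_def by (auto simp: dist_commute field_simps)
  then show ?thesis using hyp[of w x z y] by simp
qed

lemma gp_le_dist_geodesic:
  fixes x :: 'a
  assumes "dist x z + dist z y = dist x y"
  shows "gp w x y \<le> dist w z"
  using assms dist_triangle[of w x z] dist_triangle[of w y z] unfolding gromov_product_def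
  by (simp add: dist_commute)

end

section \<open>Geodesic lines and convergent subsequences\<close>

context hyperbolic_space
begin

text \<open>Outside \<open>{a..b}\<close> the path is constant; time \<open>0\<close> is the foot of the projection of \<open>p\<close>.\<close>

lemma ex_centred_geodesic:
  fixes x y :: 'a
  shows "\<exists>\<gamma> a b. a \<le> 0 \<and> 0 \<le> b \<and> \<gamma> a = x \<and> \<gamma> b = y \<and>
    (\<forall>s\<in>{a..b}. \<forall>t\<in>{a..b}. dist (\<gamma> s) (\<gamma> t) = \<bar>s - t\<bar>) \<and>
    (\<forall>s. dist p (\<gamma> s) \<le> \<bar>s\<bar> + gp p x y + 2 * \<delta>) \<and>
    dist p x - gp p x y \<le> - a \<and> dist p y - gp p x y \<le> b"
proof -
  obtain c where c: "c 0 = x" "c (dist x y) = y"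
    and iso: "\<And>s t. s \<in> {0..dist x y} \<Longrightarrow> t \<in> {0..dist x y} \<Longrightarrow> dist (c s) (c t) = \<bar>s - t\<bar>"
    using geodesic unfolding geodesic_space_def by metis
  define a b where "a = - gp x p y" and "b = dist x y - gp x p y"
  define \<gamma> where "\<gamma> s = c (min (max (s - a) 0) (dist x y))" for s
  have ab: "a \<le> 0" "0 \<le> b" "b - a = dist x y"
    using gp_nonneg[of x p y] gp_le_dist'[of x p y] by (auto simp: a_def b_def)
  have ends: "\<gamma> a = x" "\<gamma> b = y" using c ab by (auto simp: \<gamma>_def)
  have iso': "dist (\<gamma> s) (\<gamma> t) = \<bar>s - t\<bar>" if "s \<in> {a..b}" "t \<in> {a..b}" for s t
    using that ab iso[of "s - a" "t - a"] by (auto simp: \<gamma>_def)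
  have lip: "dist (\<gamma> s) (\<gamma> 0) \<le> \<bar>s\<bar>" for s
    using iso[of "min (max (s - a) 0) (dist x y)" "- a"] ab
    by (auto simp: \<gamma>_def min_def max_def split: if_splits)
  have "dist p (\<gamma> 0) \<le> gp p x y + 2 * \<delta>"
  proof (rule dist_geodesic_le_gp)
    show "dist x (\<gamma> 0) + dist (\<gamma> 0) y = dist x y" "dist x (\<gamma> 0) = gp x p y"
      using iso'[of a 0] iso'[of 0 b] ab ends by (auto simp: a_def)
  qed
  then have *: "dist p (\<gamma> s) \<le> \<bar>s\<bar> + gp p x y + 2 * \<delta>" for s
    using lip[of s] dist_triangle[of p "\<gamma> s" "\<gamma> 0"] by (simp add: dist_commute)
  have "dist p x - gp p x y \<le> - a" "dist p y - gp p x y \<le> b"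
    unfolding a_def b_def gromov_product_def by (auto simp: dist_commute field_simps)
  with * show ?thesis using ab(1,2) ends iso'
    by (intro exI[of _ \<gamma>] exI[of _ a] exI[of _ b]) blast
qed

text \<open>The last hypothesis places \<open>s\<close> between 0 and \<open>b\<close> for either
  sign of \<open>b\<close>, so that both ends of a line are covered.\<close>

lemma gp_geodesic_end:
  fixes \<gamma> :: "real \<Rightarrow> 'a"
  assumes "dist (\<gamma> s) (\<gamma> b) = \<bar>s - b\<bar>" "dist (\<gamma> 0) (\<gamma> b) = \<bar>b\<bar>" "dist (\<gamma> 0) (\<gamma> s) = \<bar>s\<bar>"
    "\<bar>b\<bar> = \<bar>s\<bar> + \<bar>s - b\<bar>"
  shows "\<bar>s\<bar> - dist p (\<gamma> 0) \<le> gp p (\<gamma> s) (\<gamma> b)"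
  unfolding gromov_product_def
  using assms dist_triangle[of "\<gamma> 0" "\<gamma> s" p] dist_triangle[of "\<gamma> 0" "\<gamma> b" p]
  by (simp add: dist_commute field_simps)

text \<open>Geodesics between the terms of representing sequences, centred at the foot of
  \<open>p\<close>, meet a fixed ball at time 0 because the products of these terms are bounded when
  \<open>\<xi> \<noteq> \<eta>\<close>. A pointwise cluster function of them is the line.\<close>

lemma ex_geodesic_line:
  assumes \<xi>: "\<xi> \<in> gromov_boundary p" and \<eta>: "\<eta> \<in> gromov_boundary p" and ne: "\<xi> \<noteq> \<eta>"
  shows "\<exists>\<gamma>. geodesic_line p \<gamma> \<xi> \<eta>"
proof -
  obtain x y where xy: "x \<in> \<xi>" "y \<in> \<eta>" using boundary_nonempty \<xi> \<eta> by metis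
  have conv: "conv_at_infinity p x" "conv_at_infinity p y" using boundary_conv \<xi> \<eta> xy by auto
  have "\<not> seq_equiv p x y" using boundary_eq_iff \<xi> \<eta> xy ne by blast
  then obtain K0 N0 where K0: "\<And>m n. m \<ge> N0 \<Longrightarrow> n \<ge> N0 \<Longrightarrow> gp p (x m) (y n) \<le> K0"
    using not_seq_equiv_bounded conv by blast
  define K where "K = max K0 0 + 2 * \<delta>"
  define P where "P n \<gamma> a b \<longleftrightarrow> a \<le> 0 \<and> 0 \<le> b \<and> \<gamma> a = x (n + N0) \<and> \<gamma> b = y (n + N0) \<and>
    (\<forall>s\<in>{a..b}. \<forall>t\<in>{a..b}. dist (\<gamma> s) (\<gamma> t) = \<bar>s - t\<bar>) \<and>
    (\<forall>s. dist p (\<gamma> s) \<le> \<bar>s\<bar> + K) \<and> dist p (x (n + N0)) - K \<le> - a \<and> dist p (y (n + N0)) - K \<le> b"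
    for n and \<gamma> :: "real \<Rightarrow> 'a" and a b :: real
  have "\<exists>\<gamma> a b. P n \<gamma> a b" for n
  proof -
    have *: "gp p (x (n + N0)) (y (n + N0)) \<le> K0" using K0 by simp
    obtain \<gamma> a b where g: "a \<le> 0 \<and> 0 \<le> b \<and> \<gamma> a = x (n + N0) \<and> \<gamma> b = y (n + N0) \<and>
    (\<forall>s\<in>{a..b}. \<forall>t\<in>{a..b}. dist (\<gamma> s) (\<gamma> t) = \<bar>s - t\<bar>) \<and>
    (\<forall>s. dist p (\<gamma> s) \<le> \<bar>s\<bar> + gp p (x (n + N0)) (y (n + N0)) + 2 * \<delta>) \<and>
    dist p (x (n + N0)) - gp p (x (n + N0)) (y (n + N0)) \<le> - a \<and>
    dist p (y (n + N0)) - gp p (x (n + N0)) (y (n + N0)) \<le> b"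
      using ex_centred_geodesic[of "x (n + N0)" "y (n + N0)"] by (elim exE)
    note g = g[THEN conjunct1] g[THEN conjunct2, THEN conjunct1] g[THEN conjunct2, THEN conjunct2]
    have gd: "dist p (\<gamma> s) \<le> \<bar>s\<bar> + gp p (x (n + N0)) (y (n + N0)) + 2 * \<delta>" for s
      using g(3) by blast
    have "dist p (\<gamma> s) \<le> \<bar>s\<bar> + K" for s
      using gd[of s] * unfolding K_def by linarith
    moreover have "dist p (x (n + N0)) - K \<le> - a" "dist p (y (n + N0)) - K \<le> b"
      using g(3) * delta_nonneg unfolding K_def by linarith+
    ultimately have "P n \<gamma> a b" unfolding P_def using g by simp
    then show ?thesis by blast
  qed
  then obtain c a b where P: "\<And>n. P n (c n) (a n) (b n)" by metis
  have a0: "\<And>n. a n \<le> 0" and b0: "\<And>n. 0 \<le> b n"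
    and ca: "\<And>n. c n (a n) = x (n + N0)" and cb: "\<And>n. c n (b n) = y (n + N0)"
    and iso: "\<And>n s t. s \<in> {a n..b n} \<Longrightarrow> t \<in> {a n..b n} \<Longrightarrow> dist (c n s) (c n t) = \<bar>s - t\<bar>"
    and cd: "\<And>n s. dist p (c n s) \<le> \<bar>s\<bar> + K"
    and da: "\<And>n. dist p (x (n + N0)) - K \<le> - a n" and db: "\<And>n. dist p (y (n + N0)) - K \<le> b n"
    using P unfolding P_def by blast+
  have "\<exists>g. \<forall>I e N. finite I \<longrightarrow> e > 0 \<longrightarrow> (\<exists>n\<ge>N. \<forall>i\<in>I. dist (c n i) (g i) < e)"
    by (rule ex_pointwise_cluster_function[of "\<lambda>s. cball p (\<bar>s\<bar> + K)"]) (auto simp: cd)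
  then obtain g where g: "\<And>I e N. finite I \<Longrightarrow> e > 0 \<Longrightarrow> \<exists>n\<ge>N. \<forall>i\<in>I. dist (c n i) (g i) < e"
    by blast
  have large: "\<exists>N. \<forall>n\<ge>N. S \<le> - a n \<and> S \<le> b n" for S
  proof -
    obtain N1 N2 where "\<And>n. n \<ge> N1 \<Longrightarrow> S + K \<le> dist p (x n)" "\<And>n. n \<ge> N2 \<Longrightarrow> S + K \<le> dist p (y n)"
      using conv_dist_at_top conv by metis
    then have "S \<le> - a n \<and> S \<le> b n" if "n \<ge> max N1 N2" for n
      using that da[of n] db[of n] by (smt (verit) max.boundedE trans_le_add1)
    then show ?thesis by blast
  qed
  have iso_g: "dist (g s) (g t) = \<bar>s - t\<bar>" for s t
  proof -
    obtain N where N: "\<And>n. n \<ge> N \<Longrightarrow> \<bar>s\<bar> + \<bar>t\<bar> \<le> - a n \<and> \<bar>s\<bar> + \<bar>t\<bar> \<le> b n" using large by blast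
    have "\<bar>dist (g s) (g t) - \<bar>s - t\<bar>\<bar> \<le> 0 + e" if "e > 0" for e
    proof -
      have "finite {s, t}" "e / 2 > 0" using that by auto
      then obtain n where n: "n \<ge> N" "dist (c n s) (g s) < e / 2" "dist (c n t) (g t) < e / 2"
        using g by (metis insertCI)
      have "dist (c n s) (c n t) = \<bar>s - t\<bar>"
        using N[OF n(1)] by (intro iso) auto
      then show ?thesis
        using n(2,3) dist_triangle[of "g s" "g t" "c n s"] dist_triangle[of "c n s" "g t" "c n t"]
          dist_triangle[of "c n s" "c n t" "g s"] dist_triangle[of "g s" "c n t" "g t"]
          dist_commute[of "c n s" "g s"] dist_commute[of "c n t" "g t"]
        by linarith
    qed
    then have "\<bar>dist (g s) (g t) - \<bar>s - t\<bar>\<bar> \<le> 0" by (rule field_le_epsilon)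
    then show ?thesis by simp
  qed
  \<comment> \<open>The sign \<open>\<sigma>\<close> selects one of the two half-lines;
    \<open>e n\<close> is the time at which the \<open>n\<close>-th geodesic reaches the term
    \<open>z (n + N0)\<close>.\<close>
  have ray: "converges_to_bdry p (\<lambda>n. g (\<sigma> * real n)) \<zeta>"
    if \<zeta>: "\<zeta> \<in> gromov_boundary p" "z \<in> \<zeta>" and e: "\<And>n. c n (e n) = z (n + N0)"
      and \<sigma>: "\<bar>\<sigma>\<bar> = 1" and en: "\<And>n. e n \<in> {a n..b n}"
      and sgn: "\<And>S. \<exists>N. \<forall>n\<ge>N. S \<le> \<sigma> * e n" for \<zeta> z e \<sigma>
  proof -
    have zc: "conv_at_infinity p z" using boundary_conv \<zeta> by blast
    have "seq_equiv p z (\<lambda>n. g (\<sigma> * real n))"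
      unfolding seq_equiv_def
    proof
      fix M
      obtain N1 where N1: "\<And>m n. m \<ge> N1 \<Longrightarrow> n \<ge> N1 \<Longrightarrow> gp p (z m) (z n) \<ge> M + \<delta>"
        using zc unfolding conv_at_infinity_def by metis
      obtain N2 :: nat where N2: "real N2 \<ge> M + \<delta> + K + 1" using real_arch_simple by blast
      have "gp p (z m) (g (\<sigma> * real k)) \<ge> M" if m: "m \<ge> max N1 N2" and k: "k \<ge> max N1 N2" for m k
      proof -
        obtain N3 where N3: "\<And>n. n \<ge> N3 \<Longrightarrow> real k \<le> \<sigma> * e n" using sgn by metis
        obtain N4 where N4: "\<And>n. n \<ge> N4 \<Longrightarrow> real k \<le> - a n \<and> real k \<le> b n" using large by metis
        obtain n where n: "n \<ge> max N1 (max N3 N4)" "dist (c n (\<sigma> * real k)) (g (\<sigma> * real k)) < 1"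
          using g[of "{\<sigma> * real k}" 1 "max N1 (max N3 N4)"] by auto
        have ab: "real k \<le> - a n" "real k \<le> b n" "real k \<le> \<sigma> * e n" using N3 N4 n by auto
        have "\<sigma> = 1 \<or> \<sigma> = -1" using \<sigma> by linarith
        then have eq: "\<bar>e n\<bar> = \<bar>\<sigma> * real k\<bar> + \<bar>\<sigma> * real k - e n\<bar>" and
          mem: "\<sigma> * real k \<in> {a n..b n}"
          using ab a0[of n] b0[of n] by auto
        have "\<bar>\<sigma> * real k\<bar> - dist p (c n 0) \<le> gp p (c n (\<sigma> * real k)) (c n (e n))"
          using iso[of "\<sigma> * real k" n "e n"] iso[of 0 n "e n"] iso[of 0 n "\<sigma> * real k"] mem en[of n] a0[of n] b0[of n]
          by (intro gp_geodesic_end[OF _ _ _ eq]) auto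
        moreover have "\<bar>\<sigma> * real k\<bar> = real k" using \<sigma> by (simp add: abs_mult)
        moreover have "dist p (c n 0) \<le> K" using cd[of n 0] by simp
        ultimately have "real k - K \<le> gp p (c n (\<sigma> * real k)) (z (n + N0))" using e by simp
        moreover have "gp p (c n (\<sigma> * real k)) (z (n + N0)) \<le> gp p (g (\<sigma> * real k)) (z (n + N0)) + 1"
          using gp_change_point[of p "c n (\<sigma> * real k)" "z (n + N0)" "g (\<sigma> * real k)"] n(2) by simp
        ultimately have "gp p (z (n + N0)) (g (\<sigma> * real k)) \<ge> M + \<delta>"
          using N2 k by (simp add: gp_commute)
        moreover have "gp p (z m) (z (n + N0)) \<ge> M + \<delta>" using N1 m n(1) by simp
        ultimately show ?thesis using hyp[of p "z m" "z (n + N0)" "g (\<sigma> * real k)"] by simp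
      qed
      then show "\<exists>N. \<forall>m\<ge>N. \<forall>n\<ge>N. M \<le> gp p (z m) (g (\<sigma> * real n))" by blast
    qed
    moreover from this have "conv_at_infinity p (\<lambda>n. g (\<sigma> * real n))"
      using conv_iff_seq_equiv seq_equiv_sym seq_equiv_trans by blast
    ultimately show ?thesis
      using boundary_mem_iff[OF \<zeta>] \<zeta>(1) unfolding converges_to_bdry_def by blast
  qed
  have "\<exists>N. \<forall>n\<ge>N. S \<le> - 1 * a n" "\<exists>N. \<forall>n\<ge>N. S \<le> 1 * b n" for S
    using large[of S] by auto
  moreover have "a n \<in> {a n..b n}" "b n \<in> {a n..b n}" for n
    using a0[of n] b0[of n] by auto
  ultimately have "converges_to_bdry p (\<lambda>n. g (- 1 * real n)) \<xi>" "converges_to_bdry p (\<lambda>n. g (1 * real n)) \<eta>"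
    using ray[OF \<xi> xy(1) ca, of "- 1"] ray[OF \<eta> xy(2) cb, of 1] by auto
  then have "geodesic_line p g \<xi> \<eta>"
    unfolding geodesic_line_def using iso_g by simp
  then show ?thesis by blast
qed

text \<open>Geodesics from \<open>p\<close> to the points \<open>x n\<close>, sampled at integer
  times, cluster pointwise. The subsequence is chosen so that its \<open>k\<close>-th geodesic stays
  within 1 of the cluster function up to time \<open>k\<close>, which makes the products of late
  terms large.\<close>

lemma ex_conv_subseq:
  fixes x :: "nat \<Rightarrow> 'a"
  assumes "\<And>M. \<exists>N. \<forall>n\<ge>N. M \<le> dist p (x n)"
  shows "\<exists>r. strict_mono r \<and> conv_at_infinity p (x \<circ> r)"
proof -
  have "\<exists>\<gamma>. \<gamma> 0 = p \<and> \<gamma> (dist p y) = y \<and>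
    (\<forall>s\<in>{0..dist p y}. \<forall>t\<in>{0..dist p y}. dist (\<gamma> s) (\<gamma> t) = \<bar>s - t\<bar>)" for y :: 'a
    using geodesic unfolding geodesic_space_def by blast
  then obtain c0 where c0: "\<And>y. c0 y 0 = p" "\<And>y. c0 y (dist p y) = y"
    "\<And>y s t. s \<in> {0..dist p y} \<Longrightarrow> t \<in> {0..dist p y} \<Longrightarrow> dist (c0 y s) (c0 y t) = \<bar>s - t\<bar>"
    by metis
  \<comment> \<open>The default \<open>p\<close> beyond the end of a short geodesic keeps
    \<open>c n k\<close> in the ball of radius \<open>k\<close>, as the cluster lemma
    requires.\<close>
  define c where "c n k = (if real k \<le> dist p (x n) then c0 (x n) (real k) else p)" for n k :: nat
  have d: "dist p (c n k) \<le> real k" for n k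
    using c0(3)[of 0 "x n" "real k"] c0(1) by (auto simp: c_def)
  have "\<exists>g. \<forall>I e N. finite I \<longrightarrow> e > 0 \<longrightarrow> (\<exists>n\<ge>N. \<forall>i\<in>I. dist (c n i) (g i) < e)"
    by (rule ex_pointwise_cluster_function[of "\<lambda>k. cball p (real k)"]) (auto simp: d)
  then obtain g where g: "\<And>I e N. finite I \<Longrightarrow> e > 0 \<Longrightarrow> \<exists>n\<ge>N. \<forall>i\<in>I. dist (c n i) (g i) < e"
    by blast
  have ex: "\<exists>n\<ge>N. real k \<le> dist p (x n) \<and> (\<forall>i\<le>k. dist (c n i) (g i) < 1)" for N k
  proof -
    obtain N' where "\<And>n. n \<ge> N' \<Longrightarrow> real k \<le> dist p (x n)" using assms by blast
    moreover obtain n where "n \<ge> max N N'" "\<forall>i\<in>{..k}. dist (c n i) (g i) < 1"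
      using g[of "{..k}" 1 "max N N'"] by auto
    ultimately show ?thesis by auto
  qed
  have "\<exists>r. \<forall>k. (real k \<le> dist p (x (r k)) \<and> (\<forall>i\<le>k. dist (c (r k) i) (g i) < 1)) \<and> r k < r (Suc k)"
  proof (rule dependent_nat_choice)
    show "\<exists>n. real 0 \<le> dist p (x n) \<and> (\<forall>i\<le>0. dist (c n i) (g i) < 1)" using ex by blast
    show "\<exists>m. (real (Suc k) \<le> dist p (x m) \<and> (\<forall>i\<le>Suc k. dist (c m i) (g i) < 1)) \<and> n < m" for n k
      using ex[of "Suc n" "Suc k"] by (meson Suc_le_lessD)
  qed
  then obtain r where r: "\<And>k. real k \<le> dist p (x (r k))" "\<And>k i. i \<le> k \<Longrightarrow> dist (c (r k) i) (g i) < 1"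
    "strict_mono r" by (metis strict_mono_Suc_iff)
  have gp_g: "real i - 1 \<le> gp p (x (r k)) (g i)" if "i \<le> k" for i k
  proof -
    have "real i \<le> dist p (x (r k))" using r(1)[of k] that by linarith
    then have "dist p (c (r k) i) = real i" "dist (c (r k) i) (x (r k)) = dist p (x (r k)) - real i"
      using c0(1)[of "x (r k)"] c0(2)[of "x (r k)"] c0(3)[of 0 "x (r k)" "real i"]
        c0(3)[of "real i" "x (r k)" "dist p (x (r k))"] by (auto simp: c_def)
    then have "gp p (x (r k)) (c (r k) i) = real i"
      by (simp add: gromov_product_def dist_commute)
    moreover have "gp p (c (r k) i) (x (r k)) \<le> gp p (g i) (x (r k)) + 1"
      using gp_change_point[of p "c (r k) i" "x (r k)" "g i"] r(2)[OF that] by simp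
    ultimately show ?thesis by (simp add: gp_commute)
  qed
  have "conv_at_infinity p (x \<circ> r)"
    unfolding conv_at_infinity_def
  proof
    fix M
    obtain i :: nat where i: "real i \<ge> M + 1 + \<delta>" using real_arch_simple by blast
    have "M \<le> gp p (x (r m)) (x (r n))" if "m \<ge> i" "n \<ge> i" for m n
      using gp_g[OF that(1)] gp_g[OF that(2)] i hyp[of p "x (r m)" "g i" "x (r n)"]
      by (simp add: gp_commute)
    then show "\<exists>N. \<forall>m\<ge>N. \<forall>n\<ge>N. M \<le> gp p ((x \<circ> r) m) ((x \<circ> r) n)" by auto
  qed
  with r(3) show ?thesis by blast
qed

end

section \<open>Visual metrics in terms of Gromov products\<close>

locale visual = hyperbolic_space p \<delta> for p :: "'a::heine_borel" and \<delta> +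
  fixes \<epsilon> C :: real and \<rho> :: "(nat \<Rightarrow> 'a) set \<Rightarrow> (nat \<Rightarrow> 'a) set \<Rightarrow> real"
  assumes visual: "visual_metric p \<epsilon> C \<rho>"
begin

lemma eps_pos: "\<epsilon> > 0" and C_ge_1: "C \<ge> 1"
  using visual by (auto simp: visual_metric_def)

lemma rho_same: "\<xi> \<in> gromov_boundary p \<Longrightarrow> \<rho> \<xi> \<xi> = 0"
  using visual by (auto simp: visual_metric_def metric_on_def)

text \<open>\<open>visual_metric\<close> speaks only of pairs joined by a line, so
  \<open>ex_geodesic_line\<close> is what gives it force. The distance \<open>D\<close> to that line
  is compared with late products of arbitrary representatives: the 1 is there since the infimum is
  only approached, \<open>2 * \<delta>\<close> pays for replacing the points of the line by the
  representatives, and another \<open>2 * \<delta>\<close> for the foot of \<open>p\<close> on the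
  line.\<close>

lemma visual_line:
  assumes "\<xi> \<in> gromov_boundary p" "\<eta> \<in> gromov_boundary p" "\<xi> \<noteq> \<eta>" "x \<in> \<xi>" "y \<in> \<eta>"
  obtains D N where "exp (- \<epsilon> * D) / C \<le> \<rho> \<xi> \<eta>" "\<rho> \<xi> \<eta> \<le> C * exp (- \<epsilon> * D)"
    "\<And>n. n \<ge> N \<Longrightarrow> gp p (x n) (y n) \<le> D + 1 + 2 * \<delta>"
    "\<And>n. n \<ge> N \<Longrightarrow> D \<le> gp p (x n) (y n) + 4 * \<delta>"
proof -
  obtain \<gamma> where \<gamma>: "geodesic_line p \<gamma> \<xi> \<eta>" using ex_geodesic_line assms by blast
  define D where "D = Inf (range (\<lambda>t. dist p (\<gamma> t)))"
  have iso: "\<And>s t. dist (\<gamma> s) (\<gamma> t) = \<bar>s - t\<bar>"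
    and x': "(\<lambda>n. \<gamma> (- real n)) \<in> \<xi>" and y': "(\<lambda>n. \<gamma> (real n)) \<in> \<eta>"
    using \<gamma> by (auto simp: geodesic_line_def converges_to_bdry_def)
  let ?x = "\<lambda>n. \<gamma> (- real n)" and ?y = "\<lambda>n. \<gamma> (real n)"
  have D_le: "D \<le> dist p (\<gamma> t)" for t
    unfolding D_def by (rule cInf_lower) (auto intro: bdd_belowI[of _ 0])
  have "\<exists>t. dist p (\<gamma> t) < D + 1"
    using cInf_lessD[of "range (\<lambda>t. dist p (\<gamma> t))" "D + 1"] unfolding D_def by auto
  then obtain t where t: "dist p (\<gamma> t) < D + 1" by blast
  have up: "D \<le> gp p (?x n) (?y n) + 2 * \<delta>" for n
  proof -
    let ?u = "gp (?x n) p (?y n)"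
    have u: "0 \<le> ?u" "?u \<le> 2 * real n"
      using gp_nonneg[of "?x n" p "?y n"] gp_le_dist'[of "?x n" p "?y n"] iso[of "- real n" "real n"] by auto
    have "dist p (\<gamma> (- real n + ?u)) \<le> gp p (?x n) (?y n) + 2 * \<delta>"
      using u by (intro dist_geodesic_le_gp) (auto simp: iso)
    then show ?thesis using D_le[of "- real n + ?u"] by linarith
  qed
  have low: "gp p (?x n) (?y n) \<le> D + 1" if "\<bar>t\<bar> \<le> real n" for n
  proof -
    have "gp p (?x n) (?y n) \<le> dist p (\<gamma> t)"
      by (rule gp_le_dist_geodesic) (use that in \<open>auto simp: iso\<close>)
    with t show ?thesis by simp
  qed
  obtain N0 where N0: "\<bar>t\<bar> \<le> real N0" using real_arch_simple by blast
  have "seq_equiv p x ?x" "seq_equiv p y ?y"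
    using boundary_mem_iff assms x' y' by blast+
  then obtain N1 N2 where N1: "\<And>m n. m \<ge> N1 \<Longrightarrow> n \<ge> N1 \<Longrightarrow> gp p (x m) (?x n) \<ge> D + 6 * \<delta> + 2"
    and N2: "\<And>m n. m \<ge> N2 \<Longrightarrow> n \<ge> N2 \<Longrightarrow> gp p (y m) (?y n) \<ge> D + 6 * \<delta> + 2"
    unfolding seq_equiv_def by metis
  let ?N = "max N0 (max N1 N2)"
  have "gp p (x n) (y n) \<le> D + 1 + 2 * \<delta>" "D \<le> gp p (x n) (y n) + 4 * \<delta>" if n: "n \<ge> ?N" for n
  proof -
    have a: "gp p (x n) (?x n) \<ge> D + 6 * \<delta> + 2" "gp p (y n) (?y n) \<ge> D + 6 * \<delta> + 2"
      "gp p (?x n) (?y n) \<le> D + 1" using n N1 N2 low N0 by auto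
    show "gp p (x n) (y n) \<le> D + 1 + 2 * \<delta>"
      using a hyp3[of p "?x n" "x n" "y n" "?y n"] delta_nonneg by (simp add: gp_commute min_def split: if_splits)
    show "D \<le> gp p (x n) (y n) + 4 * \<delta>"
      using a up[of n] hyp3[of p "x n" "?x n" "?y n" "y n"] delta_nonneg by (simp add: gp_commute min_def split: if_splits)
  qed
  moreover have "exp (- \<epsilon> * D) / C \<le> \<rho> \<xi> \<eta>" "\<rho> \<xi> \<eta> \<le> C * exp (- \<epsilon> * D)"
    using visual \<gamma> assms unfolding visual_metric_def D_def Let_def by blast+
  ultimately show thesis using that by blast
qed

text \<open>\<open>c_upper\<close> and \<open>c_lower\<close> are the additive errors of
  \<open>visual_line\<close> in exponential form.\<close>

definition c_upper :: real where "c_upper = C * exp (\<epsilon> * (1 + 2 * \<delta>))"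
definition c_lower :: real where "c_lower = exp (- (\<epsilon> * (4 * \<delta>))) / C"

lemma c_upper_pos: "c_upper > 0" and c_lower_pos: "c_lower > 0"
  using C_ge_1 by (auto simp: c_upper_def c_lower_def)

lemma rho_upper:
  assumes "\<xi> \<in> gromov_boundary p" "\<eta> \<in> gromov_boundary p" "x \<in> \<xi>" "y \<in> \<eta>"
    and V: "\<And>n. n \<ge> N \<Longrightarrow> V \<le> gp p (x n) (y n)"
  shows "\<rho> \<xi> \<eta> \<le> c_upper * exp (- \<epsilon> * V)"
proof (cases "\<xi> = \<eta>")
  case True
  then show ?thesis using rho_same assms c_upper_pos by simp
next
  case False
  obtain D N' where D: "\<rho> \<xi> \<eta> \<le> C * exp (- \<epsilon> * D)"
    "\<And>n. n \<ge> N' \<Longrightarrow> gp p (x n) (y n) \<le> D + 1 + 2 * \<delta>"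
    using visual_line[OF assms(1,2) False assms(3,4)] by metis
  have "V \<le> D + 1 + 2 * \<delta>" using D(2)[of "max N N'"] V[of "max N N'"] by simp
  then have "exp (- \<epsilon> * D) \<le> exp (\<epsilon> * (1 + 2 * \<delta>) + - \<epsilon> * V)"
    using eps_pos mult_left_mono[of V "D + 1 + 2 * \<delta>" \<epsilon>] by (simp add: algebra_simps)
  then have "C * exp (- \<epsilon> * D) \<le> C * exp (\<epsilon> * (1 + 2 * \<delta>) + - \<epsilon> * V)"
    using C_ge_1 by simp
  then show ?thesis using D(1) unfolding c_upper_def exp_add by (simp add: mult.assoc)
qed

lemma rho_lower:
  assumes "\<xi> \<in> gromov_boundary p" "\<eta> \<in> gromov_boundary p" "x \<in> \<xi>" "y \<in> \<eta>"
    and V: "\<And>n. n \<ge> N \<Longrightarrow> gp p (x n) (y n) \<le> V"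
  shows "c_lower * exp (- \<epsilon> * V) \<le> \<rho> \<xi> \<eta>"
proof -
  have ne: "\<xi> \<noteq> \<eta>"
  proof
    assume "\<xi> = \<eta>"
    then have "seq_equiv p x y" using boundary_eq_iff assms(1-4) by blast
    then obtain N' where "\<And>m n. m \<ge> N' \<Longrightarrow> n \<ge> N' \<Longrightarrow> gp p (x m) (y n) \<ge> V + 1"
      unfolding seq_equiv_def by metis
    then show False using V[of "max N N'"] by (smt (verit) max.cobounded1 max.cobounded2)
  qed
  obtain D N' where D: "exp (- \<epsilon> * D) / C \<le> \<rho> \<xi> \<eta>"
    "\<And>n. n \<ge> N' \<Longrightarrow> D \<le> gp p (x n) (y n) + 4 * \<delta>"
    using visual_line[OF assms(1,2) ne assms(3,4)] by metis
  have "D \<le> V + 4 * \<delta>" using D(2)[of "max N N'"] V[of "max N N'"] by simp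
  then have "exp (- (\<epsilon> * (4 * \<delta>)) + - \<epsilon> * V) \<le> exp (- \<epsilon> * D)"
    using eps_pos mult_left_mono[of D "V + 4 * \<delta>" \<epsilon>] by (simp add: algebra_simps)
  then have "exp (- (\<epsilon> * (4 * \<delta>)) + - \<epsilon> * V) / C \<le> exp (- \<epsilon> * D) / C"
    using C_ge_1 by (simp add: divide_right_mono)
  then show ?thesis using D(1) unfolding c_lower_def exp_add by simp
qed

end

section \<open>Hausdorff measures\<close>

lemma rdiam_le:
  assumes "\<And>x y. x \<in> U \<Longrightarrow> y \<in> U \<Longrightarrow> \<rho> x y \<le> b"
  shows "rdiam \<rho> U \<le> ereal b"
  unfolding rdiam_def using assms by (auto intro!: Sup_least)

lemma rdiam_ge: "x \<in> U \<Longrightarrow> y \<in> U \<Longrightarrow> ereal (\<rho> x y) \<le> rdiam \<rho> U"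
  unfolding rdiam_def by (auto intro!: Sup_upper)

text \<open>The empty set has diameter \<open>-\<infinity>\<close>, which
  \<open>real_of_ereal\<close> sends to 0; the finite bound \<open>d\<close> excludes
  \<open>\<infinity>\<close>, which would be sent to 0 as well.\<close>

lemma real_rdiam_bounds:
  assumes "metric_on B \<rho>" "U \<subseteq> B" "rdiam \<rho> U \<le> ereal d" "0 \<le> d"
  shows "0 \<le> real_of_ereal (rdiam \<rho> U)" "real_of_ereal (rdiam \<rho> U) \<le> d"
    "\<And>x y. x \<in> U \<Longrightarrow> y \<in> U \<Longrightarrow> \<rho> x y \<le> real_of_ereal (rdiam \<rho> U)"
proof -
  have *: "U = {} \<or> (\<exists>r\<ge>0. rdiam \<rho> U = ereal r)"
  proof (cases "U = {}")
    case False
    then obtain x where x: "x \<in> U" by blast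
    then have "\<rho> x x = 0" using assms by (auto simp: metric_on_def)
    then have "0 \<le> rdiam \<rho> U" using rdiam_ge[OF x x, of \<rho>] by (simp add: zero_ereal_def)
    then show ?thesis using assms(3) by (cases "rdiam \<rho> U") auto
  qed simp
  have e: "rdiam \<rho> U = - \<infinity>" if "U = {}" using that by (simp add: rdiam_def bot_ereal_def)
  show "0 \<le> real_of_ereal (rdiam \<rho> U)" "real_of_ereal (rdiam \<rho> U) \<le> d"
    using * e assms(3,4) by auto
  show "\<rho> x y \<le> real_of_ereal (rdiam \<rho> U)" if "x \<in> U" "y \<in> U" for x y
    using * rdiam_ge[OF that, of \<rho>] that by auto
qed

lemma ennreal_eq_0_iff_less: "x = 0 \<longleftrightarrow> (\<forall>e>0. x < ennreal e)"
proof (cases x)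
  case (real r)
  then show ?thesis by (auto simp: ennreal_less_iff) (metis less_irrefl order_le_less)
qed (auto intro!: exI[of _ 1])

lemma hausdorff_null_iff:
  "hausdorff_measure \<rho> B s A = 0 \<longleftrightarrow>
     (\<forall>d>0. \<forall>e>0. \<exists>U. (\<forall>i. U i \<subseteq> B \<and> rdiam \<rho> (U i) \<le> ereal d) \<and> A \<subseteq> (\<Union>i. U i) \<and>
        (\<Sum>i. ennreal (real_of_ereal (rdiam \<rho> (U i)) powr s)) < ennreal e)"
    (is "_ \<longleftrightarrow> (\<forall>d>0. \<forall>e>0. ?P d e)")
proof -
  have "hausdorff_measure \<rho> B s A = 0 \<longleftrightarrow> (\<forall>d>0. hausdorff_approx \<rho> B s d A = 0)"
    unfolding hausdorff_measure_def bot_ennreal[symmetric] SUP_bot_conv by auto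
  moreover have "hausdorff_approx \<rho> B s d A = 0 \<longleftrightarrow> (\<forall>e>0. ?P d e)" for d
  proof -
    have "hausdorff_approx \<rho> B s d A = 0 \<longleftrightarrow> (\<forall>e>0. hausdorff_approx \<rho> B s d A < ennreal e)"
      by (rule ennreal_eq_0_iff_less)
    also have "\<dots> \<longleftrightarrow> (\<forall>e>0. ?P d e)"
      unfolding hausdorff_approx_def INF_less_iff by (simp add: Bex_def conj_assoc)
    finally show ?thesis .
  qed
  ultimately show ?thesis by simp
qed

lemma hausdorff_null_mono:
  assumes "hausdorff_measure \<rho> B s A = 0" "A' \<subseteq> A"
  shows "hausdorff_measure \<rho> B s A' = 0"
  using assms unfolding hausdorff_null_iff by (meson order_trans)

lemma hausdorff_null_exponent_mono:
  assumes metric: "metric_on B \<rho>" and null: "hausdorff_measure \<rho> B s A = 0" and "0 < s" "s \<le> s'"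
  shows "hausdorff_measure \<rho> B s' A = 0"
  unfolding hausdorff_null_iff
proof (intro allI impI)
  fix d e :: real
  assume "d > 0" "e > 0"
  \<comment> \<open>Diameters of at most 1 make \<open>powr\<close> decrease in the
    exponent.\<close>
  then have "min d 1 > 0" by simp
  with null \<open>e > 0\<close> obtain U where U: "\<And>i. U i \<subseteq> B" "\<And>i. rdiam \<rho> (U i) \<le> ereal (min d 1)"
    "A \<subseteq> (\<Union>i. U i)" "(\<Sum>i. ennreal (real_of_ereal (rdiam \<rho> (U i)) powr s)) < ennreal e"
    unfolding hausdorff_null_iff by meson
  have "real_of_ereal (rdiam \<rho> (U i)) powr s' \<le> real_of_ereal (rdiam \<rho> (U i)) powr s" for i
    using real_rdiam_bounds[OF metric U(1) U(2)] \<open>d > 0\<close> assms(3,4) by (intro powr_mono') auto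
  then have "(\<Sum>i. ennreal (real_of_ereal (rdiam \<rho> (U i)) powr s')) \<le>
      (\<Sum>i. ennreal (real_of_ereal (rdiam \<rho> (U i)) powr s))"
    by (intro suminf_le ennreal_leI) auto
  moreover have "rdiam \<rho> (U i) \<le> ereal d" for i
    using U(2)[of i] by (rule order_trans) simp
  ultimately show "\<exists>U. (\<forall>i. U i \<subseteq> B \<and> rdiam \<rho> (U i) \<le> ereal d) \<and> A \<subseteq> (\<Union>i. U i) \<and>
      (\<Sum>i. ennreal (real_of_ereal (rdiam \<rho> (U i)) powr s')) < ennreal e"
    using U(1,3,4) by (intro exI[of _ U]) auto
qed

lemma hausdorff_null_UN:
  fixes A :: "nat \<Rightarrow> 'b set"
  assumes "\<And>n. hausdorff_measure \<rho> B s (A n) = 0"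
  shows "hausdorff_measure \<rho> B s (\<Union>n. A n) = 0"
  unfolding hausdorff_null_iff
proof (intro allI impI)
  fix d e :: real
  assume d: "d > 0" and e: "e > 0"
  define w where "w U = ennreal (real_of_ereal (rdiam \<rho> U) powr s)" for U
  \<comment> \<open>Only \<open>e / 2\<close> is distributed among the covers, because summing
    infinitely many strict inequalities yields \<open>\<le>\<close>.\<close>
  have "\<exists>U. (\<forall>i. U i \<subseteq> B \<and> rdiam \<rho> (U i) \<le> ereal d) \<and> A n \<subseteq> (\<Union>i. U i) \<and>
      (\<Sum>i. w (U i)) < ennreal (e / 2 * (1 / 2) ^ Suc n)" for n
    using assms[of n] d e unfolding hausdorff_null_iff w_def by (auto simp del: power_Suc)
  then obtain U where U: "\<And>n i. U n i \<subseteq> B" "\<And>n i. rdiam \<rho> (U n i) \<le> ereal d"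
    "\<And>n. A n \<subseteq> (\<Union>i. U n i)" "\<And>n. (\<Sum>i. w (U n i)) < ennreal (e / 2 * (1 / 2) ^ Suc n)"
    by metis
  define V where "V k = (case prod_decode k of (n, i) \<Rightarrow> U n i)" for k
  have "(\<Sum>k. w (V k)) = (\<Sum>k. (\<lambda>(n, i). w (U n i)) (prod_decode k))"
    by (simp add: V_def case_prod_unfold)
  also have "\<dots> = (\<Sum>n. \<Sum>i. w (U n i))"
    by (rule suminf_ennreal_2dimen) simp
  also have "\<dots> \<le> (\<Sum>n. ennreal (e / 2 * (1 / 2) ^ Suc n))"
    using U(4) by (intro suminf_le) (auto intro: less_imp_le)
  also have "\<dots> = ennreal (e / 2)"
    using sums_mult[OF power_half_series, of "e / 2"] e by (intro suminf_ennreal_eq) auto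
  also have "\<dots> < ennreal e" using e by (simp add: ennreal_less_iff)
  finally have "(\<Sum>k. w (V k)) < ennreal e" .
  moreover have "\<forall>k. V k \<subseteq> B \<and> rdiam \<rho> (V k) \<le> ereal d"
    using U(1,2) by (simp add: V_def case_prod_unfold)
  moreover have "(\<Union>n. A n) \<subseteq> (\<Union>k. V k)"
  proof
    fix x assume "x \<in> (\<Union>n. A n)"
    then obtain n i where "x \<in> U n i" using U(3) by blast
    then have "x \<in> V (prod_encode (n, i))" by (simp add: V_def)
    then show "x \<in> (\<Union>k. V k)" by blast
  qed
  ultimately show "\<exists>U. (\<forall>i. U i \<subseteq> B \<and> rdiam \<rho> (U i) \<le> ereal d) \<and> (\<Union>n. A n) \<subseteq> (\<Union>i. U i) \<and>
      (\<Sum>i. ennreal (real_of_ereal (rdiam \<rho> (U i)) powr s)) < ennreal e"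
    unfolding w_def by blast
qed

lemma hausdorff_null_Un:
  assumes "hausdorff_measure \<rho> B s A = 0" "hausdorff_measure \<rho> B s A' = 0"
  shows "hausdorff_measure \<rho> B s (A \<union> A') = 0"
proof -
  have "hausdorff_measure \<rho> B s (\<Union>n::nat. if n = 0 then A else A') = 0"
    using assms by (intro hausdorff_null_UN) simp
  moreover have "A \<union> A' \<subseteq> (\<Union>n::nat. if n = 0 then A else A')"
    by (auto split: if_splits)
  ultimately show ?thesis by (rule hausdorff_null_mono)
qed

text \<open>The easy half of Borel-Cantelli: the sets from \<open>m\<close> on cover
  \<open>A\<close>, and for large \<open>m\<close> their total weight is below \<open>e\<close>; the
  diameters become small because the summands tend to 0.\<close>

lemma hausdorff_null_limsup:
  fixes U :: "nat \<Rightarrow> 'b set" and b :: "nat \<Rightarrow> real"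
  assumes metric: "metric_on B \<rho>" and s: "s > 0" and U: "\<And>i. U i \<subseteq> B"
    and b: "\<And>i x y. x \<in> U i \<Longrightarrow> y \<in> U i \<Longrightarrow> \<rho> x y \<le> b i" "\<And>i. 0 \<le> b i"
    and sum: "summable (\<lambda>i. b i powr s)"
    and A: "\<And>x m. x \<in> A \<Longrightarrow> \<exists>i\<ge>m. x \<in> U i"
  shows "hausdorff_measure \<rho> B s A = 0"
  unfolding hausdorff_null_iff
proof (intro allI impI)
  fix d e :: real
  assume d: "d > 0" and e: "e > 0"
  have "eventually (\<lambda>i. b i powr s < d powr s) sequentially"
    using summable_LIMSEQ_zero[OF sum] d by (intro order_tendstoD(2)) auto
  moreover have "eventually (\<lambda>m. norm (\<Sum>i. b (i + m) powr s) < e) sequentially"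
    using suminf_exist_split[OF e sum] by (auto simp: eventually_sequentially)
  ultimately have "eventually (\<lambda>m. (\<forall>i\<ge>m. b i powr s < d powr s) \<and> norm (\<Sum>i. b (i + m) powr s) < e) sequentially"
    by (auto intro: eventually_conj eventually_all_ge_at_top)
  then obtain m where m: "\<And>i. i \<ge> m \<Longrightarrow> b i powr s < d powr s" "norm (\<Sum>i. b (i + m) powr s) < e"
    unfolding eventually_sequentially by blast
  have bd: "b (i + m) \<le> d" for i
    using m(1)[of "i + m"] powr_mono2[of s d "b (i + m)"] s d by force
  have rd: "rdiam \<rho> (U (i + m)) \<le> ereal (b (i + m))" for i
    using b by (intro rdiam_le) auto
  have "(\<Sum>i. ennreal (real_of_ereal (rdiam \<rho> (U (i + m))) powr s)) \<le> (\<Sum>i. ennreal (b (i + m) powr s))"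
    using real_rdiam_bounds[OF metric U rd b(2)] s
    by (intro suminf_le ennreal_leI powr_mono2) auto
  also have "\<dots> = ennreal (\<Sum>i. b (i + m) powr s)"
    using summable_ignore_initial_segment[OF sum] by (intro suminf_ennreal2) auto
  also have "\<dots> < ennreal e" using m(2) e by (auto simp: ennreal_less_iff intro!: ennreal_lessI)
  finally have "(\<Sum>i. ennreal (real_of_ereal (rdiam \<rho> (U (i + m))) powr s)) < ennreal e" .
  moreover have "\<forall>i. U (i + m) \<subseteq> B \<and> rdiam \<rho> (U (i + m)) \<le> ereal d"
    using U rd bd by (meson ereal_less_eq(3) order_trans)
  moreover have "A \<subseteq> (\<Union>i. U (i + m))"
  proof
    fix x assume "x \<in> A"
    then obtain i where "i \<ge> m" "x \<in> U i" using A by blast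
    then have "x \<in> U (i - m + m)" by simp
    then show "x \<in> (\<Union>i. U (i + m))" by blast
  qed
  ultimately show "\<exists>U. (\<forall>i. U i \<subseteq> B \<and> rdiam \<rho> (U i) \<le> ereal d) \<and> A \<subseteq> (\<Union>i. U i) \<and>
      (\<Sum>i. ennreal (real_of_ereal (rdiam \<rho> (U i)) powr s)) < ennreal e"
    by (intro exI[of _ "\<lambda>i. U (i + m)"]) blast
qed

text \<open>The weight of the cylinders, relative to the uniform probability on a node of the tree of
  prefixes, is below \<open>1\<close> at the root, and it is the average of its values at the children; so it
  can be kept below \<open>1\<close> along a branch.\<close>

lemma ex_branch_avoiding_cylinders:
  fixes A :: "'c set" and c :: "nat \<Rightarrow> nat \<Rightarrow> 'c" and k :: "nat \<Rightarrow> nat"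
  assumes fin: "finite A" and N: "card A > 0"
    and c: "\<And>i j. c i j \<in> A"
    and small: "(\<Sum>i. ennreal ((1 / real (card A)) ^ k i)) < 1"
  shows "\<exists>b. (\<forall>j. b j \<in> A) \<and> (\<forall>i. \<exists>j<k i. b j \<noteq> c i j)"
proof -
  define q where "q = 1 / real (card A)"
  have q: "0 < q" "real (card A) * q = 1" using N by (auto simp: q_def)
  define m where "m n a i = (if \<forall>j<min n (k i). a j = c i j then q ^ (k i - n) else 0)"
    for n and a :: "nat \<Rightarrow> 'c" and i
  define F where "F n a = (\<Sum>i. ennreal (m n a i))" for n a
  have m_nonneg: "0 \<le> m n a i" for n a i using q by (simp add: m_def)
  have m_step: "(\<Sum>x\<in>A. m (Suc n) (a(n := x)) i) \<le> real (card A) * m n a i" for n a i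
  proof (cases "\<forall>j<min n (k i). a j = c i j")
    case False
    then have "m (Suc n) (a(n := x)) i = 0" for x
      by (auto simp: m_def)
    then show ?thesis using m_nonneg by simp
  next
    case True
    show ?thesis
    proof (cases "k i \<le> n")
      case True
      then have "m (Suc n) (a(n := x)) i \<le> 1" for x by (simp add: m_def)
      then have "(\<Sum>x\<in>A. m (Suc n) (a(n := x)) i) \<le> real (card A)"
        using sum_bounded_above[of A "\<lambda>x. m (Suc n) (a(n := x)) i" 1] by simp
      moreover have "m n a i = 1"
        using True \<open>\<forall>j<min n (k i). a j = c i j\<close> by (simp add: m_def)
      ultimately show ?thesis by simp
    next
      case False
      have "m (Suc n) (a(n := x)) i \<le> (if x = c i n then q ^ (k i - Suc n) else 0)" for x
        using False q by (auto simp: m_def)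
      then have "(\<Sum>x\<in>A. m (Suc n) (a(n := x)) i) \<le> (\<Sum>x\<in>A. if x = c i n then q ^ (k i - Suc n) else 0)"
        by (rule sum_mono)
      also have "\<dots> = q ^ (k i - Suc n)" using fin c by simp
      also have "\<dots> = real (card A) * q * q ^ (k i - Suc n)" using q by simp
      also have "\<dots> = real (card A) * q ^ (k i - n)"
        using False by (metis Suc_diff_Suc mult.assoc not_le power_Suc)
      finally show ?thesis using True by (simp add: m_def)
    qed
  qed
  have step: "\<exists>x\<in>A. F (Suc n) (a(n := x)) < 1" if "F n a < 1" for n a
  proof (rule ccontr)
    assume "\<not> ?thesis"
    then have "(\<Sum>x\<in>A. F (Suc n) (a(n := x))) \<ge> (\<Sum>x\<in>A. 1)"
      by (intro sum_mono) (auto simp: not_less)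
    moreover have "(\<Sum>x\<in>A. F (Suc n) (a(n := x))) = (\<Sum>i. \<Sum>x\<in>A. ennreal (m (Suc n) (a(n := x)) i))"
      unfolding F_def by (intro suminf_sum[symmetric]) auto
    moreover have "\<dots> \<le> (\<Sum>i. ennreal (real (card A)) * ennreal (m n a i))"
      using m_step m_nonneg
      by (intro suminf_le) (auto simp: sum_ennreal simp flip: ennreal_mult intro!: ennreal_leI)
    moreover have "\<dots> = ennreal (real (card A)) * F n a"
      unfolding F_def by simp
    moreover have "\<dots> < ennreal (real (card A)) * 1"
      using that N by (intro ennreal_mult_strict_left_mono) auto
    ultimately show False by (simp add: ennreal_of_nat_eq_real_of_nat)
  qed
  obtain x0 where x0: "x0 \<in> A" using N by (metis card_gt_0_iff ex_in_conv)
  have "\<exists>f. \<forall>n. (F n (f n) < 1 \<and> (\<forall>j. f n j \<in> A)) \<and> (\<exists>x\<in>A. f (Suc n) = (f n)(n := x))"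
  proof (rule dependent_nat_choice)
    show "\<exists>a. F 0 a < 1 \<and> (\<forall>j. a j \<in> A)"
      using small x0 by (intro exI[of _ "\<lambda>_. x0"]) (simp add: F_def m_def q_def)
    show "\<exists>a'. (F (Suc n) a' < 1 \<and> (\<forall>j. a' j \<in> A)) \<and> (\<exists>x\<in>A. a' = a(n := x))"
      if a: "F n a < 1 \<and> (\<forall>j. a j \<in> A)" for a n
    proof -
      obtain x where x: "x \<in> A" "F (Suc n) (a(n := x)) < 1" using step a by blast
      then show ?thesis using a by (intro exI[of _ "a(n := x)"]) auto
    qed
  qed
  then obtain f where "\<forall>n. (F n (f n) < 1 \<and> (\<forall>j. f n j \<in> A)) \<and> (\<exists>x\<in>A. f (Suc n) = (f n)(n := x))"
    by (elim exE)
  then have f: "\<And>n. F n (f n) < 1" "\<And>n j. f n j \<in> A" "\<And>n. \<exists>x\<in>A. f (Suc n) = (f n)(n := x)"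
    by simp_all
  have stable: "f n j = f (Suc j) j" if "j < n" for n j
    using that
  proof (induction n)
    case (Suc n)
    then show ?case using f(3)[of n] by (cases "j = n") auto
  qed simp
  \<comment> \<open>On a branch inside the cylinder \<open>i\<close> the weight at stage
    \<open>k i\<close> would be the full 1, while the total stays below 1.\<close>
  have "\<exists>j<k i. f (Suc j) j \<noteq> c i j" for i
  proof (rule ccontr)
    assume "\<not> ?thesis"
    then have "\<forall>j<k i. f (k i) j = c i j" using stable[of _ "k i"] by metis
    then have "m (k i) (f (k i)) i = 1" by (simp add: m_def)
    moreover have "ennreal (m (k i) (f (k i)) i) \<le> F (k i) (f (k i))"
      unfolding F_def using sum_le_suminf[of "\<lambda>j. ennreal (m (k i) (f (k i)) j)" "{i}"] by simp
    ultimately show False using f(1)[of "k i"] by simp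
  qed
  then show ?thesis using f(2) by (intro exI[of _ "\<lambda>j. f (Suc j) j"]) blast
qed

text \<open>A mass distribution argument in which a branching argument replaces the measure. By
  \<open>sep\<close>, the addresses whose codes fall into a set of diameter \<open>D i\<close> agree
  up to the first level where \<open>\<kappa> * \<theta> ^ Suc k\<close> drops to
  \<open>D i\<close>, so each covering set blocks one cylinder; \<open>mass\<close> bounds the
  uniform probability of that cylinder by a multiple of \<open>D i powr s\<close>. If the sum is
  small, a branch avoids all cylinders and its code is not covered.\<close>

lemma hausdorff_measure_Cantor_pos:
  fixes A :: "'c set" and code :: "(nat \<Rightarrow> 'c) \<Rightarrow> 'b"
  assumes metric: "metric_on B \<rho>" and fin: "finite A" and N: "2 \<le> card A"
    and code: "\<And>a. (\<And>j. a j \<in> A) \<Longrightarrow> code a \<in> Z"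
    and sep: "\<And>a b k. (\<And>j. a j \<in> A) \<Longrightarrow> (\<And>j. b j \<in> A) \<Longrightarrow> (\<And>j. j < k \<Longrightarrow> a j = b j) \<Longrightarrow> a k \<noteq> b k \<Longrightarrow>
      \<kappa> * \<theta> ^ Suc k \<le> \<rho> (code a) (code b)"
    and \<kappa>: "0 < \<kappa>" and \<theta>: "0 < \<theta>" "\<theta> < 1" and s: "0 < s" and mass: "1 \<le> real (card A) * \<theta> powr s"
  shows "hausdorff_measure \<rho> B s Z \<noteq> 0"
proof
  assume null: "hausdorff_measure \<rho> B s Z = 0"
  \<comment> \<open>From \<open>\<kappa> * \<theta> ^ Suc k \<le> D i\<close> it follows that
    \<open>(\<theta> ^ k) powr s\<close> is at most \<open>D i powr s / c1\<close>; a cover of total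
    weight below \<open>c1 / 2\<close> therefore blocks less than half of the probability.\<close>
  define c1 where "c1 = (\<kappa> * \<theta>) powr s"
  have c1: "c1 > 0" using \<kappa> \<theta> by (simp add: c1_def)
  obtain U where U: "\<And>i. U i \<subseteq> B" "\<And>i. rdiam \<rho> (U i) \<le> ereal (\<kappa> / 2)" "Z \<subseteq> (\<Union>i. U i)"
    "(\<Sum>i. ennreal (real_of_ereal (rdiam \<rho> (U i)) powr s)) < ennreal (c1 / 2)"
    using null \<kappa> c1 unfolding hausdorff_null_iff by (meson half_gt_zero)
  define D where "D i = real_of_ereal (rdiam \<rho> (U i))" for i
  have D: "0 \<le> D i" "D i \<le> \<kappa> / 2" "\<And>x y. x \<in> U i \<Longrightarrow> y \<in> U i \<Longrightarrow> \<rho> x y \<le> D i" for i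
    unfolding D_def using real_rdiam_bounds[OF metric U(1) U(2)] \<kappa> by auto
  have ex: "\<exists>k. \<kappa> * \<theta> ^ Suc k \<le> D i" if "D i > 0" for i
  proof -
    have "D i / \<kappa> > 0" using that \<kappa> by simp
    then obtain k where "\<theta> ^ k < D i / \<kappa>" using real_arch_pow_inv \<theta> by blast
    then have "\<kappa> * \<theta> ^ k \<le> D i" using \<kappa> by (simp add: field_simps)
    moreover have "\<theta> ^ Suc k \<le> \<theta> ^ k" using \<theta> by (intro power_decreasing) auto
    ultimately show ?thesis using \<kappa> by (intro exI[of _ k]) (meson mult_le_cancel_left_pos order_trans)
  qed
  \<comment> \<open>A set of diameter 0 contains the code of at most one address, so its cylinder
    may be taken as deep as desired; depth \<open>i + 2\<close> makes these cylinders weigh at most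
    1/2 together.\<close>
  define k where "k i = (if D i > 0 then LEAST k. \<kappa> * \<theta> ^ Suc k \<le> D i else i + 2)" for i
  have k1: "\<kappa> * \<theta> ^ Suc (k i) \<le> D i" if "D i > 0" for i
    unfolding k_def using that LeastI_ex[OF ex[OF that]] by simp
  have k2: "D i < \<kappa> * \<theta> ^ Suc j" if "j < k i" for i j
  proof (cases "D i > 0")
    case True
    then show ?thesis using that not_less_Least[of j "\<lambda>k. \<kappa> * \<theta> ^ Suc k \<le> D i"]
      by (simp add: k_def not_le)
  next
    case False
    moreover have "0 < \<kappa> * \<theta> ^ Suc j" using \<kappa> \<theta> by simp
    ultimately show ?thesis by linarith
  qed
  have agree: "a j = b j" if "\<And>j. a j \<in> A" "\<And>j. b j \<in> A" "code a \<in> U i" "code b \<in> U i" "j < k i" for a b i j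
  proof (rule ccontr)
    assume ne: "a j \<noteq> b j"
    define l where "l = (LEAST l. a l \<noteq> b l)"
    have l: "a l \<noteq> b l" "\<And>l'. l' < l \<Longrightarrow> a l' = b l'" "l \<le> j"
      unfolding l_def using LeastI[of "\<lambda>l. a l \<noteq> b l", OF ne] not_less_Least[of _ "\<lambda>l. a l \<noteq> b l"]
        Least_le[of "\<lambda>l. a l \<noteq> b l", OF ne] by blast+
    have "\<kappa> * \<theta> ^ Suc l \<le> \<rho> (code a) (code b)" using sep that l by blast
    also have "\<dots> \<le> D i" using D(3) that by blast
    also have "\<dots> < \<kappa> * \<theta> ^ Suc l" using k2 l(3) that(5) by simp
    finally show False by simp
  qed
  obtain x0 where x0: "x0 \<in> A" using N by fastforce
  \<comment> \<open>An address whose code lies in \<open>U i\<close>. A set that contains no code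
    receives a constant address, since the branching lemma takes a cylinder for every index.\<close>
  define c where "c i = (if \<exists>a. (\<forall>j. a j \<in> A) \<and> code a \<in> U i
    then SOME a. (\<forall>j. a j \<in> A) \<and> code a \<in> U i else (\<lambda>_. x0))" for i
  have c: "(\<forall>j. c i j \<in> A) \<and> code (c i) \<in> U i" if "\<exists>a. (\<forall>j. a j \<in> A) \<and> code a \<in> U i" for i
    using someI_ex[OF that] that unfolding c_def by simp
  have cA: "c i j \<in> A" for i j
    using c[of i] x0 by (cases "\<exists>a. (\<forall>j. a j \<in> A) \<and> code a \<in> U i") (auto simp: c_def)
  have weight: "(1 / real (card A)) ^ k i \<le> D i powr s / c1 + 1 / 2 * (1 / 2) ^ Suc i" for i
  proof (cases "D i > 0")
    case True
    have "1 / real (card A) \<le> \<theta> powr s" using mass N by (simp add: field_simps)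
    then have "(1 / real (card A)) ^ k i \<le> (\<theta> powr s) ^ k i" by (intro power_mono) auto
    also have "\<dots> = (\<theta> ^ k i) powr s"
      using \<theta> by (simp add: powr_powr mult.commute flip: powr_realpow)
    also have "\<dots> = (\<kappa> * \<theta> ^ Suc (k i)) powr s / c1"
      using \<kappa> \<theta> by (simp add: c1_def powr_mult field_simps)
    also have "\<dots> \<le> D i powr s / c1"
      using k1[OF True] c1 \<kappa> \<theta> s by (intro divide_right_mono powr_mono2) auto
    also have "\<dots> \<le> D i powr s / c1 + 1 / 2 * (1 / 2) ^ Suc i" by simp
    finally show ?thesis .
  next
    case False
    have "(1 / real (card A)) ^ k i \<le> (1 / 2) ^ (i + 2)"
      using False N by (auto simp: k_def simp del: power_Suc intro!: power_mono)
    also have "\<dots> = 1 / 2 * (1 / 2) ^ Suc i" by simp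
    finally show ?thesis using c1 by (smt (verit) divide_nonneg_pos powr_ge_zero)
  qed
  have "(\<Sum>i. ennreal ((1 / real (card A)) ^ k i)) \<le>
      (\<Sum>i. ennreal (1 / c1) * ennreal (D i powr s) + ennreal (1 / 2 * (1 / 2) ^ Suc i))"
    using weight c1
    by (intro suminf_le) (auto simp flip: ennreal_mult ennreal_plus simp del: power_Suc intro!: ennreal_leI)
  also have "\<dots> = ennreal (1 / c1) * (\<Sum>i. ennreal (D i powr s)) + (\<Sum>i. ennreal (1 / 2 * (1 / 2) ^ Suc i))"
    by (simp add: suminf_add[symmetric] del: power_Suc)
  also have "(\<Sum>i. ennreal (1 / 2 * (1 / 2) ^ Suc i)) = ennreal (1 / 2)"
    using sums_mult[OF power_half_series, of "1 / 2"] by (intro suminf_ennreal_eq) auto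
  also have "ennreal (1 / c1) * (\<Sum>i. ennreal (D i powr s)) + ennreal (1 / 2) <
      ennreal (1 / c1) * ennreal (c1 / 2) + ennreal (1 / 2)"
    using U(4) c1 unfolding D_def
    by (simp add: ennreal_mult_strict_left_mono)
  also have "\<dots> = 1"
  proof -
    have "ennreal (1 / c1) * ennreal (c1 / 2) = ennreal (1 / c1 * (c1 / 2))"
      by (rule ennreal_mult[symmetric]) (use c1 in auto)
    moreover have "1 / c1 * (c1 / 2) = 1 / 2" using c1 by simp
    moreover have "ennreal (1 / 2) + ennreal (1 / 2) = ennreal (1 / 2 + 1 / 2)"
      by (rule ennreal_plus[symmetric]) auto
    moreover have "ennreal (1 / 2 + 1 / 2) = 1" by (simp only: field_sum_of_halves ennreal_1)
    ultimately show ?thesis by (simp only:)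
  qed
  finally have "(\<Sum>i. ennreal ((1 / real (card A)) ^ k i)) < 1" .
  then have "\<exists>b. (\<forall>j. b j \<in> A) \<and> (\<forall>i. \<exists>j<k i. b j \<noteq> c i j)"
    by (intro ex_branch_avoiding_cylinders fin cA) (use N in linarith)
  then obtain b where b': "\<forall>j. b j \<in> A" "\<forall>i. \<exists>j<k i. b j \<noteq> c i j"
    by (elim exE conjE)
  then have b: "\<And>j. b j \<in> A" by simp
  have "code b \<in> Z" by (rule code) (rule b)
  then obtain i where i: "code b \<in> U i" using U(3) by blast
  then have ci: "\<And>j. c i j \<in> A" "code (c i) \<in> U i" using b'(1) c[of i] by blast+
  obtain j where "j < k i" "b j \<noteq> c i j" using b'(2) by blast
  moreover have "b j = c i j" by (rule agree[OF b ci(1) i ci(2) \<open>j < k i\<close>])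
  ultimately show False by simp
qed

section \<open>Isometric actions and local quasigeodesics\<close>

locale hyperbolic_action = hyperbolic_space p \<delta> for p :: "'a::heine_borel" and \<delta> +
  fixes \<Gamma> :: "('g, 'm) monoid_scheme" (structure) and act :: "'g \<Rightarrow> 'a \<Rightarrow> 'a"
  assumes isometric: "isometric_action \<Gamma> act"
    and proper: "properly_discontinuous \<Gamma> act"
begin

sublocale group \<Gamma>
  using isometric by (simp add: isometric_action_def)

definition len :: "'g \<Rightarrow> real" where "len g = dist p (act g p)"

lemma act_mult [simp]: "g \<in> carrier \<Gamma> \<Longrightarrow> h \<in> carrier \<Gamma> \<Longrightarrow> act (g \<otimes> h) x = act g (act h x)"
  using isometric by (simp add: isometric_action_def)

lemma act_one [simp]: "act \<one> x = x"
  using isometric by (simp add: isometric_action_def)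

lemma dist_act [simp]: "g \<in> carrier \<Gamma> \<Longrightarrow> dist (act g x) (act g y) = dist x y"
  using isometric by (simp add: isometric_action_def)

lemma act_inv [simp]: "g \<in> carrier \<Gamma> \<Longrightarrow> act (inv g) (act g x) = x"
  by (metis act_mult act_one inv_closed l_inv)

lemma act_inv' [simp]: "g \<in> carrier \<Gamma> \<Longrightarrow> act g (act (inv g) x) = x"
  by (metis act_mult act_one inv_closed r_inv)

lemma gp_act [simp]: "g \<in> carrier \<Gamma> \<Longrightarrow> gp (act g w) (act g x) (act g y) = gp w x y"
  by (simp add: gromov_product_def)

lemma dist_act_left: "g \<in> carrier \<Gamma> \<Longrightarrow> dist (act g x) y = dist x (act (inv g) y)"
  by (metis act_inv' dist_act)

lemma gp_act_base: "g \<in> carrier \<Gamma> \<Longrightarrow> gp (act g w) x y = gp w (act (inv g) x) (act (inv g) y)"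
  by (metis act_inv' gp_act)

lemma dist_orbit: "g \<in> carrier \<Gamma> \<Longrightarrow> h \<in> carrier \<Gamma> \<Longrightarrow> dist (act g p) (act h p) = len (inv g \<otimes> h)"
  by (simp add: len_def dist_act_left)

lemma len_nonneg: "0 \<le> len g"
  by (simp add: len_def)

lemma len_one [simp]: "len \<one> = 0"
  by (simp add: len_def)

lemma len_inv [simp]: "g \<in> carrier \<Gamma> \<Longrightarrow> len (inv g) = len g"
  unfolding len_def using dist_act[of g p "act (inv g) p"] by (simp add: dist_commute)

lemma len_mult_le: "g \<in> carrier \<Gamma> \<Longrightarrow> h \<in> carrier \<Gamma> \<Longrightarrow> len (g \<otimes> h) \<le> len g + len h"
  unfolding len_def using dist_triangle[of p "act g (act h p)" "act g p"] by simp

lemma finite_len_le: "finite {g \<in> carrier \<Gamma>. len g \<le> r}"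
proof (rule finite_subset)
  let ?K = "cball p (max r 0)"
  show "finite {g \<in> carrier \<Gamma>. act g ` ?K \<inter> ?K \<noteq> {}}"
    using proper by (simp add: properly_discontinuous_def)
  have "act g p \<in> act g ` ?K \<inter> ?K" if "len g \<le> r" for g
    using that by (auto simp: len_def)
  then show "{g \<in> carrier \<Gamma>. len g \<le> r} \<subseteq> {g \<in> carrier \<Gamma>. act g ` ?K \<inter> ?K \<noteq> {}}"
    by blast
qed

lemma finite_len_bound:
  assumes "finite S"
  obtains L where "\<And>u. u \<in> S \<Longrightarrow> len u \<le> L"
proof -
  have "\<forall>u\<in>S. len u \<le> sum len S" using assms by (auto intro: member_le_sum simp: len_nonneg)
  then show thesis using that by blast
qed

lemma seq_equiv_act:
  assumes "seq_equiv p x y" "g \<in> carrier \<Gamma>"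
  shows "seq_equiv p (\<lambda>n. act g (x n)) (\<lambda>n. act g (y n))"
  unfolding seq_equiv_def
proof
  fix M
  obtain N where N: "\<And>m n. m \<ge> N \<Longrightarrow> n \<ge> N \<Longrightarrow> gp p (x m) (y n) \<ge> M + len g"
    using assms unfolding seq_equiv_def by metis
  have "M \<le> gp p (act g (x m)) (act g (y n))" if "m \<ge> N" "n \<ge> N" for m n
    using N[OF that] gp_change_base[of "act g p" "act g (x m)" "act g (y n)" p] assms(2)
    by (simp add: len_def dist_commute)
  then show "\<exists>N. \<forall>m\<ge>N. \<forall>n\<ge>N. M \<le> gp p (act g (x m)) (act g (y n))" by blast
qed

section \<open>Orbit paths of words\<close>

primrec word :: "(nat \<Rightarrow> 'g) \<Rightarrow> nat \<Rightarrow> 'g" where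
  "word s 0 = \<one>"
| "word s (Suc n) = word s n \<otimes> s n"

lemma word_closed: "(\<And>i. i < n \<Longrightarrow> s i \<in> carrier \<Gamma>) \<Longrightarrow> word s n \<in> carrier \<Gamma>"
  by (induction n) auto

lemma word_cong: "(\<And>i. i < n \<Longrightarrow> s i = s' i) \<Longrightarrow> word s n = word s' n"
  by (induction n) auto

lemma word_const: "word (\<lambda>_. g) n = g [^] n"
  by (induction n) auto

lemma dist_word_Suc:
  assumes "\<And>i. i \<le> n \<Longrightarrow> s i \<in> carrier \<Gamma>"
  shows "dist (act (word s n) p) (act (word s (Suc n)) p) = len (s n)"
proof -
  have "word s n \<in> carrier \<Gamma>" using assms by (intro word_closed) auto
  then show ?thesis using assms[of n] by (simp add: len_def)
qed

lemma gp_word_Suc: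
  assumes "\<And>i. i \<le> Suc n \<Longrightarrow> s i \<in> carrier \<Gamma>"
  shows "gp (act (word s (Suc n)) p) (act (word s n) p) (act (word s (Suc (Suc n))) p) =
    gp p (act (inv (s n)) p) (act (s (Suc n)) p)"
proof -
  have w: "word s n \<in> carrier \<Gamma>" using assms by (intro word_closed) auto
  have *: "s n \<in> carrier \<Gamma>" "s (Suc n) \<in> carrier \<Gamma>" using assms by auto
  then have "act (word s n) p = act (word s n) (act (s n) (act (inv (s n)) p))" by simp
  then show ?thesis using w * gp_act_base[of "s n" p p "act (s n) (act (s (Suc n)) p)"] by simp
qed

text \<open>These are the hypotheses of the chain lemmas for the orbit points of the prefixes,
  translated back to \<open>p\<close>. They involve adjacent letters only, so compatible letters can
  be concatenated freely.\<close>

definition admissible :: "real \<Rightarrow> (nat \<Rightarrow> 'g) \<Rightarrow> nat \<Rightarrow> bool" where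
  "admissible K s n \<longleftrightarrow> (\<forall>i<n. s i \<in> carrier \<Gamma> \<and> 2 * K + 4 * \<delta> + 1 \<le> len (s i)) \<and>
     (\<forall>i. Suc i < n \<longrightarrow> gp p (act (inv (s i)) p) (act (s (Suc i)) p) \<le> K)"

lemma admissible_chain:
  assumes "admissible K s n"
  shows "i + 2 \<le> n \<Longrightarrow> gp (act (word s (Suc i)) p) (act (word s i) p) (act (word s (Suc (Suc i))) p) \<le> K"
    and "i < n \<Longrightarrow> 2 * K + 4 * \<delta> + 1 \<le> dist (act (word s i) p) (act (word s (Suc i)) p)"
  using assms gp_word_Suc[of i s] dist_word_Suc[of i s] unfolding admissible_def by auto

lemma admissible_gp:
  assumes "admissible K s n" "i < j" "j < k" "k \<le> n"
  shows "gp (act (word s j) p) (act (word s i) p) (act (word s k) p) \<le> K + 2 * \<delta>"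
  using chain_gp[of n "\<lambda>i. act (word s i) p" K] admissible_chain[OF assms(1)] assms(2-) by blast

lemma admissible_len_first:
  assumes "admissible K s n" "0 < j" "j \<le> n"
  shows "len (s 0) + (real j - 1) \<le> len (word s j)"
proof -
  have "dist (act (word s 0) p) (act (word s 1) p) + (real j - 1) \<le> dist (act (word s 0) p) (act (word s j) p)"
    using chain_dist_first[of n "\<lambda>i. act (word s i) p" K j] admissible_chain[OF assms(1)] assms(2-) by blast
  moreover have "s 0 \<in> carrier \<Gamma>" using assms by (auto simp: admissible_def)
  ultimately show ?thesis by (simp add: len_def)
qed

lemma admissible_len_ge:
  assumes "admissible K s n" "0 \<le> K" "j \<le> n"
  shows "real j \<le> len (word s j)"
proof (cases "j = 0")
  case False
  then have "2 * K + 4 * \<delta> + 1 \<le> len (s 0)" using assms by (auto simp: admissible_def)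
  then show ?thesis using admissible_len_first[of K s n j] assms False delta_nonneg by simp
qed simp

text \<open>By \<open>gp_flip\<close>, a small product at an intermediate point of the orbit path is
  a nearly maximal product at \<open>p\<close>: geodesics from \<open>p\<close> to a later point
  pass close to it.\<close>

lemma admissible_gp_word:
  assumes "admissible K s n" "i \<le> j" "j \<le> n" "0 \<le> K"
  shows "len (word s i) - K - 2 * \<delta> \<le> gp p (act (word s i) p) (act (word s j) p)"
proof (cases "0 < i \<and> i < j")
  case True
  then have "gp (act (word s i) p) (act (word s 0) p) (act (word s j) p) \<le> K + 2 * \<delta>"
    using admissible_gp[of K s n 0 i j] assms by simp
  then show ?thesis
    using gp_flip[of p "act (word s i) p" "act (word s j) p"] by (simp add: len_def)
next
  case False
  then show ?thesis
    using assms delta_nonneg gp_nonneg[of p p "act (word s j) p"] by (cases "i = 0") (auto simp: len_def)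
qed

end

text \<open>A situation to be excluded: all of \<open>\<Gamma>\<close> fixes the boundary point of
  \<open>z\<close>. At most one further limit point is then possible, whereas a non-elementary
  action has three.\<close>

locale fixed_boundary_point = hyperbolic_action p \<delta> \<Gamma> act
  for p :: "'a::heine_borel" and \<delta> and \<Gamma> :: "('g, 'm) monoid_scheme" (structure) and act +
  fixes z :: "nat \<Rightarrow> 'a"
  assumes conv: "conv_at_infinity p z"
    and fixed: "u \<in> carrier \<Gamma> \<Longrightarrow> seq_equiv p (\<lambda>m. act u (z m)) z"
begin

lemma eventually_gp_act:
  assumes "u \<in> carrier \<Gamma>"
  shows "\<forall>\<^sub>F m in sequentially. M \<le> gp p (act u (z m)) (z m)"
  using fixed[OF assms] unfolding seq_equiv_def eventually_sequentially by blast

text \<open>A coarse Busemann function: the differences stabilise up to \<open>2 * \<delta>\<close>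
  as soon as the far points \<open>a\<close> and \<open>b\<close> agree on the scale
  \<open>dist p x\<close>.\<close>

lemma horofunction_close:
  fixes x :: 'a
  assumes "dist p x \<le> gp p a b"
  shows "\<bar>(dist x a - dist p a) - (dist x b - dist p b)\<bar> \<le> 2 * \<delta>"
proof -
  have "dist x a - dist p a = dist p x - 2 * gp p x a" "dist x b - dist p b = dist p x - 2 * gp p x b"
    by (simp_all add: gromov_product_def field_simps)
  moreover have "gp p x a \<le> dist p x" "gp p x b \<le> dist p x" by (auto intro: gp_le_dist)
  ultimately show ?thesis
    using hyp[of p x b a] hyp[of p x a b] assms by (simp add: gp_commute[of p b a])
qed

text \<open>The Busemann cocycle at the fixed point. In a coarse setting the differences need not
  converge, so some value within \<open>2 * \<delta>\<close> of all late ones is chosen.\<close>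

definition shift :: "'g \<Rightarrow> real" where
  "shift u = (SOME B. \<forall>\<^sub>F m in sequentially. \<bar>dist (act u p) (z m) - dist p (z m) - B\<bar> \<le> 2 * \<delta>)"

lemma shift: "\<forall>\<^sub>F m in sequentially. \<bar>dist (act u p) (z m) - dist p (z m) - shift u\<bar> \<le> 2 * \<delta>"
proof -
  obtain N where N: "\<And>m n. m \<ge> N \<Longrightarrow> n \<ge> N \<Longrightarrow> len u \<le> gp p (z m) (z n)"
    using conv unfolding conv_at_infinity_def by metis
  have "\<bar>(dist (act u p) (z m) - dist p (z m)) - (dist (act u p) (z N) - dist p (z N))\<bar> \<le> 2 * \<delta>"
    if "m \<ge> N" for m
    using N[OF that order_refl] by (intro horofunction_close) (simp add: len_def)
  then have "\<exists>B. \<forall>\<^sub>F m in sequentially. \<bar>dist (act u p) (z m) - dist p (z m) - B\<bar> \<le> 2 * \<delta>"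
    unfolding eventually_sequentially by blast
  then show ?thesis unfolding shift_def by (rule someI_ex)
qed

text \<open>The shift is a quasimorphism: its defect consists of \<open>2 * \<delta>\<close> for
  each of the three chosen values and \<open>2 * \<delta>\<close> for replacing the translate of
  \<open>z\<close> by \<open>inv u\<close> with \<open>z\<close> itself.\<close>

lemma shift_mult:
  assumes "u \<in> carrier \<Gamma>" "v \<in> carrier \<Gamma>"
  shows "\<bar>shift (u \<otimes> v) - shift u - shift v\<bar> \<le> 8 * \<delta>"
proof -
  have "\<forall>\<^sub>F m in sequentially. \<bar>shift (u \<otimes> v) - shift u - shift v\<bar> \<le> 8 * \<delta>"
    using shift[of "u \<otimes> v"] shift[of u] shift[of v] eventually_gp_act[OF inv_closed[OF assms(1)], of "len v"]
  proof eventually_elim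
    case (elim m)
    have "dist (act (u \<otimes> v) p) (z m) = dist (act v p) (act (inv u) (z m))"
      "dist (act u p) (z m) = dist p (act (inv u) (z m))"
      using assms by (simp_all add: dist_act_left)
    moreover have "\<bar>(dist (act v p) (act (inv u) (z m)) - dist p (act (inv u) (z m))) -
        (dist (act v p) (z m) - dist p (z m))\<bar> \<le> 2 * \<delta>"
      using elim(4) by (intro horofunction_close) (simp add: len_def)
    ultimately show ?case using elim(1-3) by linarith
  qed
  then show ?thesis by simp
qed

context
  fixes h :: "nat \<Rightarrow> 'g" and K :: real and N :: nat
  assumes h: "\<And>n. h n \<in> carrier \<Gamma>"
    and bounded: "\<And>n m. n \<ge> N \<Longrightarrow> m \<ge> N \<Longrightarrow> gp p (act (h n) p) (z m) \<le> K"
    and unbounded: "\<And>M. \<exists>n0. \<forall>n\<ge>n0. M \<le> len (h n)"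
begin

lemma shift_ge:
  assumes "n \<ge> N"
  shows "len (h n) - 2 * K - 2 * \<delta> \<le> shift (h n)"
proof -
  have "\<forall>\<^sub>F m in sequentially. len (h n) - 2 * K - 2 * \<delta> \<le> shift (h n)"
    using shift[of "h n"] eventually_ge_at_top[of N]
  proof eventually_elim
    case (elim m)
    have "dist (act (h n) p) (z m) = len (h n) + dist p (z m) - 2 * gp p (act (h n) p) (z m)"
      by (simp add: gromov_product_def len_def field_simps)
    then show ?case using elim bounded[OF assms elim(2)] by linarith
  qed
  then show ?thesis by simp
qed

text \<open>Since \<open>h n\<close> fixes the point of \<open>z\<close>, translation by
  \<open>h n\<close> turns the product into one that \<open>bounded\<close> controls. Thus the
  inverse orbit points lie close to rays from \<open>p\<close> towards \<open>z\<close>.\<close>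

lemma inverse_radial:
  assumes "n \<ge> N"
  shows "\<forall>\<^sub>F m in sequentially. gp (act (inv (h n)) p) p (z m) \<le> K + \<delta>"
  using eventually_gp_act[OF h[of n], of "K + 2 * \<delta> + 1"] eventually_ge_at_top[of N]
proof eventually_elim
  case (elim m)
  have "gp (act (inv (h n)) p) p (z m) = gp p (act (h n) p) (act (h n) (z m))"
    using h[of n] by (simp add: gp_act_base)
  then show ?case
    using elim(1) bounded[OF assms elim(2)] hyp[of p "act (h n) p" "act (h n) (z m)" "z m"] delta_nonneg
    by (simp add: min_def split: if_splits)
qed

text \<open>The conjugate displaces \<open>p\<close> as far as \<open>u\<close> displaces the point
  \<open>?y\<close>, the image of \<open>p\<close> under \<open>inv (h n)\<close>. That point is
  near a ray to \<open>z\<close>, so is its image since \<open>u\<close> fixes the end, and their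
  Busemann values differ by about \<open>c\<close> at most; such points are close. Far out on the
  ray the length of \<open>u\<close> no longer enters the bound.\<close>

lemma conjugate_len_le:
  assumes u: "u \<in> carrier \<Gamma>" "\<bar>shift u\<bar> \<le> c"
    and n: "n \<ge> N" "K + 4 * \<delta> + len u + 1 \<le> len (h n)"
  shows "len (h n \<otimes> u \<otimes> inv (h n)) \<le> c + 4 * K + 12 * \<delta>"
proof -
  have K: "0 \<le> K" using bounded[of N N] gp_nonneg[of p "act (h N) p" "z N"] by simp
  let ?y = "act (inv (h n)) p"
  let ?y' = "act u ?y"
  have "\<forall>\<^sub>F m in sequentially. dist ?y ?y' \<le> c + 4 * K + 12 * \<delta>"
    using shift[of u] inverse_radial[OF n(1)]
      eventually_gp_act[OF inv_closed[OF u(1)], of "K + 3 * \<delta> + 1 + len (h n)"]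
  proof eventually_elim
    case (elim m)
    have lenh: "dist p ?y = len (h n)" using h[of n] by (metis len_def len_inv)
    have 1: "dist ?y (z m) \<le> dist p (z m) - len (h n) + 2 * (K + \<delta>)"
      using elim(2) lenh by (simp add: gromov_product_def dist_commute field_simps)
    have "K + 3 * \<delta> + 1 \<le> gp ?y (act (inv u) (z m)) (z m)"
      using elim(3) gp_change_base[of p "act (inv u) (z m)" "z m" ?y] lenh by linarith
    then have "gp ?y p (act (inv u) (z m)) \<le> K + 2 * \<delta>"
      using elim(2) hyp[of ?y p "act (inv u) (z m)" "z m"] delta_nonneg
      by (simp add: min_def split: if_splits)
    then have 2: "gp ?y' (act u p) (z m) \<le> K + 2 * \<delta>"
      using u(1) by (simp add: gp_act_base)
    have "dist ?y' p \<ge> len (h n) - len u"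
      using dist_triangle[of "act u p" ?y' p] u(1) lenh by (simp add: len_def dist_commute)
    moreover have "dist ?y' (act u p) = len (h n)" using u(1) lenh by (simp add: dist_commute)
    ultimately have "K + 4 * \<delta> + 1 \<le> gp ?y' p (act u p)"
      using n(2) unfolding gromov_product_def[of ?y'] by (simp add: len_def)
    then have 3: "gp ?y' p (z m) \<le> K + 3 * \<delta>"
      using 2 hyp[of ?y' "act u p" p "z m"] delta_nonneg
      by (simp add: min_def gp_commute split: if_splits)
    have "dist ?y' (z m) \<le> dist (act u p) (z m) - len (h n) + 2 * (K + 2 * \<delta>)"
      using 2 \<open>dist ?y' (act u p) = len (h n)\<close> by (simp add: gromov_product_def field_simps)
    moreover have "dist (act u p) (z m) \<le> dist ?y' (z m) + len (h n)"
      using dist_triangle[of "act u p" "z m" ?y'] \<open>dist ?y' (act u p) = len (h n)\<close> by (simp add: dist_commute)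
    moreover have "dist p ?y' \<le> dist p (z m) - dist ?y' (z m) + 2 * (K + 3 * \<delta>)"
      using 3 by (simp add: gromov_product_def dist_commute field_simps)
    moreover note elim(1) u(2) 1 lenh four_points[of ?y ?y' p "z m"]
    ultimately show ?case using K delta_nonneg by (auto simp: max_def dist_commute split: if_splits)
  qed
  then have "dist ?y ?y' \<le> c + 4 * K + 12 * \<delta>" by simp
  moreover have "len (h n \<otimes> u \<otimes> inv (h n)) = dist ?y ?y'"
    using u(1) h[of n] by (simp add: len_def dist_act_left)
  ultimately show ?thesis by simp
qed

text \<open>Conjugation by a far element \<open>h n\<close> embeds any finite set of such elements
  into one fixed ball. How far one has to go depends on the set, but the ball does not, so the
  cardinalities of finite subsets are uniformly bounded.\<close>

lemma finite_shift_le: "finite {u \<in> carrier \<Gamma>. \<bar>shift u\<bar> \<le> c}"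
proof (rule finite_if_finite_subsets_card_bdd[THEN conjunct1])
  fix S assume S: "S \<subseteq> {u \<in> carrier \<Gamma>. \<bar>shift u\<bar> \<le> c}" "finite S"
  let ?R = "{g \<in> carrier \<Gamma>. len g \<le> c + 4 * K + 12 * \<delta>}"
  obtain L where L: "\<And>u. u \<in> S \<Longrightarrow> len u \<le> L"
    using S(2) by (rule finite_len_bound) blast
  obtain n0 where "\<And>n. n \<ge> n0 \<Longrightarrow> K + 4 * \<delta> + L + 1 \<le> len (h n)" using unbounded by metis
  then have n: "K + 4 * \<delta> + L + 1 \<le> len (h (max n0 N))" by simp
  let ?h = "h (max n0 N)"
  have "card S = card ((\<lambda>u. ?h \<otimes> u \<otimes> inv ?h) ` S)"
  proof (rule card_image[symmetric], rule inj_onI)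
    fix u v assume uv: "u \<in> S" "v \<in> S" "?h \<otimes> u \<otimes> inv ?h = ?h \<otimes> v \<otimes> inv ?h"
    have c: "u \<in> carrier \<Gamma>" "v \<in> carrier \<Gamma>" using S(1) uv by auto
    show "u = v" using uv(3) h[of "max n0 N"] c by simp
  qed
  also have "\<dots> \<le> card ?R"
  proof (rule card_mono[OF finite_len_le], rule image_subsetI)
    fix u assume "u \<in> S"
    then have u: "u \<in> carrier \<Gamma>" "\<bar>shift u\<bar> \<le> c" "len u \<le> L" using S L by auto
    then show "?h \<otimes> u \<otimes> inv ?h \<in> ?R" using conjugate_len_le[OF u(1,2), of "max n0 N"] n h by simp
  qed
  finally show "card S \<le> card ?R" .
qed

end

text \<open>Division with remainder by \<open>g\<close>: removing one factor \<open>g\<close> lowers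
  the shift by at least 1 and by at most \<open>shift g + 8 * \<delta>\<close>, so the shift stays
  nonnegative until it is at most that bound.\<close>

lemma shift_decompose:
  assumes g: "g \<in> carrier \<Gamma>" "8 * \<delta> + 1 \<le> shift g"
  shows "w \<in> carrier \<Gamma> \<Longrightarrow> 0 \<le> shift w \<Longrightarrow> shift w \<le> real n \<Longrightarrow>
    \<exists>j::nat. \<exists>e\<in>carrier \<Gamma>. \<bar>shift e\<bar> \<le> shift g + 8 * \<delta> \<and> w = g [^] j \<otimes> e"
proof (induction n arbitrary: w)
  case 0
  then show ?case using g delta_nonneg by (intro exI[of _ 0] bexI[of _ w]) auto
next
  case (Suc n)
  show ?case
  proof (cases "shift w \<le> shift g + 8 * \<delta>")
    case True
    then show ?thesis using Suc.prems by (intro exI[of _ 0] bexI[of _ w]) auto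
  next
    case False
    define w' where "w' = inv g \<otimes> w"
    have w': "w' \<in> carrier \<Gamma>" "w = g \<otimes> w'" using g Suc.prems by (auto simp: w'_def m_assoc[symmetric])
    have "\<bar>shift w - shift g - shift w'\<bar> \<le> 8 * \<delta>" using shift_mult[OF g(1) w'(1)] w'(2) by simp
    then have "0 \<le> shift w'" "shift w' \<le> real n" using False g(2) Suc.prems by auto
    then obtain j :: nat and e where "e \<in> carrier \<Gamma>" "\<bar>shift e\<bar> \<le> shift g + 8 * \<delta>" "w' = g [^] j \<otimes> e"
      using Suc.IH[OF w'(1)] by blast
    moreover from this have "w = g [^] Suc j \<otimes> e"
      using w'(2) g nat_pow_Suc2[of g j] by (simp add: m_assoc del: nat_pow_Suc)
    ultimately show ?thesis by blast
  qed
qed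

text \<open>Elements of bounded shift are finite in number, so the whole orbit stays near the orbit of the
  powers of one element \<open>g\<close> of large shift, and these accumulate at a single point other than \<open>z\<close>.\<close>

lemma no_two_further_limit_points:
  assumes h: "\<And>n. h n \<in> carrier \<Gamma>" "\<And>n. h' n \<in> carrier \<Gamma>"
    and conv_h: "conv_at_infinity p (\<lambda>n. act (h n) p)" "conv_at_infinity p (\<lambda>n. act (h' n) p)"
    and ne: "\<not> seq_equiv p (\<lambda>n. act (h n) p) z" "\<not> seq_equiv p (\<lambda>n. act (h' n) p) z"
  shows "seq_equiv p (\<lambda>n. act (h n) p) (\<lambda>n. act (h' n) p)"
proof -
  obtain K N where K: "\<And>n m. n \<ge> N \<Longrightarrow> m \<ge> N \<Longrightarrow> gp p (act (h n) p) (z m) \<le> K"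
    using not_seq_equiv_bounded[OF conv_h(1) conv ne(1)] by blast
  obtain K' N' where K': "\<And>n m. n \<ge> N' \<Longrightarrow> m \<ge> N' \<Longrightarrow> gp p (act (h' n) p) (z m) \<le> K'"
    using not_seq_equiv_bounded[OF conv_h(2) conv ne(2)] by blast
  have unb: "\<exists>n0. \<forall>n\<ge>n0. M \<le> len (h n)" "\<exists>n0. \<forall>n\<ge>n0. M \<le> len (h' n)" for M
    using conv_dist_at_top[OF conv_h(1)] conv_dist_at_top[OF conv_h(2)] by (auto simp: len_def)
  have K0: "0 \<le> K" using K[of N N] gp_nonneg[of p "act (h N) p" "z N"] by simp
  define L where "L = K + \<delta>"
  \<comment> \<open>The sum of two demands: \<open>2 * K + 10 * \<delta> + 1\<close> yields the
    shift of \<open>g\<close> through \<open>shift_ge\<close>, and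
    \<open>2 * L + 4 * \<delta> + 1\<close> makes the powers of \<open>g\<close> an admissible
    word.\<close>
  obtain n0 where n0: "\<And>n. n \<ge> n0 \<Longrightarrow> 2 * K + 10 * \<delta> + 1 + 2 * L + 4 * \<delta> + 1 \<le> len (h n)" using unb(1) by metis
  define g where "g = h (max n0 N)"
  have g: "g \<in> carrier \<Gamma>" using h by (simp add: g_def)
  have lg: "2 * K + 10 * \<delta> + 1 + 2 * L + 4 * \<delta> + 1 \<le> len g" using n0 by (simp add: g_def)
  have sg: "8 * \<delta> + 1 \<le> shift g"
    using shift_ge[of h N K "max n0 N"] h(1) K unb(1) lg K0 delta_nonneg by (simp add: g_def L_def)
  have "\<forall>\<^sub>F m in sequentially. gp (act (inv g) p) p (z m) \<le> K + \<delta>"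
    unfolding g_def by (rule inverse_radial[of h N K]) (use h K unb in auto)
  \<comment> \<open>\<open>inv g\<close> moves \<open>p\<close> towards \<open>z\<close> and
    \<open>g\<close> moves it elsewhere, so the two directions diverge; this is the turning bound
    for the powers of \<open>g\<close>.\<close>
  then have "\<forall>\<^sub>F m in sequentially. gp p (act (inv g) p) (act g p) \<le> L"
    using eventually_ge_at_top[of N]
  proof eventually_elim
    case (elim m)
    have "gp (act (inv g) p) p (z m) \<le> K + \<delta>" using elim by (simp add: g_def)
    moreover have "gp (act (inv g) p) p (z m) + gp p (act (inv g) p) (z m) = len g"
      using gp_flip[of p "act (inv g) p" "z m"] g by (simp add: len_def[symmetric])
    moreover have "gp p (act g p) (z m) \<le> K" using K elim(2) by (simp add: g_def)
    moreover note hyp[of p "act g p" "act (inv g) p" "z m"]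
    ultimately show ?case using lg K0 delta_nonneg by (simp add: L_def gp_commute min_def split: if_splits)
  qed
  then have gpg: "gp p (act (inv g) p) (act g p) \<le> L" by simp
  have adm: "admissible L (\<lambda>_. g) n" for n
    using g gpg lg K0 delta_nonneg by (auto simp: admissible_def L_def)
  have L0: "0 \<le> L" using K0 delta_nonneg by (simp add: L_def)
  define E where "E = {u \<in> carrier \<Gamma>. \<bar>shift u\<bar> \<le> shift g + 8 * \<delta>}"
  have "finite E" unfolding E_def using finite_shift_le[of h N K] h(1) K unb(1) by blast
  then obtain R where R: "\<And>u. u \<in> E \<Longrightarrow> len u \<le> R"
    by (rule finite_len_bound) blast
  have near: "\<exists>n0. \<forall>n\<ge>n0. \<exists>j\<ge>J. dist (act (f n) p) (act (g [^] j) p) \<le> R"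
    if f: "\<And>n. f n \<in> carrier \<Gamma>" and b: "\<And>n m. n \<ge> M \<Longrightarrow> m \<ge> M \<Longrightarrow> gp p (act (f n) p) (z m) \<le> k"
      and u: "\<And>M. \<exists>n0. \<forall>n\<ge>n0. M \<le> len (f n)" for f :: "nat \<Rightarrow> 'g" and M :: nat and k and J :: nat
  proof -
    have "finite ((\<lambda>j. g [^] j) ` {..<J})" by simp
    then obtain P where "\<And>u. u \<in> (\<lambda>j. g [^] j) ` {..<J} \<Longrightarrow> len u \<le> P"
      by (rule finite_len_bound) blast
    then have P: "len (g [^] j) \<le> P" if "j < J" for j using that by blast
    \<comment> \<open>The first bound makes the shift of \<open>f n\<close> nonnegative; the second
      exceeds the length of a low power of \<open>g\<close> plus the remainder, which forces an
      exponent of at least \<open>J\<close>.\<close>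
    obtain n1 where n1: "\<And>n. n \<ge> n1 \<Longrightarrow> max (2 * k + 2 * \<delta>) (P + R + 1) \<le> len (f n)" using u by metis
    have "\<exists>j\<ge>J. dist (act (f n) p) (act (g [^] j) p) \<le> R" if n: "n \<ge> max M n1" for n
    proof -
      have "max (2 * k + 2 * \<delta>) (P + R + 1) \<le> len (f n)" using n1 n by simp
      then have lf: "2 * k + 2 * \<delta> \<le> len (f n)" "P + R + 1 \<le> len (f n)" by simp_all
      then have "0 \<le> shift (f n)" using shift_ge[of f M k n] f b u n by simp
      moreover obtain i :: nat where "shift (f n) \<le> real i" using real_arch_simple by blast
      ultimately obtain j :: nat and e where je: "e \<in> E" "f n = g [^] j \<otimes> e"
        using shift_decompose[OF g sg f] unfolding E_def by blast
      have ec: "e \<in> carrier \<Gamma>" using je by (simp add: E_def)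
      have "dist (act (f n) p) (act (g [^] j) p) = len e"
        using je(2) ec g by (simp add: len_def dist_commute)
      then have d: "dist (act (f n) p) (act (g [^] j) p) \<le> R" using R je(1) by simp
      then have "len (f n) \<le> len (g [^] j) + R"
        using dist_triangle[of p "act (f n) p" "act (g [^] j) p"] by (simp add: len_def dist_commute)
      then have "J \<le> j" using P[of j] lf by (cases "j < J") auto
      then show ?thesis using d by blast
    qed
    then show ?thesis by blast
  qed
  show ?thesis
    unfolding seq_equiv_def
  proof
    fix M
    obtain J :: nat where J: "M + 2 * R + L + 2 * \<delta> \<le> real J" using real_arch_simple by blast
    obtain n1 where n1: "\<And>n. n \<ge> n1 \<Longrightarrow> \<exists>j\<ge>J. dist (act (h n) p) (act (g [^] j) p) \<le> R"
      using near[of h N K J] h K unb by blast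
    obtain n2 where n2: "\<And>n. n \<ge> n2 \<Longrightarrow> \<exists>j\<ge>J. dist (act (h' n) p) (act (g [^] j) p) \<le> R"
      using near[of h' N' K' J] h K' unb by blast
    have gpow: "real J - L - 2 * \<delta> \<le> gp p (act (g [^] i) p) (act (g [^] j) p)" if "J \<le> i" "i \<le> j" for i j :: nat
      using admissible_gp_word[OF adm[of j] that(2) order_refl L0] admissible_len_ge[OF adm[of j] L0 that(2)] that
      by (simp add: word_const)
    have gpow': "real J - L - 2 * \<delta> \<le> gp p (act (g [^] i) p) (act (g [^] j) p)" if "J \<le> i" "J \<le> j" for i j :: nat
      using gpow[of i j] gpow[of j i] that gp_commute[of p "act (g [^] i) p"] by (cases "i \<le> j") auto
    have "M \<le> gp p (act (h m) p) (act (h' n) p)" if mn: "m \<ge> max n1 n2" "n \<ge> max n1 n2" for m n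
    proof -
      obtain i where i: "i \<ge> J" "dist (act (h m) p) (act (g [^] i) p) \<le> R" using n1 mn by auto
      obtain j where j: "j \<ge> J" "dist (act (h' n) p) (act (g [^] j) p) \<le> R" using n2 mn by auto
      have "gp p (act (g [^] i) p) (act (g [^] j) p) \<le> gp p (act (h m) p) (act (g [^] j) p) + R"
        using gp_change_point[of p "act (g [^] i) p" "act (g [^] j) p" "act (h m) p"] i by (simp add: dist_commute)
      moreover have "gp p (act (h m) p) (act (g [^] j) p) \<le> gp p (act (h m) p) (act (h' n) p) + R"
        using gp_change_point[of p "act (g [^] j) p" "act (h m) p" "act (h' n) p"] j
        by (simp add: dist_commute gp_commute)
      ultimately show ?thesis using gpow'[OF i(1) j(1)] J by linarith
    qed
    then show "\<exists>N. \<forall>m\<ge>N. \<forall>n\<ge>N. M \<le> gp p (act (h m) p) (act (h' n) p)" by blast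
  qed
qed

end

section \<open>Connecting elements in a normal subgroup\<close>

lemma (in hyperbolic_space) seq_equiv_of_diagonal:
  assumes "conv_at_infinity p x" "\<And>M. \<exists>N. \<forall>n\<ge>N. M \<le> gp p (y n) (x n)"
  shows "seq_equiv p y x"
  unfolding seq_equiv_def
proof
  fix M
  obtain N1 where N1: "\<And>n. n \<ge> N1 \<Longrightarrow> M + \<delta> \<le> gp p (y n) (x n)" using assms(2) by blast
  obtain N2 where N2: "\<And>m n. m \<ge> N2 \<Longrightarrow> n \<ge> N2 \<Longrightarrow> M + \<delta> \<le> gp p (x m) (x n)"
    using assms(1) unfolding conv_at_infinity_def by metis
  have "M \<le> gp p (y m) (x n)" if "m \<ge> max N1 N2" "n \<ge> max N1 N2" for m n
    using that N1[of m] N2[of m n] hyp[of p "y m" "x m" "x n"] by simp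
  then show "\<exists>N. \<forall>m\<ge>N. \<forall>n\<ge>N. M \<le> gp p (y m) (x n)" by blast
qed

lemma (in hyperbolic_space) converges_to_bdry_seq_equiv:
  assumes "converges_to_bdry p x \<xi>" "seq_equiv p y x"
  shows "converges_to_bdry p y \<xi>"
proof -
  have "conv_at_infinity p y"
    using assms(2) conv_iff_seq_equiv seq_equiv_sym seq_equiv_trans by blast
  then show ?thesis
    using assms boundary_mem_iff seq_equiv_sym unfolding converges_to_bdry_def by blast
qed

locale normal_subgroup_action = hyperbolic_action p \<delta> \<Gamma> act
  for p :: "'a::heine_borel" and \<delta> and \<Gamma> :: "('g, 'm) monoid_scheme" (structure) and act +
  fixes H :: "'g set"
  assumes nonelementary:
      "\<exists>a b c. {a, b, c} \<subseteq> limit_set p act (carrier \<Gamma>) \<and> a \<noteq> b \<and> b \<noteq> c \<and> a \<noteq> c"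
    and normal_H: "H \<lhd> \<Gamma>" and infinite_H: "infinite H"
    and infinite_index: "infinite (rcosets\<^bsub>\<Gamma>\<^esub> H)"
begin

lemma subgroup_H: "subgroup H \<Gamma>"
  using normal_H by (rule normal_imp_subgroup)

lemma H_carrier: "h \<in> H \<Longrightarrow> h \<in> carrier \<Gamma>"
  using subgroup.mem_carrier[OF subgroup_H] by blast

lemma H_one [simp]: "\<one> \<in> H" and H_inv: "h \<in> H \<Longrightarrow> inv h \<in> H"
  and H_mult: "h \<in> H \<Longrightarrow> k \<in> H \<Longrightarrow> h \<otimes> k \<in> H"
  using subgroup_H by (simp_all add: subgroup.one_closed subgroup.m_inv_closed subgroup.m_closed)

lemma H_conj: "g \<in> carrier \<Gamma> \<Longrightarrow> h \<in> H \<Longrightarrow> g \<otimes> h \<otimes> inv g \<in> H"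
  using normal.inv_op_closed2[OF normal_H] by blast

lemma ex_long_H: "\<exists>h\<in>H. M \<le> len h"
proof (rule ccontr)
  assume "\<not> ?thesis"
  then have "H \<subseteq> {g \<in> carrier \<Gamma>. len g \<le> M}" using H_carrier by force
  then show False using infinite_H finite_len_le finite_subset by blast
qed

text \<open>Inversion preserves lengths, so the inverse orbit points leave every ball too and
  converge along a subsequence, which still represents \<open>\<xi>\<close>.\<close>

lemma limit_set_sequence:
  assumes "\<xi> \<in> limit_set p act (carrier \<Gamma>)"
  shows "\<exists>g. (\<forall>n. g n \<in> carrier \<Gamma>) \<and> converges_to_bdry p (\<lambda>n. act (g n) p) \<xi> \<and>
    conv_at_infinity p (\<lambda>n. act (inv (g n)) p)"
proof -
  obtain g where g: "\<And>n. g n \<in> carrier \<Gamma>" "converges_to_bdry p (\<lambda>n. act (g n) p) \<xi>"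
    using assms unfolding limit_set_def by blast
  have conv: "conv_at_infinity p (\<lambda>n. act (g n) p)"
    using g boundary_conv unfolding converges_to_bdry_def by blast
  have "dist p (act (inv (g n)) p) = dist p (act (g n) p)" for n
    using len_inv[OF g(1)] by (simp add: len_def)
  then have "\<exists>N. \<forall>n\<ge>N. M \<le> dist p (act (inv (g n)) p)" for M
    using conv_dist_at_top[OF conv] by simp
  then have "\<exists>r. strict_mono r \<and> conv_at_infinity p ((\<lambda>n. act (inv (g n)) p) \<circ> r)"
    by (rule ex_conv_subseq)
  then obtain r where r: "strict_mono r" "conv_at_infinity p ((\<lambda>n. act (inv (g n)) p) \<circ> r)"
    by blast
  have "seq_equiv p (\<lambda>n. act (g (r n)) p) (\<lambda>n. act (g n) p)"
    using seq_equiv_subseq[OF _ r(1) strict_mono_id] conv by (simp add: conv_iff_seq_equiv o_def)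
  then have "converges_to_bdry p (\<lambda>n. act (g (r n)) p) \<xi>"
    using g(2) converges_to_bdry_seq_equiv by blast
  then show ?thesis using g(1) r(2) by (intro exI[of _ "g \<circ> r"]) (simp add: o_def)
qed

lemma ex_three_sequences:
  obtains \<alpha> :: "nat \<Rightarrow> nat \<Rightarrow> 'g" where
    "\<And>i n. \<alpha> i n \<in> carrier \<Gamma>"
    "\<And>i. conv_at_infinity p (\<lambda>n. act (\<alpha> i n) p)"
    "\<And>i. conv_at_infinity p (\<lambda>n. act (inv (\<alpha> i n)) p)"
    "\<And>i j. i < 3 \<Longrightarrow> j < 3 \<Longrightarrow> i \<noteq> j \<Longrightarrow>
      \<not> seq_equiv p (\<lambda>n. act (\<alpha> i n) p) (\<lambda>n. act (\<alpha> j n) p)"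
proof -
  obtain a b c where abc: "a \<in> limit_set p act (carrier \<Gamma>)" "b \<in> limit_set p act (carrier \<Gamma>)"
    "c \<in> limit_set p act (carrier \<Gamma>)" "a \<noteq> b" "b \<noteq> c" "a \<noteq> c"
    using nonelementary by auto
  define \<xi> where "\<xi> i = (if i = 0 then a else if i = 1 then b else c)" for i :: nat
  have "\<xi> i \<in> limit_set p act (carrier \<Gamma>)" for i using abc by (simp add: \<xi>_def)
  then have "\<forall>i. \<exists>g. (\<forall>n. g n \<in> carrier \<Gamma>) \<and> converges_to_bdry p (\<lambda>n. act (g n) p) (\<xi> i) \<and>
    conv_at_infinity p (\<lambda>n. act (inv (g n)) p)" using limit_set_sequence by simp
  from choice[OF this] obtain \<alpha> where \<alpha>: "\<forall>i. (\<forall>n. \<alpha> i n \<in> carrier \<Gamma>) \<and>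
    converges_to_bdry p (\<lambda>n. act (\<alpha> i n) p) (\<xi> i) \<and> conv_at_infinity p (\<lambda>n. act (inv (\<alpha> i n)) p)"
    by blast
  have "\<not> seq_equiv p (\<lambda>n. act (\<alpha> i n) p) (\<lambda>n. act (\<alpha> j n) p)" if "i < 3" "j < 3" "i \<noteq> j" for i j
  proof -
    have "\<xi> i \<noteq> \<xi> j" using that abc by (auto simp: \<xi>_def)
    then show ?thesis using \<alpha> boundary_eq_iff unfolding converges_to_bdry_def by blast
  qed
  moreover have "conv_at_infinity p (\<lambda>n. act (\<alpha> i n) p)" for i
    using \<alpha> boundary_conv unfolding converges_to_bdry_def by blast
  ultimately show thesis using \<alpha> that[of \<alpha>] by blast
qed

text \<open>\<open>Dir i\<close> is a neighbourhood of the \<open>i\<close>-th limit point. An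
  element that starts towards the point \<open>i\<close> and whose inverse starts towards the point
  \<open>j\<close> is \<open>\<alpha> i n \<otimes> u \<otimes> inv (\<alpha> j n)\<close>, where
  \<open>u\<close> must separate the backward limits of the two sequences. For \<open>i = j\<close>,
  which is included, \<open>u\<close> must move a single backward limit.\<close>

lemma ex_directions:
  obtains K and Dir :: "nat \<Rightarrow> 'a set" where "0 \<le> K"
    "\<And>i j M. i < 3 \<Longrightarrow> j < 3 \<Longrightarrow>
      \<exists>\<phi>\<in>carrier \<Gamma>. M \<le> len \<phi> \<and> act \<phi> p \<in> Dir i \<and> act (inv \<phi>) p \<in> Dir j"
    "\<And>x i j y y'. i < 3 \<Longrightarrow> j < 3 \<Longrightarrow> i \<noteq> j \<Longrightarrow> y \<in> Dir i \<Longrightarrow> y' \<in> Dir j \<Longrightarrow>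
      gp p x y \<le> K \<or> gp p x y' \<le> K"
proof -
  obtain \<alpha> :: "nat \<Rightarrow> nat \<Rightarrow> 'g" where \<alpha>: "\<And>i n. \<alpha> i n \<in> carrier \<Gamma>"
    and conv_fwd: "\<And>i. conv_at_infinity p (\<lambda>n. act (\<alpha> i n) p)"
    and conv_inv: "\<And>i. conv_at_infinity p (\<lambda>n. act (inv (\<alpha> i n)) p)"
    and ne: "\<And>i j. i < 3 \<Longrightarrow> j < 3 \<Longrightarrow> i \<noteq> j \<Longrightarrow>
      \<not> seq_equiv p (\<lambda>n. act (\<alpha> i n) p) (\<lambda>n. act (\<alpha> j n) p)"
    by (rule ex_three_sequences) blast
  \<comment> \<open>Otherwise the backward limits coincide in a point fixed by
    \<open>\<Gamma>\<close>; at least two of the three limit points differ from it, which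
    \<open>no_two_further_limit_points\<close> forbids.\<close>
  have not_fixed: "\<exists>u\<in>carrier \<Gamma>. \<not> seq_equiv p (\<lambda>n. act (inv (\<alpha> i n)) p) (\<lambda>n. act u (act (inv (\<alpha> j n)) p))"
    for i j
  proof (rule ccontr)
    assume "\<not> ?thesis"
    then have eq: "seq_equiv p (\<lambda>n. act (inv (\<alpha> i n)) p) (\<lambda>n. act u (act (inv (\<alpha> j n)) p))"
      if "u \<in> carrier \<Gamma>" for u using that by blast
    define z where "z n = act (inv (\<alpha> i n)) p" for n
    have eq1: "seq_equiv p z (\<lambda>n. act (inv (\<alpha> j n)) p)" using eq[of \<one>] by (simp add: z_def[abs_def])
    have "seq_equiv p (\<lambda>m. act u (z m)) z" if u: "u \<in> carrier \<Gamma>" for u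
      using seq_equiv_act[OF eq1 u] eq[OF u] seq_equiv_sym seq_equiv_trans unfolding z_def by blast
    then interpret fixed_boundary_point p \<delta> \<Gamma> act z
      by unfold_locales (use conv_inv in \<open>simp_all add: z_def[abs_def]\<close>)
    have two: False if "k < 3" "l < 3" "k \<noteq> l" "\<not> seq_equiv p (\<lambda>n. act (\<alpha> k n) p) z"
      "\<not> seq_equiv p (\<lambda>n. act (\<alpha> l n) p) z" for k l
      using no_two_further_limit_points[of "\<alpha> k" "\<alpha> l"] \<alpha> conv_fwd that ne by blast
    have one: False if "k < 3" "l < 3" "k \<noteq> l" "seq_equiv p (\<lambda>n. act (\<alpha> k n) p) z"
      "seq_equiv p (\<lambda>n. act (\<alpha> l n) p) z" for k l
      using that ne seq_equiv_sym seq_equiv_trans by blast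
    show False using two[of 0 1] two[of 0 2] two[of 1 2] one[of 0 1] one[of 0 2] one[of 1 2] by auto
  qed
  have phi: "\<exists>\<phi>. (\<forall>n. \<phi> n \<in> carrier \<Gamma>) \<and> seq_equiv p (\<lambda>n. act (\<phi> n) p) (\<lambda>n. act (\<alpha> i n) p) \<and>
      seq_equiv p (\<lambda>n. act (inv (\<phi> n)) p) (\<lambda>n. act (\<alpha> j n) p)" for i j
  proof -
    obtain u where u: "u \<in> carrier \<Gamma>"
      "\<not> seq_equiv p (\<lambda>n. act (inv (\<alpha> i n)) p) (\<lambda>n. act u (act (inv (\<alpha> j n)) p))"
      using not_fixed by blast
    have "conv_at_infinity p (\<lambda>n. act u (act (inv (\<alpha> j n)) p))"
      using seq_equiv_act[OF _ u(1)] conv_inv by (simp add: conv_iff_seq_equiv)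
    then obtain B N where B: "\<And>n. n \<ge> N \<Longrightarrow> gp p (act (inv (\<alpha> i n)) p) (act u (act (inv (\<alpha> j n)) p)) \<le> B"
      using not_seq_equiv_bounded[OF conv_inv _ u(2)] by blast
    define \<phi> where "\<phi> n = \<alpha> i n \<otimes> u \<otimes> inv (\<alpha> j n)" for n
    have \<phi>: "\<phi> n \<in> carrier \<Gamma>" for n using \<alpha> u by (simp add: \<phi>_def)
    have inv_\<phi>: "inv (\<phi> n) = \<alpha> j n \<otimes> inv u \<otimes> inv (\<alpha> i n)" for n
      using \<alpha> u by (simp add: \<phi>_def inv_mult_group m_assoc)
    have a: "gp p (act (\<phi> n) p) (act (\<alpha> i n) p) = len (\<alpha> i n) - gp p (act (inv (\<alpha> i n)) p) (act u (act (inv (\<alpha> j n)) p))"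
      for n
      using gp_flip[of p "act (\<alpha> i n) p" "act (\<phi> n) p"] \<alpha> u
      by (simp add: \<phi>_def len_def gp_commute gp_act_base[of "\<alpha> i n" p])
    have "gp p (act (inv (\<phi> n)) p) (act (\<alpha> j n) p) = len (\<alpha> j n) - gp p (act (inv (\<alpha> j n)) p) (act (inv u) (act (inv (\<alpha> i n)) p))"
      for n
      using gp_flip[of p "act (\<alpha> j n) p" "act (inv (\<phi> n)) p"] \<alpha> u
      by (simp add: inv_\<phi> len_def gp_commute gp_act_base[of "\<alpha> j n" p])
    note inv_eq = this
    have inv_le: "gp p (act (inv (\<alpha> j n)) p) (act (inv u) (act (inv (\<alpha> i n)) p)) \<le>
        gp p (act (inv (\<alpha> i n)) p) (act u (act (inv (\<alpha> j n)) p)) + len u" for n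
      using gp_change_base[of "act u p" "act u (act (inv (\<alpha> j n)) p)" "act (inv (\<alpha> i n)) p" p] u(1)
      by (simp add: gp_act_base len_def dist_commute gp_commute)
    have b: "len (\<alpha> j n) - (gp p (act (inv (\<alpha> i n)) p) (act u (act (inv (\<alpha> j n)) p)) + len u)
        \<le> gp p (act (inv (\<phi> n)) p) (act (\<alpha> j n) p)" for n
      using inv_eq[of n] inv_le[of n] by linarith
    have "seq_equiv p (\<lambda>n. act (\<phi> n) p) (\<lambda>n. act (\<alpha> i n) p)"
    proof (rule seq_equiv_of_diagonal[OF conv_fwd])
      fix M
      obtain N' where "\<And>n. n \<ge> N' \<Longrightarrow> M + B \<le> len (\<alpha> i n)"
        using conv_dist_at_top[OF conv_fwd] unfolding len_def by blast
      then have "M \<le> gp p (act (\<phi> n) p) (act (\<alpha> i n) p)" if "n \<ge> max N N'" for n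
        using that B[of n] a[of n] by force
      then show "\<exists>N. \<forall>n\<ge>N. M \<le> gp p (act (\<phi> n) p) (act (\<alpha> i n) p)" by blast
    qed
    moreover have "seq_equiv p (\<lambda>n. act (inv (\<phi> n)) p) (\<lambda>n. act (\<alpha> j n) p)"
    proof (rule seq_equiv_of_diagonal[OF conv_fwd])
      fix M
      obtain N' where "\<And>n. n \<ge> N' \<Longrightarrow> M + B + len u \<le> len (\<alpha> j n)"
        using conv_dist_at_top[OF conv_fwd] unfolding len_def by blast
      then have "M \<le> gp p (act (inv (\<phi> n)) p) (act (\<alpha> j n) p)" if "n \<ge> max N N'" for n
        using that B[of n] b[of n] by force
      then show "\<exists>N. \<forall>n\<ge>N. M \<le> gp p (act (inv (\<phi> n)) p) (act (\<alpha> j n) p)" by blast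
    qed
    ultimately show ?thesis using \<phi> by blast
  qed
  have "\<exists>K N. \<forall>m\<ge>N. gp p (act (\<alpha> i m) p) (act (\<alpha> j m) p) \<le> K" if "i < 3" "j < 3" "i \<noteq> j" for i j
    using not_seq_equiv_bounded[OF conv_fwd conv_fwd ne[OF that]] by (elim exE) blast
  then obtain kk nn where KN: "\<And>i j m. i < 3 \<Longrightarrow> j < 3 \<Longrightarrow> i \<noteq> j \<Longrightarrow> m \<ge> nn i j \<Longrightarrow>
      gp p (act (\<alpha> i m) p) (act (\<alpha> j m) p) \<le> kk i j"
    by metis
  define K0 where "K0 = (\<Sum>ij\<in>{..<3} \<times> {..<3}. \<bar>kk (fst ij) (snd ij)\<bar>)"
  define N0 where "N0 = (\<Sum>ij\<in>{..<3} \<times> {..<3}. nn (fst ij) (snd ij))"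
  have K0: "gp p (act (\<alpha> i m) p) (act (\<alpha> j m) p) \<le> K0" if "i < 3" "j < 3" "i \<noteq> j" "m \<ge> N0" for i j m
  proof -
    have "nn i j \<le> N0" "\<bar>kk i j\<bar> \<le> K0"
      unfolding N0_def K0_def
      using that member_le_sum[of "(i, j)" "{..<3} \<times> {..<3}" "\<lambda>ij. nn (fst ij) (snd ij)"]
        member_le_sum[of "(i, j)" "{..<3} \<times> {..<3}" "\<lambda>ij. \<bar>kk (fst ij) (snd ij)\<bar>"] by auto
    then show ?thesis using KN[of i j m] that by linarith
  qed
  \<comment> \<open>The margin \<open>3 * \<delta> + 1\<close> outweighs the loss of
    \<open>2 * \<delta>\<close> in \<open>sep\<close>, given that the late products between
    different sequences are at most \<open>K0\<close>.\<close>
  define Dir where "Dir i = {y. \<exists>N. \<forall>n\<ge>N. K0 + 3 * \<delta> + 1 \<le> gp p y (act (\<alpha> i n) p)}" for i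
  have sep: "gp p y y' \<le> K0 + 2 * \<delta>" if ij: "i < 3" "j < 3" "i \<noteq> j" "y \<in> Dir i" "y' \<in> Dir j" for i j y y'
  proof -
    obtain N1 N2 where "\<And>n. n \<ge> N1 \<Longrightarrow> K0 + 3 * \<delta> + 1 \<le> gp p y (act (\<alpha> i n) p)"
      "\<And>n. n \<ge> N2 \<Longrightarrow> K0 + 3 * \<delta> + 1 \<le> gp p y' (act (\<alpha> j n) p)"
      using ij(4,5) unfolding Dir_def by blast
    then have "K0 + 3 * \<delta> + 1 \<le> gp p y (act (\<alpha> i (N0 + N1 + N2)) p)"
      "K0 + 3 * \<delta> + 1 \<le> gp p y' (act (\<alpha> j (N0 + N1 + N2)) p)" by simp_all
    moreover have "gp p (act (\<alpha> i (N0 + N1 + N2)) p) (act (\<alpha> j (N0 + N1 + N2)) p) \<le> K0"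
      using K0 ij by simp
    ultimately show ?thesis
      using hyp3[of p "act (\<alpha> i (N0 + N1 + N2)) p" y y' "act (\<alpha> j (N0 + N1 + N2)) p"] delta_nonneg
      by (simp add: gp_commute min_def split: if_splits)
  qed
  have K0_nonneg: "0 \<le> K0" unfolding K0_def by (simp add: sum_nonneg)
  show thesis
  proof (rule that[of "K0 + 3 * \<delta>" Dir])
    show "0 \<le> K0 + 3 * \<delta>" using K0_nonneg delta_nonneg by simp
  next
    fix i j :: nat and M assume "i < 3" "j < 3"
    obtain \<phi> where \<phi>: "\<And>n. \<phi> n \<in> carrier \<Gamma>" "seq_equiv p (\<lambda>n. act (\<phi> n) p) (\<lambda>n. act (\<alpha> i n) p)"
      "seq_equiv p (\<lambda>n. act (inv (\<phi> n)) p) (\<lambda>n. act (\<alpha> j n) p)" using phi by blast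
    let ?T = "max M (K0 + 3 * \<delta> + 1)"
    obtain N1 where N1: "\<And>m n. m \<ge> N1 \<Longrightarrow> n \<ge> N1 \<Longrightarrow> ?T \<le> gp p (act (\<phi> m) p) (act (\<alpha> i n) p)"
      using \<phi>(2) unfolding seq_equiv_def by metis
    obtain N2 where N2: "\<And>m n. m \<ge> N2 \<Longrightarrow> n \<ge> N2 \<Longrightarrow> ?T \<le> gp p (act (inv (\<phi> m)) p) (act (\<alpha> j n) p)"
      using \<phi>(3) unfolding seq_equiv_def by metis
    let ?n = "max N1 N2"
    have "?T \<le> len (\<phi> ?n)"
      using N1[of ?n ?n] gp_le_dist[of p "act (\<phi> ?n) p" "act (\<alpha> i ?n) p"] by (simp add: len_def)
    moreover have "act (\<phi> ?n) p \<in> Dir i" using N1[of ?n] unfolding Dir_def by force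
    moreover have "act (inv (\<phi> ?n)) p \<in> Dir j" using N2[of ?n] unfolding Dir_def by force
    ultimately show "\<exists>\<phi>\<in>carrier \<Gamma>. M \<le> len \<phi> \<and> act \<phi> p \<in> Dir i \<and> act (inv \<phi>) p \<in> Dir j"
      using \<phi>(1) by (intro bexI[of _ "\<phi> ?n"]) auto
  next
    fix x y y' and i j :: nat assume "i < 3" "j < 3" "i \<noteq> j" "y \<in> Dir i" "y' \<in> Dir j"
    then have "gp p y y' \<le> K0 + 2 * \<delta>" by (rule sep)
    then show "gp p x y \<le> K0 + 3 * \<delta> \<or> gp p x y' \<le> K0 + 3 * \<delta>"
      using hyp[of p y x y'] by (auto simp: gp_commute min_def split: if_splits)
  qed
qed

text \<open>In applications \<open>x\<close> is the orbit point of the inverse of the preceding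
  letter and \<open>y\<close> that of the following letter: some member of one finite set fits
  between them with small turning. \<open>K\<close> and \<open>M\<close> are separate so that the
  length can be prescribed after the turning bound is known.\<close>

definition is_connector_set :: "real \<Rightarrow> real \<Rightarrow> 'g set \<Rightarrow> bool" where
  "is_connector_set K M F \<longleftrightarrow> finite F \<and> F \<subseteq> H \<and> (\<forall>f\<in>F. M \<le> len f) \<and>
     (\<forall>x y. \<exists>f\<in>F. gp p x (act f p) \<le> K \<and> gp p (act (inv f) p) y \<le> K)"

text \<open>The conjugates \<open>\<phi> i \<otimes> g \<otimes> inv (\<phi> i)\<close> lie in
  \<open>H\<close> by normality, and both they and their inverses start along
  \<open>\<phi> i\<close>. A point blocks at most one of three directions, so two points leave one
  free. The inverses of all \<open>\<phi> i\<close> start in a direction \<open>j\<close> that is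
  free for \<open>g\<close> and \<open>inv g\<close>, which keeps the inner turns small; the lengths
  can grow without affecting \<open>K\<close>.\<close>

lemma ex_connectors:
  "\<exists>K\<ge>0. \<forall>M. \<exists>F. is_connector_set K M F"
proof -
  obtain K and Dir :: "nat \<Rightarrow> 'a set" where K: "0 \<le> K"
    and phi: "\<And>i j M. i < 3 \<Longrightarrow> j < 3 \<Longrightarrow>
      \<exists>\<phi>\<in>carrier \<Gamma>. M \<le> len \<phi> \<and> act \<phi> p \<in> Dir i \<and> act (inv \<phi>) p \<in> Dir j"
    and sep: "\<And>x i j y y'. i < 3 \<Longrightarrow> j < 3 \<Longrightarrow> i \<noteq> j \<Longrightarrow> y \<in> Dir i \<Longrightarrow> y' \<in> Dir j \<Longrightarrow>
      gp p x y \<le> K \<or> gp p x y' \<le> K"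
    by (rule ex_directions) blast
  have avoid: "\<exists>i<3. \<forall>y\<in>Dir i. gp p x y \<le> K \<and> gp p x' y \<le> K" for x x'
  proof -
    define bad where "bad x i \<longleftrightarrow> (\<exists>y\<in>Dir i. \<not> gp p x y \<le> K)" for x i
    have uniq: "\<not> (bad x i \<and> bad x j)" if "i < 3" "j < 3" "i \<noteq> j" for x i j
      using sep[OF that] unfolding bad_def by blast
    have "\<exists>i<3. \<not> bad x i \<and> \<not> bad x' i"
    proof (rule ccontr)
      assume c: "\<not> ?thesis"
      then have "bad x 0 \<or> bad x' 0" "bad x 1 \<or> bad x' 1" "bad x 2 \<or> bad x' 2" by auto
      then show False using uniq[of 0 1 x] uniq[of 0 2 x] uniq[of 1 2 x]
        uniq[of 0 1 x'] uniq[of 0 2 x'] uniq[of 1 2 x'] by auto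
    qed
    then show ?thesis unfolding bad_def by blast
  qed
  have "\<exists>F. finite F \<and> F \<subseteq> H \<and> (\<forall>f\<in>F. M \<le> len f) \<and>
     (\<forall>x y. \<exists>f\<in>F. gp p x (act f p) \<le> K + \<delta> \<and> gp p (act (inv f) p) y \<le> K + \<delta>)" for M
  proof -
    define L where "L = max M (2 * K + 4 * \<delta> + 1)"
    obtain g where g: "g \<in> H" "L \<le> len g" using ex_long_H by blast
    have gc: "g \<in> carrier \<Gamma>" using g H_carrier by blast
    obtain j where j: "j < 3" "\<And>y. y \<in> Dir j \<Longrightarrow> gp p (act g p) y \<le> K \<and> gp p (act (inv g) p) y \<le> K"
      using avoid[of "act g p" "act (inv g) p"] by blast
    have "\<forall>i\<in>{..<3}. \<exists>\<phi>. \<phi> \<in> carrier \<Gamma> \<and> L \<le> len \<phi> \<and> act \<phi> p \<in> Dir i \<and> act (inv \<phi>) p \<in> Dir j"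
      using phi j(1) by blast
    from bchoice[OF this] obtain \<phi> where \<phi>: "\<And>i. i < 3 \<Longrightarrow> \<phi> i \<in> carrier \<Gamma>" "\<And>i. i < 3 \<Longrightarrow> L \<le> len (\<phi> i)"
      "\<And>i. i < 3 \<Longrightarrow> act (\<phi> i) p \<in> Dir i" "\<And>i. i < 3 \<Longrightarrow> act (inv (\<phi> i)) p \<in> Dir j" by auto
    define f where "f i = \<phi> i \<otimes> g \<otimes> inv (\<phi> i)" for i
    \<comment> \<open>The case \<open>k = inv g\<close> covers the inverse of \<open>f i\<close>,
      which is the same conjugate of \<open>inv g\<close>.\<close>
    have conj: "L \<le> len (\<phi> i \<otimes> k \<otimes> inv (\<phi> i)) \<and>
        len (\<phi> i) - K - 2 * \<delta> \<le> gp p (act (\<phi> i) p) (act (\<phi> i \<otimes> k \<otimes> inv (\<phi> i)) p)"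
      if i: "i < 3" and k: "k = g \<or> k = inv g" for i k
    proof -
      have kc: "k \<in> carrier \<Gamma>" "L \<le> len k" using k gc g by auto
      have kk: "\<And>y. y \<in> Dir j \<Longrightarrow> gp p (act k p) y \<le> K \<and> gp p (act (inv k) p) y \<le> K" using k j gc by auto
      define s where "s = (!) [\<phi> i, k, inv (\<phi> i)]"
      have adm: "admissible K s 3"
        unfolding admissible_def using \<phi>[OF i] kc kk[OF \<phi>(4)[OF i]]
        by (auto simp: s_def L_def less_Suc_eq numeral_3_eq_3 gp_commute[of p "act (inv (\<phi> i)) p"])
      have w: "word s 3 = \<phi> i \<otimes> k \<otimes> inv (\<phi> i)" "word s 1 = \<phi> i" "s 0 = \<phi> i"
        using \<phi>(1)[OF i] kc by (simp_all add: s_def numeral_3_eq_3)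
      show ?thesis
        using admissible_gp_word[OF adm, of 1 3] admissible_len_first[OF adm, of 3] K w \<phi>(2)[OF i] by simp
    qed
    define F where "F = f ` {..<3}"
    have inv_f: "inv (f i) = \<phi> i \<otimes> inv g \<otimes> inv (\<phi> i)" if "i < 3" for i
      using \<phi>(1)[OF that] gc by (simp add: f_def inv_mult_group m_assoc)
    have "\<exists>f\<in>F. gp p x (act f p) \<le> K + \<delta> \<and> gp p (act (inv f) p) y \<le> K + \<delta>" for x y
    proof -
      obtain i where i: "i < 3" "gp p x (act (\<phi> i) p) \<le> K" "gp p y (act (\<phi> i) p) \<le> K"
        using avoid[of x y] \<phi>(3) by blast
      have "2 * K + 4 * \<delta> + 1 \<le> len (\<phi> i)" using \<phi>(2)[OF i(1)] by (simp add: L_def)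
      then have "K + 2 * \<delta> + 1 \<le> gp p (act (\<phi> i) p) (act (f i) p)"
        "K + 2 * \<delta> + 1 \<le> gp p (act (\<phi> i) p) (act (inv (f i)) p)"
        using conj[OF i(1), of g] conj[OF i(1), of "inv g"] by (auto simp: f_def inv_f[OF i(1), unfolded f_def])
      then have "gp p x (act (f i) p) \<le> K + \<delta>" "gp p (act (inv (f i)) p) y \<le> K + \<delta>"
        using i(2,3) hyp[of p x "act (f i) p" "act (\<phi> i) p"] hyp[of p y "act (inv (f i)) p" "act (\<phi> i) p"] delta_nonneg
        by (simp_all add: gp_commute min_def split: if_splits)
      then show ?thesis using i(1) by (auto simp: F_def)
    qed
    moreover have "F \<subseteq> H" using \<phi>(1) g(1) by (auto simp: F_def f_def intro: H_conj)
    moreover have "\<forall>f\<in>F. M \<le> len f" using conj by (auto simp: F_def f_def L_def)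
    moreover have "finite F" by (simp add: F_def)
    ultimately show ?thesis by blast
  qed
  then show ?thesis
    using K delta_nonneg unfolding is_connector_set_def by (intro exI[of _ "K + \<delta>"]) auto
qed

end

section \<open>Escaping sequences in the quotient group\<close>

context normal_subgroup_action
begin

text \<open>By normality this is the quotient norm on \<open>\<Gamma>/H\<close>, the infimum of the
  lengths in the coset of \<open>q\<close>.\<close>

definition depth :: "'g \<Rightarrow> real" where
  "depth q = infdist (act q p) ((\<lambda>h. act h p) ` H)"

lemma depth_le: "h \<in> H \<Longrightarrow> depth q \<le> dist (act q p) (act h p)"
  unfolding depth_def by (intro infdist_le) auto

lemma depth_greatest: "(\<And>h. h \<in> H \<Longrightarrow> r \<le> dist (act q p) (act h p)) \<Longrightarrow> r \<le> depth q"
  using H_one unfolding depth_def infdist_def by (auto simp del: H_one intro!: cINF_greatest)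

lemma depth_nonneg: "0 \<le> depth q"
  unfolding depth_def by (rule infdist_nonneg)

lemma depth_mult_le: "q \<in> carrier \<Gamma> \<Longrightarrow> v \<in> carrier \<Gamma> \<Longrightarrow> depth (q \<otimes> v) \<le> depth q + len v"
  unfolding depth_def
  using infdist_triangle[of "act (q \<otimes> v) p" _ "act q p"] by (simp add: len_def dist_commute)

lemma conj_mult: "q \<in> carrier \<Gamma> \<Longrightarrow> h \<in> carrier \<Gamma> \<Longrightarrow> q \<otimes> h = (q \<otimes> h \<otimes> inv q) \<otimes> q"
  by (simp add: m_assoc)

text \<open>By normality \<open>q \<otimes> h = c \<otimes> q\<close> with \<open>c \<in> H\<close>,
  and left translation by \<open>c\<close> preserves the orbit of \<open>H\<close>.\<close>

lemma depth_coset_le: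
  assumes q: "q \<in> carrier \<Gamma>" and h: "h \<in> H"
  shows "depth q \<le> depth (q \<otimes> h)"
proof (rule depth_greatest)
  fix k assume k: "k \<in> H"
  define c where "c = q \<otimes> h \<otimes> inv q"
  have c: "c \<in> H" using H_conj q h by (simp add: c_def)
  have "q \<otimes> h = c \<otimes> q" unfolding c_def using conj_mult q H_carrier[OF h] by blast
  then have "dist (act (q \<otimes> h) p) (act k p) = dist (act q p) (act (inv c \<otimes> k) p)"
    using q H_carrier[OF c] H_carrier[OF k] by (simp add: dist_act_left[of c])
  then show "depth q \<le> dist (act (q \<otimes> h) p) (act k p)"
    using depth_le[of "inv c \<otimes> k" q] c k H_inv H_mult by simp
qed

lemma depth_coset:
  assumes "q \<in> carrier \<Gamma>" "h \<in> H"
  shows "depth (q \<otimes> h) = depth q"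
proof (rule antisym)
  show "depth q \<le> depth (q \<otimes> h)" using assms by (rule depth_coset_le)
  have "depth (q \<otimes> h) \<le> depth (q \<otimes> h \<otimes> inv h)"
    using assms H_carrier H_inv by (intro depth_coset_le) auto
  then show "depth (q \<otimes> h) \<le> depth q"
    using assms H_carrier by (simp add: m_assoc)
qed

lemma depth_ge_coset_len:
  assumes q: "q \<in> carrier \<Gamma>" and r: "\<And>h. h \<in> H \<Longrightarrow> r \<le> len (q \<otimes> h)"
  shows "r \<le> depth q"
proof (rule depth_greatest)
  fix k assume k: "k \<in> H"
  define h where "h = inv q \<otimes> inv k \<otimes> q"
  have kc: "k \<in> carrier \<Gamma>" using H_carrier k by blast
  have "h \<in> H" using H_conj[of "inv q" "inv k"] q k H_inv by (simp add: h_def)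
  moreover have "q \<otimes> h = inv k \<otimes> q" using q kc by (simp add: h_def m_assoc[symmetric])
  moreover have "len (inv k \<otimes> q) = dist (act q p) (act k p)"
    using q kc dist_orbit[of k q] by (simp add: dist_commute)
  ultimately show "r \<le> dist (act q p) (act k p)" using r by metis
qed

text \<open>The union of the cosets in the ball of radius \<open>n\<close> about the identity of
  \<open>\<Gamma>/H\<close>, with the elements of length at most \<open>r\<close> as
  generators.\<close>

primrec reach :: "real \<Rightarrow> nat \<Rightarrow> 'g set" where
  "reach r 0 = H"
| "reach r (Suc n) = {x \<otimes> t | x t. x \<in> reach r n \<and> t \<in> carrier \<Gamma> \<and> len t \<le> r}"

lemma reach_carrier: "reach r n \<subseteq> carrier \<Gamma>"
  by (induction n) (auto simp: H_carrier)

lemma reach_step: "x \<in> reach r n \<Longrightarrow> t \<in> carrier \<Gamma> \<Longrightarrow> len t \<le> r \<Longrightarrow> x \<otimes> t \<in> reach r (Suc n)"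
  by auto

lemma reach_Suc: "0 \<le> r \<Longrightarrow> reach r n \<subseteq> reach r (Suc n)"
  using reach_step[of _ r n \<one>] reach_carrier by fastforce

lemma reach_mono: "0 \<le> r \<Longrightarrow> m \<le> n \<Longrightarrow> reach r m \<subseteq> reach r n"
  by (rule lift_Suc_mono_le[of "reach r"]) (use reach_Suc in auto)

lemma reach_coset: "x \<in> reach r n \<Longrightarrow> h \<in> H \<Longrightarrow> x \<otimes> h \<in> reach r n"
proof (induction n arbitrary: x h)
  case 0
  then show ?case using H_mult by simp
next
  case (Suc n)
  then obtain y t where y: "x = y \<otimes> t" "y \<in> reach r n" "t \<in> carrier \<Gamma>" "len t \<le> r" by auto
  have c: "y \<in> carrier \<Gamma>" "h \<in> carrier \<Gamma>" using y reach_carrier H_carrier Suc.prems by blast+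
  have "x \<otimes> h = (y \<otimes> (t \<otimes> h \<otimes> inv t)) \<otimes> t" using y(1,3) c by (simp add: m_assoc)
  moreover have "y \<otimes> (t \<otimes> h \<otimes> inv t) \<in> reach r n"
    using Suc.IH y H_conj Suc.prems by blast
  ultimately show ?case using reach_step y(3,4) by metis
qed

lemma reach_left: "x \<in> reach r n \<Longrightarrow> h \<in> H \<Longrightarrow> h \<otimes> x \<in> reach r n"
proof -
  assume x: "x \<in> reach r n" and h: "h \<in> H"
  have c: "x \<in> carrier \<Gamma>" "h \<in> carrier \<Gamma>" using x h reach_carrier H_carrier by blast+
  have "h \<otimes> x = x \<otimes> (inv x \<otimes> h \<otimes> x)" using c by (simp add: m_assoc[symmetric])
  moreover have "inv x \<otimes> h \<otimes> x \<in> H" using H_conj[of "inv x" h] c h by simp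
  ultimately show ?thesis using reach_coset[OF x] by simp
qed

text \<open>The bound \<open>max r 0\<close> admits the identity as a filler for the positions from
  \<open>n\<close> on, also for negative \<open>r\<close>.\<close>

lemma reach_word:
  "x \<in> reach r n \<Longrightarrow> \<exists>h\<in>H. \<exists>t. (\<forall>i. t i \<in> carrier \<Gamma> \<and> len (t i) \<le> max r 0) \<and> x = h \<otimes> word t n"
proof (induction n arbitrary: x)
  case 0
  then show ?case using H_carrier by (intro bexI[of _ x] exI[of _ "\<lambda>_. \<one>"]) auto
next
  case (Suc n)
  then obtain y u where y: "x = y \<otimes> u" "y \<in> reach r n" "u \<in> carrier \<Gamma>" "len u \<le> r" by auto
  obtain h t where t: "h \<in> H" "\<forall>i. t i \<in> carrier \<Gamma> \<and> len (t i) \<le> max r 0" "y = h \<otimes> word t n"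
    using Suc.IH[OF y(2)] by blast
  let ?t = "t(n := u)"
  have "word ?t n = word t n" by (rule word_cong) simp
  then have "x = h \<otimes> word ?t (Suc n)"
    using y t H_carrier word_closed[of n t] by (simp add: m_assoc)
  moreover have "\<forall>i. ?t i \<in> carrier \<Gamma> \<and> len (?t i) \<le> max r 0" using t y by auto
  ultimately show ?case using t(1) by blast
qed

text \<open>Proper discontinuity leaves finitely many generators of length at most \<open>r\<close>,
  so balls in the quotient are finite.\<close>

lemma reach_finite_index:
  "\<exists>Y. finite Y \<and> Y \<subseteq> carrier \<Gamma> \<and> reach r n \<subseteq> (\<Union>y\<in>Y. H #> y)"
proof (induction n)
  case 0
  then show ?case using subgroup.subset[OF subgroup_H] by (intro exI[of _ "{\<one>}"]) (auto simp: coset_mult_one)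
next
  case (Suc n)
  then obtain Y where Y: "finite Y" "Y \<subseteq> carrier \<Gamma>" "reach r n \<subseteq> (\<Union>y\<in>Y. H #> y)" by blast
  let ?T = "{t \<in> carrier \<Gamma>. len t \<le> r}"
  let ?Y = "(\<lambda>(y, t). y \<otimes> t) ` (Y \<times> ?T)"
  have "reach r (Suc n) \<subseteq> (\<Union>y\<in>?Y. H #> y)"
  proof
    fix x assume "x \<in> reach r (Suc n)"
    then obtain z t where z: "x = z \<otimes> t" "z \<in> reach r n" "t \<in> ?T" by auto
    then obtain y h where y: "y \<in> Y" "h \<in> H" "z = h \<otimes> y" using Y(3) by (auto simp: r_coset_def)
    then have "x = h \<otimes> (y \<otimes> t)" using z Y(2) H_carrier by (auto simp: m_assoc)
    then show "x \<in> (\<Union>y\<in>?Y. H #> y)" using y z by (force simp: r_coset_def)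
  qed
  moreover have "finite ?Y" using Y(1) finite_len_le by blast
  moreover have "?Y \<subseteq> carrier \<Gamma>" using Y(2) by auto
  ultimately show ?case by blast
qed

lemma reach_neq_carrier: "reach r n \<noteq> carrier \<Gamma>"
proof
  assume eq: "reach r n = carrier \<Gamma>"
  obtain Y where Y: "finite Y" "Y \<subseteq> carrier \<Gamma>" "reach r n \<subseteq> (\<Union>y\<in>Y. H #> y)"
    using reach_finite_index[of r n] by blast
  have "rcosets H \<subseteq> (\<lambda>y. H #> y) ` Y"
  proof
    fix S assume "S \<in> rcosets H"
    then obtain x where x: "x \<in> carrier \<Gamma>" "S = H #> x" by (auto simp: RCOSETS_def)
    then obtain y where y: "y \<in> Y" "x \<in> H #> y" using Y(3) eq by blast
    then have "H #> y = H #> x" using repr_independence[of x H y] Y(2) subgroup_H by blast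
    then show "S \<in> (\<lambda>y. H #> y) ` Y" using x y by blast
  qed
  then show False using Y(1) infinite_index finite_surj by blast
qed

text \<open>Half of the quantity after \<open>R \<le>\<close> bounds from below, by the triangle
  inequality at both ends, the distance of a whole geodesic between the two orbit points from the
  orbit of \<open>H\<close>.\<close>

definition escaping :: "(nat \<Rightarrow> 'g) \<Rightarrow> bool" where
  "escaping v \<longleftrightarrow> (\<forall>i. v i \<in> carrier \<Gamma>) \<and>
     (\<forall>R. \<exists>k0. \<forall>k\<ge>k0. R \<le> depth (word v k) + depth (word v (Suc k)) - len (v k))"

text \<open>Koenig's lemma: the balls of the quotient never stop growing, so there are shortest
  words of every length, and a cluster point of them is an infinite geodesic of the quotient. As
  finitely many elements obey a given length bound, the depth along it tends to infinity.\<close>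

lemma escaping_bounded_steps:
  assumes r: "0 \<le> r" and grow: "\<And>n. reach r n \<noteq> reach r (Suc n)"
  shows "\<exists>v. escaping v"
proof -
  let ?T = "{t \<in> carrier \<Gamma>. len t \<le> r}"
  have prefix: "word t (Suc k) \<notin> reach r k"
    if t: "\<And>i. t i \<in> ?T" and n: "word t (Suc n) \<notin> reach r n" "k \<le> n" for t k n
  proof
    assume k: "word t (Suc k) \<in> reach r k"
    have "word t (Suc m) \<in> reach r m" if "k \<le> m" for m
      using that
    proof (induction m rule: dec_induct)
      case base
      then show ?case using k .
    next
      case (step m)
      have "word t (Suc m) \<otimes> t (Suc m) \<in> reach r (Suc m)"
        by (rule reach_step[OF step.IH]) (use t in auto)
      then show ?case by simp
    qed
    then show False using n by blast
  qed
  have "\<exists>t. (\<forall>i. t i \<in> ?T) \<and> word t (Suc n) \<notin> reach r n" for n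
  proof -
    obtain x where x: "x \<in> reach r (Suc n)" "x \<notin> reach r n" using grow[of n] reach_Suc[OF r] by blast
    then obtain h t where t: "h \<in> H" "\<And>i. t i \<in> ?T" "x = h \<otimes> word t (Suc n)"
      using reach_word[OF x(1)] r by fastforce
    then show ?thesis using x(2) reach_left by blast
  qed
  then obtain t where t: "\<And>n i. t n i \<in> ?T" "\<And>n. word (t n) (Suc n) \<notin> reach r n" by metis
  \<comment> \<open>Letters are coded by natural numbers, so that real distances below 1 mean
    equality.\<close>
  define c where "c = to_nat_on ?T"
  have fin: "finite ?T" by (rule finite_len_le)
  have c: "inj_on c ?T" unfolding c_def by (intro inj_on_to_nat_on countable_finite fin)
  have "\<exists>g. \<forall>I e N. finite I \<longrightarrow> e > 0 \<longrightarrow> (\<exists>n\<ge>N. \<forall>i\<in>I. dist (real (c (t n i))) (g i) < e)"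
    by (rule ex_pointwise_cluster_function[of "\<lambda>_. (\<lambda>x. real (c x)) ` ?T"])
      (use fin t in \<open>auto intro!: finite_imp_compact\<close>)
  then obtain g where g: "\<And>I e N. finite I \<Longrightarrow> e > 0 \<Longrightarrow> \<exists>n\<ge>N. \<forall>i\<in>I. dist (real (c (t n i))) (g i) < e"
    by blast
  have "\<exists>n\<ge>k. \<forall>i\<in>{..k}. dist (real (c (t n i))) (g i) < 1 / 2" for k
    by (rule g) auto
  then obtain n where n: "\<And>k. n k \<ge> k" "\<And>k i. i \<le> k \<Longrightarrow> dist (real (c (t (n k) i))) (g i) < 1 / 2"
    by (metis atMost_iff)
  define v where "v i = t (n i) i" for i
  have v: "t (n k) i = v i" if "i \<le> k" for i k
  proof -
    have "dist (real (c (t (n k) i))) (real (c (v i))) < 1"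
      unfolding v_def using n(2)[OF that] n(2)[of i i] by (rule dist_triangle_half_l[of _ "g i"]) simp_all
    then have "c (t (n k) i) = c (v i)" by (simp add: dist_real_def)
    then show ?thesis using c t unfolding v_def inj_on_def by blast
  qed
  have vT: "v i \<in> ?T" for i using t by (simp add: v_def)
  have wc: "word v k \<in> carrier \<Gamma>" for k using vT by (intro word_closed) auto
  have new: "word v (Suc k) \<notin> reach r k" for k
  proof -
    have "word v (Suc k) = word (t (n k)) (Suc k)" using v by (intro word_cong) simp
    then show ?thesis using prefix[OF t(1) t(2) n(1)] by metis
  qed
  have deep: "\<exists>k0. \<forall>k\<ge>k0. R \<le> depth (word v k)" for R
  proof -
    \<comment> \<open>Elements of length at most \<open>R\<close> that occur in some ball occur in a
      common one, \<open>reach r m\<close>; the coset of a later vertex is outside it and hence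
      contains no short element.\<close>
    define B where "B = {g \<in> carrier \<Gamma>. len g \<le> R} \<inter> (\<Union>n. reach r n)"
    have "finite B" unfolding B_def using finite_len_le by blast
    have "\<forall>g\<in>B. \<exists>n. g \<in> reach r n" by (auto simp: B_def)
    from bchoice[OF this] obtain f where f: "\<And>g. g \<in> B \<Longrightarrow> g \<in> reach r (f g)" by blast
    define m where "m = (\<Sum>g\<in>B. f g)"
    have m: "g \<in> reach r m" if "g \<in> B" for g
    proof -
      have "f g \<le> m" unfolding m_def using \<open>finite B\<close> that by (auto intro: member_le_sum)
      then show ?thesis using f[OF that] reach_mono[OF r] by blast
    qed
    have "R \<le> depth (word v k)" if k: "k \<ge> Suc m" for k
    proof (rule depth_ge_coset_len[OF wc])
      fix h assume h: "h \<in> H"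
      define l where "l = k - 1"
      have l: "k = Suc l" "m \<le> l" using k unfolding l_def by linarith+
      have "word v k \<in> reach r k" for k
      proof (induction k)
        case (Suc k)
        then show ?case using reach_step[of "word v k" r k "v k"] vT by simp
      qed simp
      then have wh: "word v k \<otimes> h \<in> reach r k" using reach_coset h by blast
      show "R \<le> len (word v k \<otimes> h)"
      proof (rule ccontr)
        assume "\<not> ?thesis"
        then have "word v k \<otimes> h \<in> B" using wh reach_carrier unfolding B_def by fastforce
        then have "word v k \<otimes> h \<in> reach r l" using m reach_mono[OF r l(2)] by blast
        then have "word v k \<otimes> h \<otimes> inv h \<in> reach r l" using reach_coset H_inv h by blast
        then have "word v k \<in> reach r l" using wc H_carrier[OF h] by (simp add: m_assoc)
        then show False using new l(1) by blast
      qed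
    qed
    then show ?thesis by blast
  qed
  have "\<exists>k0. \<forall>k\<ge>k0. R \<le> depth (word v k) + depth (word v (Suc k)) - len (v k)" for R
  proof -
    obtain k0 where k0: "\<And>k. k \<ge> k0 \<Longrightarrow> max R 0 + r \<le> depth (word v k)" using deep by blast
    have "R \<le> depth (word v k) + depth (word v (Suc k)) - len (v k)" if "k \<ge> k0" for k
    proof -
      have "len (v k) \<le> r" using vT[of k] by simp
      then show ?thesis using k0[OF that] depth_nonneg[of "word v (Suc k)"] by linarith
    qed
    then show ?thesis by blast
  qed
  then have "escaping v" unfolding escaping_def using vT by blast
  then show ?thesis by blast
qed

text \<open>Here the bounded steps generate only proper subgroups. A shortest element \<open>v\<close> outside such a subgroup
  \<open>P \<supseteq> H\<close> is as short as any element of \<open>q v H\<close> for \<open>q \<in> P\<close>, so \<open>q v\<close> is at least as deep as \<open>v\<close> is long.\<close>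

lemma escaping_long_steps:
  assumes stop: "\<And>r. 0 \<le> r \<Longrightarrow> \<exists>n. reach r n = reach r (Suc n)"
  shows "\<exists>v. escaping v"
proof -
  have next_step: "\<exists>v\<in>carrier \<Gamma>. real k \<le> len v \<and> len v \<le> depth (q \<otimes> v)" if q: "q \<in> carrier \<Gamma>" for q k
  proof -
    \<comment> \<open>The subgroup \<open>P\<close> generated by \<open>H\<close> and the elements
      of length at most \<open>r\<close> contains \<open>q\<close>, and every element outside it is
      longer than \<open>k\<close>.\<close>
    define r where "r = max (len q) (real k)"
    have r: "0 \<le> r" "len q \<le> r" "real k \<le> r" by (auto simp: r_def)
    obtain n where n: "reach r n = reach r (Suc n)" using stop r by blast
    define P where "P = reach r n"
    have P_step: "x \<otimes> t \<in> P" if "x \<in> P" "t \<in> carrier \<Gamma>" "len t \<le> r" for x t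
      using reach_step that n unfolding P_def by blast
    have P_c: "P \<subseteq> carrier \<Gamma>" unfolding P_def by (rule reach_carrier)
    have P_H: "H \<subseteq> P" using reach_mono[OF r(1), of 0 n] by (simp add: P_def)
    have P_T: "t \<in> P" if "t \<in> carrier \<Gamma>" "len t \<le> r" for t
      using P_step[OF subsetD[OF P_H H_one] that] that by simp
    have P_mult: "x \<otimes> y \<in> P" if "x \<in> P" "y \<in> reach r m" for x y m
      using that(2)
    proof (induction m arbitrary: y)
      case 0
      then show ?case using reach_coset that(1) by (simp add: P_def)
    next
      case (Suc m)
      then obtain z t where z: "y = z \<otimes> t" "z \<in> reach r m" "t \<in> carrier \<Gamma>" "len t \<le> r" by auto
      then have "x \<otimes> z \<otimes> t \<in> P" using Suc.IH P_step by blast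
      moreover have "x \<in> carrier \<Gamma>" "z \<in> carrier \<Gamma>" using that(1) P_c z reach_carrier by blast+
      ultimately show ?case using z by (simp add: m_assoc)
    qed
    have P_inv: "inv y \<in> P" if "y \<in> reach r m" for y m
      using that
    proof (induction m arbitrary: y)
      case 0
      then show ?case using P_H H_inv by auto
    next
      case (Suc m)
      then obtain z t where z: "y = z \<otimes> t" "z \<in> reach r m" "t \<in> carrier \<Gamma>" "len t \<le> r" by auto
      then have "inv t \<otimes> inv z \<in> P" using P_mult[of "inv t" "inv z" n] P_T Suc.IH unfolding P_def by auto
      moreover have "z \<in> carrier \<Gamma>" using z reach_carrier by blast
      ultimately show ?case using z by (simp add: inv_mult_group)
    qed
    have "P \<noteq> carrier \<Gamma>" unfolding P_def by (rule reach_neq_carrier)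
    then obtain v0 where v0: "v0 \<in> carrier \<Gamma>" "v0 \<notin> P" using P_c by blast
    let ?S = "{g \<in> carrier \<Gamma>. len g \<le> len v0} - P"
    have "finite ?S" "?S \<noteq> {}" using finite_len_le v0 by auto
    then obtain v where v: "v \<in> ?S" "\<And>g. g \<in> ?S \<Longrightarrow> len v \<le> len g"
      using arg_min_if_finite[of ?S len] by (meson not_less)
    have vmin: "len v \<le> len g" if "g \<in> carrier \<Gamma>" "g \<notin> P" for g
      using v that by (cases "len g \<le> len v0") auto
    have "len v \<le> depth (q \<otimes> v)"
    proof (rule depth_ge_coset_len)
      show "q \<otimes> v \<in> carrier \<Gamma>" using q v by simp
      fix h assume h: "h \<in> H"
      have hc: "h \<in> carrier \<Gamma>" using H_carrier h by blast
      have "q \<otimes> v \<otimes> h \<notin> P"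
      proof
        assume "q \<otimes> v \<otimes> h \<in> P"
        then have "q \<otimes> v \<otimes> h \<otimes> inv h \<in> P" using reach_coset H_inv h unfolding P_def by blast
        then have "q \<otimes> v \<in> P" using q v hc by (simp add: m_assoc)
        moreover have "inv q \<in> P" using P_inv[of q n] P_T q r by (simp add: P_def)
        ultimately have "inv q \<otimes> (q \<otimes> v) \<in> P" using P_mult unfolding P_def by blast
        then show False using v q by (simp add: m_assoc[symmetric])
      qed
      then show "len v \<le> len (q \<otimes> v \<otimes> h)" using vmin q v hc by simp
    qed
    moreover have "real k \<le> len v" using P_T[of v] v r by force
    ultimately show ?thesis using v by blast
  qed
  have "\<exists>q. \<forall>n. (q n \<in> carrier \<Gamma> \<and> (n = 0 \<longrightarrow> q n = \<one>)) \<and>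
    (\<exists>v\<in>carrier \<Gamma>. q (Suc n) = q n \<otimes> v \<and> real n \<le> len v \<and> len v \<le> depth (q (Suc n)))"
  proof (rule dependent_nat_choice)
    show "\<exists>x. x \<in> carrier \<Gamma> \<and> (0 = (0::nat) \<longrightarrow> x = \<one>)" by auto
    show "\<exists>y. (y \<in> carrier \<Gamma> \<and> (Suc n = 0 \<longrightarrow> y = \<one>)) \<and>
      (\<exists>v\<in>carrier \<Gamma>. y = x \<otimes> v \<and> real n \<le> len v \<and> len v \<le> depth y)"
      if "x \<in> carrier \<Gamma> \<and> (n = 0 \<longrightarrow> x = \<one>)" for x n
    proof -
      have x: "x \<in> carrier \<Gamma>" using that by simp
      obtain v where "v \<in> carrier \<Gamma>" "real n \<le> len v" "len v \<le> depth (x \<otimes> v)"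
        using next_step[OF x, of n] by blast
      then show ?thesis using x by (intro exI[of _ "x \<otimes> v"] conjI bexI[of _ v]) auto
    qed
  qed
  then obtain q where "\<forall>n. (q n \<in> carrier \<Gamma> \<and> (n = 0 \<longrightarrow> q n = \<one>)) \<and>
    (\<exists>v\<in>carrier \<Gamma>. q (Suc n) = q n \<otimes> v \<and> real n \<le> len v \<and> len v \<le> depth (q (Suc n)))"
    by (elim exE)
  then have q: "q 0 = \<one>"
    "\<forall>n. \<exists>v\<in>carrier \<Gamma>. q (Suc n) = q n \<otimes> v \<and> real n \<le> len v \<and> len v \<le> depth (q (Suc n))"
    by simp_all
  from q(2) have "\<forall>n. \<exists>v. v \<in> carrier \<Gamma> \<and> q (Suc n) = q n \<otimes> v \<and> real n \<le> len v \<and> len v \<le> depth (q (Suc n))"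
    by blast
  from choice[OF this] obtain v where "\<forall>n. v n \<in> carrier \<Gamma> \<and>
    q (Suc n) = q n \<otimes> v n \<and> real n \<le> len (v n) \<and> len (v n) \<le> depth (q (Suc n))"
    by (elim exE)
  then have v: "\<And>n. v n \<in> carrier \<Gamma>" "\<And>n. q (Suc n) = q n \<otimes> v n"
    "\<And>n. real n \<le> len (v n)" "\<And>n. len (v n) \<le> depth (q (Suc n))" by blast+
  have w: "word v n = q n" for n using q(1) v(2) by (induction n) auto
  have "\<exists>k0. \<forall>k\<ge>k0. R \<le> depth (word v k) + depth (word v (Suc k)) - len (v k)" for R
  proof -
    obtain k0 :: nat where k0: "R \<le> real k0" using real_arch_simple by blast
    have "R \<le> depth (word v k) + depth (word v (Suc k)) - len (v k)" if "k \<ge> Suc k0" for k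
    proof -
      define l where "l = k - 1"
      have l: "k = Suc l" "k0 \<le> l" using that unfolding l_def by linarith+
      \<comment> \<open>The preceding step provides a depth of at least \<open>k - 1\<close>, and
        the depth reached by the current step compensates its length.\<close>
      have "R \<le> depth (q k)" using v(3)[of l] v(4)[of l] l k0 by simp
      then show ?thesis using v(4)[of k] unfolding w by simp
    qed
    then show ?thesis by blast
  qed
  then have "escaping v" unfolding escaping_def using v(1) by blast
  then show ?thesis by blast
qed

lemma ex_escaping: "\<exists>v. escaping v"
  using escaping_bounded_steps escaping_long_steps by blast

text \<open>Any escaping sequence may be delayed by identity steps until it travels at speed at most one.\<close>

lemma ex_slow_escaping: "\<exists>v. escaping v \<and> (\<forall>k. (\<Sum>i<k. len (v i)) \<le> real k)"
proof -
  obtain v where v: "escaping v" using ex_escaping by blast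
  have vc: "v i \<in> carrier \<Gamma>" for i using v by (simp add: escaping_def)
  define L where "L j = (\<Sum>i<j. len (v i))" for j
  \<comment> \<open>\<open>J k\<close> counts the letters of \<open>v\<close> used up to time
    \<open>k\<close>; the next letter waits until the total length including it is at most the
    elapsed time.\<close>
  define J where "J = rec_nat 0 (\<lambda>k j. if L (Suc j) \<le> real k then Suc j else j)"
  have J: "J 0 = 0" "\<And>k. J (Suc k) = (if L (Suc (J k)) \<le> real k then Suc (J k) else J k)"
    by (simp_all add: J_def)
  define v' where "v' k = (if L (Suc (J k)) \<le> real k then v (J k) else \<one>)" for k
  have v'c: "v' k \<in> carrier \<Gamma>" for k using vc by (simp add: v'_def)
  have wc: "word v k \<in> carrier \<Gamma>" for k using vc by (intro word_closed) auto
  have w: "word v' k = word v (J k)" for k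
    using wc vc by (induction k) (auto simp: J v'_def)
  have sum: "(\<Sum>i<k. len (v' i)) = L (J k)" for k
    by (induction k) (auto simp: J v'_def L_def)
  have LJ: "L (J k) \<le> real k" for k
    by (induction k) (auto simp: J L_def[of 0])
  have mono: "J k \<le> J (k + d)" for k d
    by (induction d) (auto simp: J intro: le_SucI)
  have large: "\<exists>k0. \<forall>k\<ge>k0. j \<le> J k" for j
  proof (induction j)
    case (Suc j)
    then obtain k0 where k0: "\<And>k. k \<ge> k0 \<Longrightarrow> j \<le> J k" by blast
    obtain m :: nat where m: "L (Suc j) \<le> real m" using real_arch_simple by blast
    have "Suc j \<le> J k" if "k \<ge> Suc (max k0 m)" for k
    proof (rule ccontr)
      assume "\<not> ?thesis"
      define l where "l = k - 1"
      have l: "k = Suc l" "l \<ge> max k0 m" using that unfolding l_def by linarith+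
      then have "J l \<le> J k" using mono[of l 1] by simp
      then have "J l = j" "J k = j" using k0[of l] k0[of k] l \<open>\<not> Suc j \<le> J k\<close> by auto
      then show False using J(2)[of l] m l by (auto split: if_splits)
    qed
    then show ?case by blast
  qed auto
  have "\<exists>k0. \<forall>k\<ge>k0. R \<le> depth (word v' k) + depth (word v' (Suc k)) - len (v' k)" for R
  proof -
    obtain j0 where j0: "\<And>j. j \<ge> j0 \<Longrightarrow> R \<le> depth (word v j) + depth (word v (Suc j)) - len (v j)"
      using v unfolding escaping_def by blast
    obtain k0 where k0: "\<And>k. k \<ge> k0 \<Longrightarrow> j0 \<le> J k" using large by blast
    have "R \<le> depth (word v' k) + depth (word v' (Suc k)) - len (v' k)" if "k \<ge> k0" for k
    proof (cases "L (Suc (J k)) \<le> real k")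
      case True
      then show ?thesis using j0[OF k0[OF that]] unfolding w by (simp add: J v'_def)
    next
      case False
      have "R \<le> depth (word v (J k)) + depth (word v (Suc (J k))) - len (v (J k))"
        using j0[OF k0[OF that]] .
      \<comment> \<open>An idle step has both ends at position \<open>J k\<close>; as the depth is
        1-Lipschitz, twice its value there is at least the expression for the next letter of
        \<open>v\<close>.\<close>
      also have "\<dots> \<le> 2 * depth (word v (J k))"
        using depth_mult_le[OF wc vc, of "J k" "J k"] by simp
      finally show ?thesis using False unfolding w by (simp add: J v'_def)
    qed
    then show ?thesis by blast
  qed
  then have "escaping v'" unfolding escaping_def using v'c by blast
  then show ?thesis using sum LJ by (intro exI[of _ v']) auto
qed

end

section \<open>A Cantor set of non-conical limit points\<close>

context hyperbolic_action
begin

lemma admissible_conv: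
  assumes "\<And>n. admissible K s n" "0 \<le> K"
  shows "conv_at_infinity p (\<lambda>n. act (word s n) p)"
  unfolding conv_at_infinity_def
proof
  fix M
  obtain N :: nat where N: "M + K + 2 * \<delta> \<le> real N" using real_arch_simple by blast
  have *: "M \<le> gp p (act (word s m) p) (act (word s n) p)" if "N \<le> m" "m \<le> n" for m n
    using admissible_gp_word[OF assms(1) that(2) order_refl assms(2)]
      admissible_len_ge[OF assms(1) assms(2) that(2)] that N by simp
  have "M \<le> gp p (act (word s m) p) (act (word s n) p)" if "N \<le> m" "N \<le> n" for m n
    using *[of m n] *[of n m] that gp_commute[of p "act (word s m) p"] by (cases "m \<le> n") auto
  then show "\<exists>N. \<forall>m\<ge>N. \<forall>n\<ge>N. M \<le> gp p (act (word s m) p) (act (word s n) p)" by blast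
qed

end

context normal_subgroup_action
begin

text \<open>If \<open>w\<close> tends to a limit point, then so does \<open>w f w^{-1} \<in> H\<close> for connectors \<open>f\<close> adapted to \<open>w\<close>.\<close>

lemma limit_point_in_limit_set_H:
  assumes w: "\<And>n. w n \<in> carrier \<Gamma>" and conv: "converges_to_bdry p (\<lambda>n. act (w n) p) \<xi>"
  shows "\<xi> \<in> limit_set p act H"
proof -
  obtain K where K: "0 \<le> K" "\<And>M. \<exists>F. is_connector_set K M F"
    using ex_connectors by blast
  define M where "M = 2 * K + 4 * \<delta> + 1"
  obtain F where F: "F \<subseteq> H" "\<And>f. f \<in> F \<Longrightarrow> M \<le> len f"
    "\<And>x y. \<exists>f\<in>F. gp p x (act f p) \<le> K \<and> gp p (act (inv f) p) y \<le> K"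
    using K(2)[of M] unfolding is_connector_set_def by blast
  have cw: "conv_at_infinity p (\<lambda>n. act (w n) p)"
    using conv boundary_conv unfolding converges_to_bdry_def by blast
  obtain N where N: "\<And>n. n \<ge> N \<Longrightarrow> M \<le> len (w n)"
    using conv_dist_at_top[OF cw] unfolding len_def by blast
  have "\<forall>n. \<exists>f\<in>F. gp p (act (inv (w n)) p) (act f p) \<le> K \<and> gp p (act (inv f) p) (act (inv (w n)) p) \<le> K"
    using F(3) by blast
  then obtain f where f: "\<And>n. f n \<in> F" "\<And>n. gp p (act (inv (w n)) p) (act (f n) p) \<le> K"
    "\<And>n. gp p (act (inv (f n)) p) (act (inv (w n)) p) \<le> K" by metis
  define g where "g n = w (n + N) \<otimes> f (n + N) \<otimes> inv (w (n + N))" for n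
  have fH: "f n \<in> H" for n using f F by blast
  have fc: "f n \<in> carrier \<Gamma>" for n using fH H_carrier by blast
  have gH: "g n \<in> H" for n unfolding g_def using w fH by (intro H_conj) auto
  \<comment> \<open>The letters \<open>w\<close>, \<open>f\<close>, \<open>inv w\<close> form an
    admissible word, so the conjugate follows \<open>w\<close> up to a bounded error.\<close>
  have near: "len (w (n + N)) - K - 2 * \<delta> \<le> gp p (act (g n) p) (act (w (n + N)) p)" for n
  proof -
    define s where "s = (!) [w (n + N), f (n + N), inv (w (n + N))]"
    have adm: "admissible K s 3"
      unfolding admissible_def using w fc F(2) f N[of "n + N"]
      by (auto simp: s_def M_def less_Suc_eq numeral_3_eq_3)
    have "word s 3 = g n" "word s 1 = w (n + N)"
      using w fc by (simp_all add: s_def g_def numeral_3_eq_3)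
    then show ?thesis using admissible_gp_word[OF adm, of 1 3] K by (simp add: gp_commute)
  qed
  have shifted: "seq_equiv p (\<lambda>n. act (w (n + N)) p) (\<lambda>n. act (w n) p)"
    using seq_equiv_subseq[of "\<lambda>n. act (w n) p" "\<lambda>n. act (w n) p" "\<lambda>n. n + N" id] cw
    by (simp add: conv_iff_seq_equiv o_def strict_mono_def)
  have "seq_equiv p (\<lambda>n. act (g n) p) (\<lambda>n. act (w (n + N)) p)"
  proof (rule seq_equiv_of_diagonal)
    show "conv_at_infinity p (\<lambda>n. act (w (n + N)) p)"
      using shifted conv_iff_seq_equiv seq_equiv_sym seq_equiv_trans by blast
    fix M
    obtain N' where "\<And>n. n \<ge> N' \<Longrightarrow> M + K + 2 * \<delta> \<le> len (w n)"
      using conv_dist_at_top[OF cw] unfolding len_def by blast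
    then have "M \<le> gp p (act (g n) p) (act (w (n + N)) p)" if "n \<ge> N'" for n
      using near[of n] that by (smt (verit) trans_le_add1)
    then show "\<exists>N'. \<forall>n\<ge>N'. M \<le> gp p (act (g n) p) (act (w (n + N)) p)" by blast
  qed
  then have "seq_equiv p (\<lambda>n. act (g n) p) (\<lambda>n. act (w n) p)"
    using shifted seq_equiv_trans by blast
  then have "converges_to_bdry p (\<lambda>n. act (g n) p) \<xi>"
    using conv converges_to_bdry_seq_equiv by blast
  then show ?thesis unfolding limit_set_def using gH by blast
qed

text \<open>A point \<open>\<gamma> t\<close> near the orbit of \<open>H\<close> is close to the
  orbit path between the prefixes whose lengths straddle \<open>t\<close>. The depths of these two
  prefixes are at most \<open>R\<close> plus their distances to \<open>\<gamma> t\<close>, and the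
  distances add up to \<open>len (s i)\<close> and a constant at most, contradicting
  \<open>drift\<close>.\<close>

lemma escaping_limit_not_conical:
  assumes adm: "\<And>n. admissible K s n" and K: "0 \<le> K"
    and drift: "\<And>R. \<exists>n0. \<forall>n\<ge>n0. R \<le> depth (word s n) + depth (word s (Suc n)) - len (s n)"
    and conv: "converges_to_bdry p (\<lambda>n. act (word s n) p) \<xi>"
  shows "\<xi> \<notin> conical_limit_set p act H"
proof
  assume "\<xi> \<in> conical_limit_set p act H"
  then obtain g R \<gamma> where R: "R > 0" and g: "\<And>n. g n \<in> H" "converges_to_bdry p (\<lambda>n. act (g n) p) \<xi>"
    and ray: "geodesic_ray p \<gamma> \<xi>" and near: "\<And>n. \<exists>t\<ge>0. dist (act (g n) p) (\<gamma> t) \<le> R"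
    unfolding conical_limit_set_def by blast
  define x where "x n = act (word s n) p" for n
  have sc: "s n \<in> carrier \<Gamma>" for n using adm[of "Suc n"] by (simp add: admissible_def)
  have wc: "word s n \<in> carrier \<Gamma>" for n using sc by (intro word_closed)
  have \<gamma>: "\<gamma> 0 = p" "\<And>s t. 0 \<le> s \<Longrightarrow> 0 \<le> t \<Longrightarrow> dist (\<gamma> s) (\<gamma> t) = \<bar>s - t\<bar>"
    "converges_to_bdry p (\<lambda>n. \<gamma> (real n)) \<xi>"
    using ray by (auto simp: geodesic_ray_def)
  have eq: "seq_equiv p (\<lambda>n. \<gamma> (real n)) x"
    using \<gamma>(3) conv boundary_mem_iff unfolding converges_to_bdry_def x_def[abs_def] by blast
  \<comment> \<open>Twice the error \<open>R + 2 * K + 6 * \<delta>\<close> made at one prefix, and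
    1 for strictness.\<close>
  obtain n0 where n0: "\<And>n. n \<ge> n0 \<Longrightarrow>
      2 * R + 4 * K + 12 * \<delta> + 1 \<le> depth (word s n) + depth (word s (Suc n)) - len (s n)"
    using drift by blast
  \<comment> \<open>A time beyond all prefix lengths up to \<open>n0\<close> forces the index
    \<open>i\<close> below to be at least \<open>n0\<close>.\<close>
  define T where "T = (\<Sum>i\<le>n0. len (word s i))"
  have "conv_at_infinity p (\<lambda>n. act (g n) p)"
    using g boundary_conv unfolding converges_to_bdry_def by blast
  then obtain m where m: "T + R \<le> dist p (act (g m) p)" using conv_dist_at_top by blast
  obtain t where t: "0 \<le> t" "dist (act (g m) p) (\<gamma> t) \<le> R" using near by blast
  have dt: "dist p (\<gamma> t) = t" using \<gamma>(1) \<gamma>(2)[of 0 t] t by simp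
  have "T \<le> t" using m t dt dist_triangle[of p "act (g m) p" "\<gamma> t"] by (simp add: dist_commute)
  have ex: "\<exists>i. t < len (word s (Suc i))"
  proof -
    obtain j :: nat where "t < real j" using reals_Archimedean2 by blast
    then show ?thesis using admissible_len_ge[OF adm K, of "Suc j" "Suc j"] by (intro exI[of _ j]) simp
  qed
  define i where "i = (LEAST i. t < len (word s (Suc i)))"
  have i1: "t < len (word s (Suc i))" unfolding i_def using LeastI_ex[OF ex] .
  have i2: "len (word s i) \<le> t"
  proof (cases i)
    case (Suc j)
    then have "\<not> t < len (word s (Suc j))"
      using not_less_Least[of j "\<lambda>i. t < len (word s (Suc i))"] by (simp add: i_def)
    then show ?thesis using Suc by simp
  qed (use t in simp)
  have i3: "n0 \<le> i"
  proof (rule ccontr)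
    assume "\<not> ?thesis"
    then have "len (word s (Suc i)) \<le> T"
      unfolding T_def by (intro member_le_sum) (auto simp: len_nonneg)
    then show False using i1 \<open>T \<le> t\<close> by simp
  qed
  obtain N where N: "\<And>m n. m \<ge> N \<Longrightarrow> n \<ge> N \<Longrightarrow> t \<le> gp p (\<gamma> (real m)) (x n)"
    using eq unfolding seq_equiv_def by metis
  obtain N' :: nat where N': "t \<le> real N'" using real_arch_simple by blast
  define k where "k = max N (max N' (Suc i))"
  have k: "k \<ge> N" "t \<le> real k" "Suc i \<le> k" using N' by (auto simp: k_def)
  have "gp p (\<gamma> t) (\<gamma> (real k)) = t"
    using \<gamma>(2)[of t "real k"] \<gamma>(2)[of 0 "real k"] \<gamma>(1) t k dt by (simp add: gromov_product_def)
  then have tk: "t - \<delta> \<le> gp p (\<gamma> t) (x k)"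
    using N[OF k(1) k(1)] hyp[of p "\<gamma> t" "\<gamma> (real k)" "x k"] by simp
  have d: "dist (\<gamma> t) (x j) \<le> \<bar>len (word s j) - t\<bar> + 2 * K + 6 * \<delta>" if "j \<le> k" for j
  proof -
    have "len (word s j) - K - 2 * \<delta> \<le> gp p (x j) (x k)"
      using admissible_gp_word[OF adm that order_refl K] by (simp add: x_def)
    then have "min t (len (word s j)) - K - 3 * \<delta> \<le> gp p (\<gamma> t) (x j)"
      using tk hyp[of p "\<gamma> t" "x k" "x j"] K delta_nonneg by (auto simp: gp_commute min_def split: if_splits)
    moreover have "dist (\<gamma> t) (x j) = t + len (word s j) - 2 * gp p (\<gamma> t) (x j)"
      using dist_eq_gp[of "\<gamma> t" "x j" p] dt by (simp add: x_def len_def)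
    ultimately show ?thesis by (auto simp: min_def abs_if split: if_splits)
  qed
  have dep: "depth (word s j) \<le> R + dist (\<gamma> t) (x j)" for j
    using depth_le[OF g(1), of "word s j" m] dist_triangle[of "x j" "act (g m) p" "\<gamma> t"] t(2)
    by (simp add: x_def dist_commute)
  have "len (word s (Suc i)) \<le> len (word s i) + len (s i)"
    using len_mult_le[OF wc sc] by simp
  then show False
    using d[of i] d[of "Suc i"] dep[of i] dep[of "Suc i"] n0[OF i3] i1 i2 k by (auto simp: abs_if split: if_splits)
qed

text \<open>The element \<open>t\<close> represents the coset of \<open>v\<close> at an additive
  cost \<open>c\<close> in length. It fits between any two letters that admit the connector
  \<open>f\<close> on both sides, so one transition serves all words.\<close>

definition is_transition :: "real \<Rightarrow> real \<Rightarrow> 'g \<Rightarrow> real \<Rightarrow> 'g \<Rightarrow> 'g \<Rightarrow> bool" where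
  "is_transition K M f c v t \<longleftrightarrow>
     t \<in> carrier \<Gamma> \<and> inv v \<otimes> t \<in> H \<and> len t \<le> len v + c \<and> M \<le> len t \<and>
     (\<forall>a\<in>carrier \<Gamma>. M \<le> len a \<longrightarrow>
        gp p (act (inv a) p) (act f p) \<le> K \<longrightarrow> gp p (act (inv f) p) (act a p) \<le> K \<longrightarrow>
        gp p (act (inv a) p) (act t p) \<le> K + 2 * \<delta> \<and> gp p (act (inv t) p) (act a p) \<le> K + 2 * \<delta>)"

text \<open>The transition \<open>f \<psi> v' \<psi>' f\<close> lies in the coset \<open>v H\<close>; here \<open>v'\<close> is a long representative of
  that coset and \<open>\<psi>\<close>, \<open>\<psi>'\<close> are connectors making the concatenation a local quasigeodesic.\<close>

lemma ex_transition:
  assumes F: "is_connector_set K M F" and K: "0 \<le> K" and M: "2 * K + 4 * \<delta> + 1 \<le> M"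
  shows "\<exists>c\<ge>0. \<forall>f\<in>F. \<forall>v\<in>carrier \<Gamma>. \<exists>t. is_transition K M f c v t"
proof -
  obtain g where g: "g \<in> H" "2 * M \<le> len g" using ex_long_H by blast
  have gc: "g \<in> carrier \<Gamma>" using g H_carrier by blast
  have fin: "finite F" and FH: "\<And>f. f \<in> F \<Longrightarrow> f \<in> H" and FM: "\<And>f. f \<in> F \<Longrightarrow> M \<le> len f"
    and Fxy: "\<And>x y. \<exists>f\<in>F. gp p x (act f p) \<le> K \<and> gp p (act (inv f) p) y \<le> K"
    using F unfolding is_connector_set_def by auto
  define L where "L = sum len F"
  have L: "len f \<le> L" if "f \<in> F" for f
    unfolding L_def using that fin by (intro member_le_sum) (auto simp: len_nonneg)
  have L0: "0 \<le> L" unfolding L_def by (intro sum_nonneg) (auto simp: len_nonneg)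
  have main: "\<exists>t. is_transition K M f (len g + 4 * L) v t"
    if f: "f \<in> F" and v: "v \<in> carrier \<Gamma>" for f v
  proof -
    have fc: "f \<in> carrier \<Gamma>" using f FH H_carrier by blast
    \<comment> \<open>A short \<open>v\<close> is lengthened inside its coset by \<open>g\<close>,
      whose length of at least \<open>2 * M\<close> survives the loss of
      \<open>len v < M\<close>.\<close>
    have "\<exists>h\<in>H. M \<le> len (v \<otimes> h) \<and> len (v \<otimes> h) \<le> len v + len g"
    proof (cases "M \<le> len v")
      case True
      then show ?thesis using v len_nonneg[of g] by (intro bexI[of _ \<one>]) auto
    next
      case False
      have "len g \<le> len (inv v) + len (v \<otimes> g)"
        using len_mult_le[of "inv v" "v \<otimes> g"] v gc by (simp add: m_assoc[symmetric])
      then show ?thesis using False g v gc len_mult_le[of v g] by (intro bexI[of _ g]) auto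
    qed
    then obtain h where h: "h \<in> H" "M \<le> len (v \<otimes> h)" "len (v \<otimes> h) \<le> len v + len g" by blast
    define u where "u = v \<otimes> h"
    have hc: "h \<in> carrier \<Gamma>" using h H_carrier by blast
    have uc: "u \<in> carrier \<Gamma>" using v hc by (simp add: u_def)
    obtain a1 where a1: "a1 \<in> F" "gp p (act (inv f) p) (act a1 p) \<le> K" "gp p (act (inv a1) p) (act u p) \<le> K"
      using Fxy by blast
    obtain a2 where a2: "a2 \<in> F" "gp p (act (inv u) p) (act a2 p) \<le> K" "gp p (act (inv a2) p) (act f p) \<le> K"
      using Fxy by blast
    have ac: "a1 \<in> carrier \<Gamma>" "a2 \<in> carrier \<Gamma>" using a1 a2 FH H_carrier by blast+
    define t where "t = f \<otimes> a1 \<otimes> u \<otimes> a2 \<otimes> f"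
    have tc: "t \<in> carrier \<Gamma>" using fc ac uc by (simp add: t_def)
    have "inv v \<otimes> t = (inv v \<otimes> (f \<otimes> a1) \<otimes> inv (inv v)) \<otimes> h \<otimes> (a2 \<otimes> f)"
      using v fc ac hc by (simp add: t_def u_def m_assoc)
    moreover have "inv v \<otimes> (f \<otimes> a1) \<otimes> inv (inv v) \<in> H"
      using v f a1 FH H_mult by (intro H_conj) auto
    ultimately have tH: "inv v \<otimes> t \<in> H" using h f a2 FH H_mult by metis
    have "len t \<le> len f + len a1 + len u + len a2 + len f"
      using len_mult_le[of "f \<otimes> a1 \<otimes> u \<otimes> a2" f] len_mult_le[of "f \<otimes> a1 \<otimes> u" a2]
        len_mult_le[of "f \<otimes> a1" u] len_mult_le[of f a1] fc ac uc by (simp add: t_def)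
    then have tl: "len t \<le> len v + (len g + 4 * L)"
      using L[OF f] L[OF a1(1)] L[OF a2(1)] h(3) by (simp add: u_def)
    have lens: "M \<le> len f" "M \<le> len a1" "M \<le> len a2" "M \<le> len u"
      using FM f a1 a2 h by (auto simp: u_def)
    define s where "s = (!) [f, a1, u, a2, f]"
    have adm: "admissible K s 5"
      unfolding admissible_def using fc ac uc lens M a1 a2
      by (auto simp: s_def less_Suc_eq eval_nat_numeral)
    have "word s 5 = t" using fc ac uc by (simp add: s_def t_def eval_nat_numeral)
    moreover have "s 0 = f" by (simp add: s_def)
    ultimately have tM: "M \<le> len t" using admissible_len_first[OF adm, of 5] lens by simp
    have "gp p (act (inv a) p) (act t p) \<le> K + 2 * \<delta> \<and> gp p (act (inv t) p) (act a p) \<le> K + 2 * \<delta>"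
      if ab: "a \<in> carrier \<Gamma>" "M \<le> len a"
        "gp p (act (inv a) p) (act f p) \<le> K" "gp p (act (inv f) p) (act a p) \<le> K" for a
    proof -
      \<comment> \<open>The transition is entered and left through \<open>f\<close>, so the letter
        \<open>a\<close> meets only turns known to be small; the products at its first and last
        junction are those of \<open>t\<close> taken as a single letter.\<close>
      define s where "s = (!) [a, f, a1, u, a2, f, a]"
      have adm: "admissible K s 7"
        unfolding admissible_def using fc ac uc lens M a1 a2 ab
        by (auto simp: s_def less_Suc_eq eval_nat_numeral)
      have w: "word s 0 = \<one>" "word s 1 = a" "word s 6 = a \<otimes> t" "word s 7 = a \<otimes> t \<otimes> a"
        using fc ac uc ab by (simp_all add: s_def t_def eval_nat_numeral m_assoc)
      have "gp (act (word s 1) p) (act (word s 0) p) (act (word s 6) p) \<le> K + 2 * \<delta>"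
        by (rule admissible_gp[OF adm]) auto
      then have 1: "gp p (act (inv a) p) (act t p) \<le> K + 2 * \<delta>"
        unfolding w using ab tc by (simp add: gp_act_base)
      have "gp (act (word s 6) p) (act (word s 1) p) (act (word s 7) p) \<le> K + 2 * \<delta>"
        by (rule admissible_gp[OF adm]) auto
      then have "gp p (act (inv t) p) (act a p) \<le> K + 2 * \<delta>"
        unfolding w using ab tc by (simp add: gp_act_base)
      with 1 show ?thesis by blast
    qed
    then have "is_transition K M f (len g + 4 * L) v t"
      unfolding is_transition_def using tc tH tl tM by blast
    then show ?thesis by blast
  qed
  show ?thesis
    using main len_nonneg[of g] L0 by (intro exI[of _ "len g + 4 * L"]) auto
qed

end

section \<open>Extracting a separated alphabet of nearly equal lengths\<close>

lemma ex_large_fibre: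
  assumes "finite S" "finite T" "f ` S \<subseteq> T" "S \<noteq> {}"
  shows "\<exists>t\<in>T. card S \<le> card T * card {x \<in> S. f x = t}"
proof (rule ccontr)
  assume "\<not> ?thesis"
  then have *: "\<And>t. t \<in> T \<Longrightarrow> card T * card {x \<in> S. f x = t} < card S" by force
  have "T \<noteq> {}" using assms by auto
  have "card T * card S = (\<Sum>t\<in>T. card T * card {x \<in> S. f x = t})"
    using sum.group[OF assms(1-3), of "\<lambda>_. 1::nat"] by (simp add: sum_distrib_left[symmetric])
  also have "\<dots> < (\<Sum>t\<in>T. card S)"
    using * \<open>T \<noteq> {}\<close> assms(2) by (intro sum_strict_mono) auto
  finally show False by simp
qed

text \<open>A separated subset of maximal size: by maximality the sets in \<open>ball\<close> around
  its points cover \<open>B\<close>. The alternative \<open>x = y\<close> puts each centre into its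
  own set whatever the values of \<open>d x x\<close> and \<open>D\<close>.\<close>

lemma ex_separated_subset:
  fixes d :: "'b \<Rightarrow> 'b \<Rightarrow> real"
  assumes fin: "finite B" and sym: "\<And>x y. d x y = d y x"
    and ball: "\<And>x. x \<in> B \<Longrightarrow> card {y \<in> B. d x y < D \<or> x = y} \<le> n"
  shows "\<exists>A\<subseteq>B. (\<forall>x\<in>A. \<forall>y\<in>A. x \<noteq> y \<longrightarrow> D \<le> d x y) \<and> card B \<le> card A * n"
proof -
  define P where "P A \<longleftrightarrow> A \<subseteq> B \<and> (\<forall>x\<in>A. \<forall>y\<in>A. x \<noteq> y \<longrightarrow> D \<le> d x y)" for A
  have "P {}" by (simp add: P_def)
  moreover have "\<forall>A. P A \<longrightarrow> card A < Suc (card B)" using fin by (auto simp: P_def less_Suc_eq_le intro: card_mono)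
  ultimately have "\<exists>A. P A \<and> (\<forall>A'. P A' \<longrightarrow> card A' \<le> card A)"
    by (rule Lattices_Big.ex_has_greatest_nat)
  then obtain A where A: "P A" "\<And>A'. P A' \<Longrightarrow> card A' \<le> card A" by blast
  have finA: "finite A" using A(1) fin finite_subset by (auto simp: P_def)
  have "B \<subseteq> (\<Union>x\<in>A. {y \<in> B. d x y < D \<or> x = y})"
  proof
    fix y assume y: "y \<in> B"
    show "y \<in> (\<Union>x\<in>A. {y \<in> B. d x y < D \<or> x = y})"
    proof (rule ccontr)
      assume c: "\<not> ?thesis"
      then have far: "D \<le> d x y" "x \<noteq> y" if "x \<in> A" for x using y that by (simp_all add: not_less)
      then have "D \<le> d y x" if "x \<in> A" for x using that sym[of y x] by simp
      with far have "P (insert y A)" using A(1) y unfolding P_def by blast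
      then have "card (insert y A) \<le> card A" by (rule A(2))
      then show False using c y finA by (auto simp: card_insert_if split: if_splits)
    qed
  qed
  then have "card B \<le> card (\<Union>x\<in>A. {y \<in> B. d x y < D \<or> x = y})"
    using finA fin by (intro card_mono) auto
  also have "\<dots> \<le> (\<Sum>x\<in>A. card {y \<in> B. d x y < D \<or> x = y})" by (rule card_UN_le[OF finA])
  also have "\<dots> \<le> card A * n"
    using sum_bounded_above[of A "\<lambda>x. card {y \<in> B. d x y < D \<or> x = y}" n] ball A(1) by (auto simp: P_def)
  finally show ?thesis using A(1) by (auto simp: P_def)
qed

context normal_subgroup_action
begin

lemma finite_H_ball: "finite {g \<in> H. len g \<le> r}"
  by (rule finite_subset[OF _ finite_len_le[of r]]) (auto simp: H_carrier)

lemma frequently_many: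
  assumes "ereal \<sigma> < critical_exponent p act H"
  shows "\<exists>n\<ge>N. exp (\<sigma> * real n) \<le> real (card {g \<in> H. len g \<le> real n})"
proof -
  have "\<exists>\<^sub>F n in sequentially. ereal \<sigma> < ereal (ln (real (card {g \<in> H. dist p (act g p) \<le> real n})) / real n)"
  proof (rule ccontr)
    assume "\<not> ?thesis"
    then have "\<forall>\<^sub>F n in sequentially. ereal (ln (real (card {g \<in> H. dist p (act g p) \<le> real n})) / real n) \<le> ereal \<sigma>"
      by (simp add: frequently_def not_less)
    then have "critical_exponent p act H \<le> ereal \<sigma>"
      unfolding critical_exponent_def by (rule Limsup_bounded)
    then show False using assms by simp
  qed
  then obtain n where n: "n \<ge> Suc N" "\<sigma> < ln (real (card {g \<in> H. len g \<le> real n})) / real n"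
    unfolding frequently_sequentially len_def by force
  have "\<one> \<in> {g \<in> H. len g \<le> real n}" by simp
  then have "{g \<in> H. len g \<le> real n} \<noteq> {}" by blast
  then have "card {g \<in> H. len g \<le> real n} > 0" using finite_H_ball by (simp add: card_gt_0_iff)
  moreover have "\<sigma> * real n \<le> ln (real (card {g \<in> H. len g \<le> real n}))"
    using n by (simp add: pos_less_divide_eq less_imp_le)
  ultimately have "exp (\<sigma> * real n) \<le> real (card {g \<in> H. len g \<le> real n})"
    by (subst (asm) ln_ge_iff) auto
  then show ?thesis using n(1) by (intro exI[of _ n]) auto
qed

lemma exp_dominates_linear:
  fixes \<beta> Q :: real
  assumes "0 < \<beta>"
  shows "\<exists>N. \<forall>n\<ge>N. Q * (real n + 1) \<le> exp (\<beta> * real n)"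
proof -
  have "((\<lambda>x::real. x / exp x) \<longlongrightarrow> 0) at_top"
    using tendsto_power_div_exp_0[of 1] by simp
  moreover have "filterlim (\<lambda>n. \<beta> * real n) at_top sequentially"
    using assms by (intro filterlim_tendsto_pos_mult_at_top[OF tendsto_const _ filterlim_real_sequentially])
  ultimately have "(\<lambda>n. \<beta> * real n / exp (\<beta> * real n)) \<longlonglongrightarrow> 0"
    by (rule filterlim_compose)
  moreover have "\<beta> / (2 * (\<bar>Q\<bar> + 1)) > 0" using assms by simp
  ultimately have "\<forall>\<^sub>F n in sequentially. \<beta> * real n / exp (\<beta> * real n) < \<beta> / (2 * (\<bar>Q\<bar> + 1))"
    by (rule order_tendstoD(2))
  moreover have "\<forall>\<^sub>F n in sequentially. (1::nat) \<le> n" by (rule eventually_ge_at_top)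
  ultimately have "\<forall>\<^sub>F n in sequentially. Q * (real n + 1) \<le> exp (\<beta> * real n)"
  proof eventually_elim
    case (elim n)
    have "\<beta> * (real n * (2 * (\<bar>Q\<bar> + 1))) < \<beta> * exp (\<beta> * real n)"
      using elim(1) by (simp add: field_simps)
    then have "real n * (2 * (\<bar>Q\<bar> + 1)) < exp (\<beta> * real n)"
      using assms by (simp only: mult_less_cancel_left_pos)
    moreover have "Q * (real n + 1) \<le> (\<bar>Q\<bar> + 1) * (2 * real n)"
      using elim(2) by (intro mult_mono) auto
    ultimately show ?case by (simp add: algebra_simps)
  qed
  then show ?thesis by (simp add: eventually_sequentially)
qed

text \<open>Nearly equal lengths give the tree of words uniform scales, the separation
  \<open>D\<close> makes branches diverge within one letter, and the common connector
  \<open>f\<close> lets one transition precede and follow every letter.\<close>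

definition generates_at :: "real \<Rightarrow> real \<Rightarrow> real \<Rightarrow> real \<Rightarrow> 'g \<Rightarrow> 'g set \<Rightarrow> bool" where
  "generates_at K M D r f A \<longleftrightarrow> finite A \<and> A \<subseteq> H \<and> 2 \<le> card A \<and> 0 \<le> r \<and>
    (\<forall>a\<in>A. M \<le> len a \<and> r \<le> len a \<and> len a \<le> r + 1 \<and>
       gp p (act (inv a) p) (act f p) \<le> K \<and> gp p (act (inv f) p) (act a p) \<le> K) \<and>
    (\<forall>a\<in>A. \<forall>b\<in>A. a \<noteq> b \<longrightarrow> D \<le> dist (act a p) (act b p))"

text \<open>Two selections in a ball of radius \<open>n\<close>: by integer part of the length and
  connector, which loses a factor linear in \<open>n\<close>, and by separation, which loses a
  constant. Growth at an exponent \<open>\<sigma>' > \<sigma>\<close> absorbs both. The annulus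
  found may lie far inside the ball; this only helps, as the bound is wanted in terms of
  \<open>r\<close>.\<close>

lemma ex_generating_annulus:
  assumes \<sigma>: "0 < \<sigma>" "ereal \<sigma> < critical_exponent p act H"
    and F: "is_connector_set K M F" and D: "0 \<le> D" and c: "0 \<le> c"
  shows "\<exists>A r. \<exists>f\<in>F. generates_at K M D r f A \<and> exp (\<sigma> * (r + c)) \<le> real (card A)"
proof -
  have finF: "finite F" using F by (simp add: is_connector_set_def)
  have "\<forall>a. \<exists>f\<in>F. gp p (act (inv a) p) (act f p) \<le> K \<and> gp p (act (inv f) p) (act a p) \<le> K"
    using F by (simp add: is_connector_set_def)
  then obtain \<phi> where \<phi>: "\<And>a. \<phi> a \<in> F" "\<And>a. gp p (act (inv a) p) (act (\<phi> a) p) \<le> K"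
    "\<And>a. gp p (act (inv (\<phi> a)) p) (act a p) \<le> K" by metis
  obtain \<sigma>' where \<sigma>': "\<sigma> < \<sigma>'" "ereal \<sigma>' < critical_exponent p act H"
    using ereal_dense2[OF \<sigma>(2)] by auto
  define nD where "nD = card {g \<in> carrier \<Gamma>. len g \<le> D}"
  define nM where "nM = card {g \<in> H. len g \<le> M + 1}"
  \<comment> \<open>The losses to be absorbed: connectors, separation, the cost \<open>c\<close>,
    and a surplus \<open>nM + 3\<close> that leaves more elements than there are of length at most
    \<open>M + 1\<close>, so that the annulus lies beyond \<open>M\<close>.\<close>
  define Q where "Q = real (card F) * real nD * (real nM + 3) * exp (\<sigma> * c)"
  obtain N where N: "\<And>n. n \<ge> N \<Longrightarrow> Q * (real n + 1) \<le> exp ((\<sigma>' - \<sigma>) * real n)"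
    using exp_dominates_linear[of "\<sigma>' - \<sigma>" Q] \<sigma>' by auto
  obtain n where n: "n \<ge> N" "exp (\<sigma>' * real n) \<le> real (card {g \<in> H. len g \<le> real n})"
    using frequently_many[OF \<sigma>'(2)] by blast
  define S where "S = {g \<in> H. len g \<le> real n}"
  define T where "T = {..n} \<times> F"
  define \<Phi> where "\<Phi> g = (nat \<lfloor>len g\<rfloor>, \<phi> g)" for g
  have finS: "finite S" unfolding S_def by (rule finite_H_ball)
  have "\<one> \<in> S" by (simp add: S_def)
  have finT: "finite T" using finF by (simp add: T_def)
  have "\<Phi> ` S \<subseteq> T"
  proof
    fix y assume "y \<in> \<Phi> ` S"
    then obtain g where g: "y = \<Phi> g" "len g \<le> real n" by (auto simp: S_def)
    have "nat \<lfloor>len g\<rfloor> \<le> n" using g(2) by linarith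
    then show "y \<in> T" using g(1) \<phi> by (simp add: T_def \<Phi>_def)
  qed
  then obtain rf where rf: "rf \<in> T" "card S \<le> card T * card {g \<in> S. \<Phi> g = rf}"
    using ex_large_fibre[OF finS finT] \<open>\<one> \<in> S\<close> by blast
  define r f where "r = fst rf" and "f = snd rf"
  have r: "r \<le> n" "f \<in> F" using rf(1) by (auto simp: T_def r_def f_def)
  define B where "B = {g \<in> S. \<Phi> g = rf}"
  have B: "g \<in> H" "g \<in> carrier \<Gamma>" "real r \<le> len g" "len g \<le> real r + 1" "\<phi> g = f" if "g \<in> B" for g
  proof -
    have "nat \<lfloor>len g\<rfloor> = r" using that by (auto simp: B_def \<Phi>_def r_def)
    then show "real r \<le> len g" "len g \<le> real r + 1" using len_nonneg[of g] by linarith+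
    show "g \<in> H" "\<phi> g = f" using that by (auto simp: B_def \<Phi>_def f_def S_def)
    then show "g \<in> carrier \<Gamma>" using H_carrier by blast
  qed
  have finB: "finite B" using finS by (simp add: B_def)
  have "\<exists>A\<subseteq>B. (\<forall>x\<in>A. \<forall>y\<in>A. x \<noteq> y \<longrightarrow> D \<le> dist (act x p) (act y p)) \<and> card B \<le> card A * nD"
  proof (rule ex_separated_subset[OF finB])
    show "dist (act x p) (act y p) = dist (act y p) (act x p)" for x y by (rule dist_commute)
    fix x assume x: "x \<in> B"
    have xc: "x \<in> carrier \<Gamma>" using B x by blast
    have "card {y \<in> B. dist (act x p) (act y p) < D \<or> x = y} = card ((\<lambda>y. inv x \<otimes> y) ` {y \<in> B. dist (act x p) (act y p) < D \<or> x = y})"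
      using xc B(2) by (intro card_image[symmetric] inj_onI) auto
    also have "\<dots> \<le> nD"
      unfolding nD_def
    proof (rule card_mono[OF finite_len_le], rule image_subsetI)
      fix y assume "y \<in> {y \<in> B. dist (act x p) (act y p) < D \<or> x = y}"
      then have "y \<in> carrier \<Gamma>" "len (inv x \<otimes> y) \<le> D"
        using B(2) xc D dist_orbit[of x y] by auto
      then show "inv x \<otimes> y \<in> {g \<in> carrier \<Gamma>. len g \<le> D}" using xc by simp
    qed
    finally show "card {y \<in> B. dist (act x p) (act y p) < D \<or> x = y} \<le> nD" .
  qed
  then obtain A where A: "A \<subseteq> B" "\<And>x y. x \<in> A \<Longrightarrow> y \<in> A \<Longrightarrow> x \<noteq> y \<Longrightarrow> D \<le> dist (act x p) (act y p)"
    "card B \<le> card A * nD" by blast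
  have finA: "finite A" using A(1) finB finite_subset by blast
  have "card S \<le> (Suc n * card F) * (card A * nD)"
  proof -
    have "card S \<le> (Suc n * card F) * card B" using rf(2) by (simp add: T_def B_def card_cartesian_product)
    also have "\<dots> \<le> (Suc n * card F) * (card A * nD)" using A(3) by (rule mult_le_mono2)
    finally show ?thesis .
  qed
  then have "real (card S) \<le> real ((Suc n * card F) * (card A * nD))" by (rule of_nat_mono)
  then have up: "exp (\<sigma>' * real n) \<le> (real n + 1) * real (card F) * real nD * real (card A)"
    using n(2) by (simp add: S_def algebra_simps)
  have "real (card A) \<ge> (real nM + 3) * exp (\<sigma> * (real n + c))"
  proof -
    have "Q * (real n + 1) * exp (\<sigma> * real n) \<le> exp ((\<sigma>' - \<sigma>) * real n) * exp (\<sigma> * real n)"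
      using N[OF n(1)] by (intro mult_right_mono) auto
    also have "\<dots> = exp (\<sigma>' * real n)" by (simp add: exp_add[symmetric] algebra_simps)
    also note up
    finally have *: "((real n + 1) * real (card F) * real nD) * ((real nM + 3) * exp (\<sigma> * (real n + c)))
        \<le> ((real n + 1) * real (card F) * real nD) * real (card A)"
      by (simp add: Q_def exp_add algebra_simps)
    have "0 < exp (\<sigma>' * real n)" by simp
    also note up
    finally have "(real n + 1) * real (card F) * real nD \<noteq> 0" by (metis less_irrefl mult_zero_left)
    then have "0 < (real n + 1) * real (card F) * real nD"
      by (metis less_eq_real_def mult_nonneg_nonneg of_nat_0_le_iff of_nat_Suc add.commute)
    with * show ?thesis by (simp only: mult_le_cancel_left_pos)
  qed
  moreover have "1 \<le> exp (\<sigma> * (real n + c))" using \<sigma> c by simp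
  then have "real nM + 3 \<le> (real nM + 3) * exp (\<sigma> * (real n + c))"
    using mult_left_mono[of 1 "exp (\<sigma> * (real n + c))" "real nM + 3"] by simp
  ultimately have cA: "real nM + 3 \<le> real (card A)" by (rule order_trans[rotated])
  have "exp (\<sigma> * (real r + c)) \<le> exp (\<sigma> * (real n + c))" using r \<sigma> by simp
  also have "\<dots> \<le> (real nM + 3) * exp (\<sigma> * (real n + c))"
    using mult_right_mono[of 1 "real nM + 3" "exp (\<sigma> * (real n + c))"] by simp
  also have "\<dots> \<le> real (card A)" by fact
  finally have big: "exp (\<sigma> * (real r + c)) \<le> real (card A)" .
  have "M \<le> real r"
  proof (rule ccontr)
    assume "\<not> ?thesis"
    then have "A \<subseteq> {g \<in> H. len g \<le> M + 1}" using A(1) B by force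
    then have "card A \<le> nM" unfolding nM_def by (rule card_mono[OF finite_H_ball])
    then show False using cA by simp
  qed
  have "\<forall>a\<in>A. M \<le> len a \<and> real r \<le> len a \<and> len a \<le> real r + 1 \<and>
       gp p (act (inv a) p) (act f p) \<le> K \<and> gp p (act (inv f) p) (act a p) \<le> K"
  proof
    fix a assume "a \<in> A"
    then have "a \<in> B" using A(1) by blast
    then show "M \<le> len a \<and> real r \<le> len a \<and> len a \<le> real r + 1 \<and>
       gp p (act (inv a) p) (act f p) \<le> K \<and> gp p (act (inv f) p) (act a p) \<le> K"
      using B[of a] \<open>M \<le> real r\<close> \<phi>(2,3)[of a] by auto
  qed
  moreover have "A \<subseteq> H" using A(1) B by blast
  moreover have "2 \<le> card A" using cA by simp
  ultimately have "generates_at K M D (real r) f A"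
    using finA A(2) by (simp add: generates_at_def)
  then show ?thesis using r(2) big by blast
qed

end

section \<open>The Cantor set carried by the tree of words\<close>

locale visual_action = normal_subgroup_action p \<delta> \<Gamma> act H + visual p \<delta> \<epsilon> C \<rho>
  for p :: "'a::heine_borel" and \<delta> and \<Gamma> :: "('g, 'm) monoid_scheme" (structure) and act and H
    and \<epsilon> C :: real and \<rho>
begin

lemma metric_rho: "metric_on (gromov_boundary p) \<rho>"
  using visual by (simp add: visual_metric_def)

text \<open>Level \<open>k\<close> of the tree is seen at scale
  \<open>exp (- \<epsilon> * \<Lambda>) ^ k\<close>, where \<open>\<Lambda>\<close> bounds the
  average length per level. The cost passed to \<open>ex_generating_annulus\<close> is all of
  \<open>\<Lambda> - r\<close>, so the number of letters meets the mass condition at exponent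
  \<open>s\<close>.\<close>

lemma nonconical_measure_pos:
  assumes s: "0 < s" "ereal (\<epsilon> * s) < critical_exponent p act H"
  shows "hausdorff_measure \<rho> (gromov_boundary p) s (nonconical_limit_set p act H) \<noteq> 0"
proof -
  obtain K where K: "0 \<le> K" "\<And>M. \<exists>F. is_connector_set K M F"
    using ex_connectors by blast
  \<comment> \<open>The turning bound once transitions count as single letters, as in
    \<open>is_transition\<close>; \<open>M\<close> is the step length that goes with it.\<close>
  define K1 where "K1 = K + 2 * \<delta>"
  define M where "M = 2 * K1 + 4 * \<delta> + 1"
  have K1: "0 \<le> K1" "K \<le> K1" using K(1) delta_nonneg by (auto simp: K1_def)
  obtain F where F: "is_connector_set K M F" using K(2) by blast
  have "2 * K + 4 * \<delta> + 1 \<le> M" using K1 by (simp add: M_def)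
  from ex_transition[OF F K(1) this]
  obtain c where c: "c \<ge> 0" and trans: "\<forall>f\<in>F. \<forall>v\<in>carrier \<Gamma>. \<exists>t. is_transition K M f c v t" by blast
  \<comment> \<open>Seen from a branch point, two different letters then have a product below
    \<open>r - K1 - 4 * \<delta>\<close>, whereas each continuation has product at least
    \<open>r - K1 - 2 * \<delta>\<close> with its own letter; \<open>hyp3\<close> keeps the
    continuations apart.\<close>
  define D where "D = 2 * K1 + 8 * \<delta> + 3"
  have "0 < \<epsilon> * s" "0 \<le> D" "0 \<le> c + 2" using s eps_pos K1 c delta_nonneg by (auto simp: D_def)
  from ex_generating_annulus[OF this(1) s(2) F this(2,3)]
  obtain A r f where f: "f \<in> F" and gen: "generates_at K M D r f A"
    and big: "exp (\<epsilon> * s * (r + (c + 2))) \<le> real (card A)" by blast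
  from gen have A: "finite A" "A \<subseteq> H" "2 \<le> card A" and r: "0 \<le> r"
    and Aa: "\<forall>a\<in>A. M \<le> len a \<and> r \<le> len a \<and> len a \<le> r + 1 \<and>
       gp p (act (inv a) p) (act f p) \<le> K \<and> gp p (act (inv f) p) (act a p) \<le> K"
    and sepA: "\<forall>a\<in>A. \<forall>b\<in>A. a \<noteq> b \<longrightarrow> D \<le> dist (act a p) (act b p)"
    unfolding generates_at_def by - ((elim conjE, assumption)+)
  have Ac: "a \<in> carrier \<Gamma>" if "a \<in> A" for a using that A H_carrier by blast
  obtain v where v: "escaping v" "\<And>k. (\<Sum>i<k. len (v i)) \<le> real k" using ex_slow_escaping by blast
  have vc: "v i \<in> carrier \<Gamma>" for i using v by (simp add: escaping_def)
  have "\<forall>i. \<exists>t. is_transition K M f c (v i) t" using trans f vc by blast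
  from choice[OF this] obtain t where is_t: "\<forall>i. is_transition K M f c (v i) (t i)" ..
  then have t: "t i \<in> carrier \<Gamma>" "inv (v i) \<otimes> t i \<in> H" "len (t i) \<le> len (v i) + c" "M \<le> len (t i)" for i
    by (simp_all add: is_transition_def)
  have t_gp: "gp p (act (inv x) p) (act (t i) p) \<le> K1" "gp p (act (inv (t i)) p) (act x p) \<le> K1" if "x \<in> A" for x i
    using is_t Ac Aa that unfolding is_transition_def K1_def by blast+
  define S where "S a n = (if even n then a (n div 2) else t (n div 2))" for a :: "nat \<Rightarrow> 'g" and n
  have S_simps: "S a (2 * k) = a k" "S a (Suc (2 * k)) = t k" for a k by (simp_all add: S_def)
  define paths where "paths = {a :: nat \<Rightarrow> 'g. \<forall>j. a j \<in> A}"
  have pA: "a j \<in> A" if "a \<in> paths" for a j using that by (simp add: paths_def)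
  have Sc: "S a n \<in> carrier \<Gamma>" if "a \<in> paths" for a n
    using pA[OF that] Ac t by (simp add: S_def)
  have adm: "admissible K1 (S a) n" if a: "a \<in> paths" for a n
  proof -
    have "2 * K1 + 4 * \<delta> + 1 \<le> len (S a i)" for i
      using Aa t pA[OF a] unfolding S_def M_def[symmetric] by auto
    moreover have "gp p (act (inv (S a i)) p) (act (S a (Suc i)) p) \<le> K1" for i
    proof (cases "even i")
      case True
      then obtain k where "i = 2 * k" by (rule evenE)
      then show ?thesis using t_gp(1)[OF pA[OF a]] by (simp add: S_simps)
    next
      case False
      then obtain k where k: "i = 2 * k + 1" by (rule oddE)
      then have "Suc i = 2 * Suc k" by simp
      then have "S a (Suc i) = a (Suc k)" "S a i = t k" using k by (simp_all only: S_simps) (simp add: S_simps)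
      then show ?thesis using t_gp(2)[OF pA[OF a]] by simp
    qed
    ultimately show ?thesis using Sc[OF a] unfolding admissible_def by blast
  qed
  have wc: "word (S a) n \<in> carrier \<Gamma>" if "a \<in> paths" for a n using Sc[OF that] by (intro word_closed) auto
  have vwc: "word v n \<in> carrier \<Gamma>" for n using vc by (intro word_closed) auto
  \<comment> \<open>Modulo \<open>H\<close> the letters of \<open>A\<close> vanish and
    \<open>t k\<close> equals \<open>v k\<close>, so all words follow the same path
    \<open>word v\<close>.\<close>
  have coset: "\<exists>h\<in>H. word (S a) (2 * k) = word v k \<otimes> h" if a: "a \<in> paths" for a k
  proof (induction k)
    case 0
    then show ?case using H_one by (intro bexI[of _ \<one>]) auto
  next
    case (Suc k)
    then obtain h where h: "h \<in> H" "word (S a) (2 * k) = word v k \<otimes> h" by blast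
    have ak: "a k \<in> H" using pA[OF a] A by blast
    have c: "h \<in> carrier \<Gamma>" "a k \<in> carrier \<Gamma>" "t k \<in> carrier \<Gamma>" using h ak t H_carrier by auto
    let ?h = "(inv (v k) \<otimes> (h \<otimes> a k) \<otimes> inv (inv (v k))) \<otimes> (inv (v k) \<otimes> t k)"
    have "word (S a) (2 * Suc k) = word v k \<otimes> h \<otimes> a k \<otimes> t k"
      using h by (simp add: S_simps)
    also have "\<dots> = word v (Suc k) \<otimes> ?h"
      using c vc vwc by (simp add: m_assoc inv_solve_left)
        (simp add: m_assoc[symmetric])
    finally have "word (S a) (2 * Suc k) = word v (Suc k) \<otimes> ?h" .
    moreover have "inv (v k) \<otimes> t k \<in> H" using t by blast
    then have "?h \<in> H" by (rule H_mult[OF H_conj[OF inv_closed[OF vc] H_mult[OF h(1) ak]]])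
    ultimately show ?case by blast
  qed
  have depth_even: "depth (word (S a) (2 * k)) = depth (word v k)" if "a \<in> paths" for a k
    using coset[OF that, of k] depth_coset[OF vwc] by auto
  have depth_odd: "depth (word (S a) (Suc (2 * k))) = depth (word v k)" if a: "a \<in> paths" for a k
  proof -
    have "a k \<in> H" using pA[OF a] A by blast
    then show ?thesis
      using depth_coset[OF wc[OF a, of "2 * k"]] depth_even[OF a, of k] by (simp add: S_simps)
  qed
  \<comment> \<open>A letter of \<open>A\<close> preserves the depth and has length at most
    \<open>r + 1\<close>; a transition is longer by at most \<open>c\<close> than the step of
    \<open>v\<close> that it represents.\<close>
  have drift: "\<exists>n0. \<forall>n\<ge>n0. R \<le> depth (word (S a) n) + depth (word (S a) (Suc n)) - len (S a n)"
    if a: "a \<in> paths" for a R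
  proof -
    obtain k0 where k0: "\<And>k. k \<ge> k0 \<Longrightarrow> R + c + r + 1 \<le> depth (word v k) + depth (word v (Suc k)) - len (v k)"
      using v(1) unfolding escaping_def by blast
    have "R \<le> depth (word (S a) n) + depth (word (S a) (Suc n)) - len (S a n)" if n: "n \<ge> 2 * k0" for n
    proof (cases "even n")
      case True
      then obtain k where k: "n = 2 * k" by (rule evenE)
      have "len (a k) \<le> r + 1" using Aa pA[OF a] by blast
      moreover have "depth (word v (Suc k)) \<le> depth (word v k) + len (v k)"
        using depth_mult_le[OF vwc vc] by simp
      ultimately show ?thesis
        using k0[of k] n c depth_even[OF a, of k] depth_odd[OF a, of k] unfolding k by (simp add: S_simps)
    next
      case False
      then obtain k where k: "n = Suc (2 * k)" by (metis oddE Suc_eq_plus1)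
      have sn: "Suc n = 2 * Suc k" using k by simp
      have "len (t k) \<le> len (v k) + c" using t by blast
      then show ?thesis
        using k0[of k] n r depth_even[OF a, of "Suc k"] depth_odd[OF a, of k] unfolding sn k
        by (simp add: S_simps del: word.simps)
    qed
    then show ?thesis by blast
  qed
  define code where "code a = bdry_class p (\<lambda>n. act (word (S a) n) p)" for a
  have conv: "converges_to_bdry p (\<lambda>n. act (word (S a) n) p) (code a)" if "a \<in> paths" for a
    unfolding code_def using admissible_conv[OF adm[OF that] K1(1)] by (rule conv_converges_to_bdry)
  \<comment> \<open>Per level: at most \<open>r + 1\<close> for the letter, \<open>c\<close> for the
    transition, and on average 1 for the delayed step of \<open>v\<close>.\<close>
  define \<Lambda> where "\<Lambda> = r + (c + 2)"
  have \<Lambda>: "0 < \<Lambda>" using r c by (simp add: \<Lambda>_def)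
  have len_even: "len (word (S a) (2 * k)) \<le> real k * \<Lambda>" if a: "a \<in> paths" for a k
  proof -
    have "len (word (S a) (2 * k)) \<le> (\<Sum>i<k. len (v i)) + real k * (r + 1 + c)"
    proof (induction k)
      case (Suc k)
      have "len (word (S a) (2 * Suc k)) \<le> len (word (S a) (2 * k)) + len (a k) + len (t k)"
        using len_mult_le[of "word (S a) (2 * k) \<otimes> a k" "t k"] len_mult_le[of "word (S a) (2 * k)" "a k"]
          wc[OF a] Ac[OF pA[OF a]] t by (simp add: S_simps)
      moreover have "len (a k) \<le> r + 1" using Aa pA[OF a] by blast
      moreover have "len (t k) \<le> len (v k) + c" using t by blast
      ultimately show ?case using Suc.IH by (simp add: algebra_simps)
    qed simp
    then show ?thesis using v(2)[of k] by (simp add: \<Lambda>_def algebra_simps)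
  qed
  show ?thesis
  proof (rule hausdorff_measure_Cantor_pos[where A = A and code = code and \<kappa> = c_lower and \<theta> = "exp (- \<epsilon> * \<Lambda>)"])
    show "metric_on (gromov_boundary p) \<rho>" by (rule metric_rho)
    show "finite A" "2 \<le> card A" by (rule A)+
    show "0 < c_lower" by (rule c_lower_pos)
    show "0 < exp (- \<epsilon> * \<Lambda>)" "exp (- \<epsilon> * \<Lambda>) < 1" using eps_pos \<Lambda> by auto
    show "0 < s" by (rule s)
    have "exp (- \<epsilon> * \<Lambda>) powr s = exp (- (\<epsilon> * s * \<Lambda>))" by (simp add: powr_def)
    moreover have "exp (\<epsilon> * s * \<Lambda>) * exp (- (\<epsilon> * s * \<Lambda>)) \<le> real (card A) * exp (- (\<epsilon> * s * \<Lambda>))"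
      using big unfolding \<Lambda>_def by (intro mult_right_mono) auto
    ultimately show "1 \<le> real (card A) * exp (- \<epsilon> * \<Lambda>) powr s" by (simp add: exp_minus_inverse)
  next
    fix a :: "nat \<Rightarrow> 'g" assume "\<And>j. a j \<in> A"
    then have a: "a \<in> paths" by (simp add: paths_def)
    show "code a \<in> nonconical_limit_set p act H"
      unfolding nonconical_limit_set_def
      using limit_point_in_limit_set_H[OF wc[OF a] conv[OF a]]
        escaping_limit_not_conical[OF adm[OF a] K1(1) drift[OF a] conv[OF a]] by blast
  next
    fix a b :: "nat \<Rightarrow> 'g" and k :: nat
    assume "\<And>j. a j \<in> A" "\<And>j. b j \<in> A" and eq: "\<And>j. j < k \<Longrightarrow> a j = b j" and ne: "a k \<noteq> b k"
    then have a: "a \<in> paths" and b: "b \<in> paths" by (simp_all add: paths_def)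
    define u where "u = word (S a) (2 * k)"
    have u: "u = word (S b) (2 * k)" unfolding u_def using eq by (intro word_cong) (auto simp: S_def)
    have uc: "u \<in> carrier \<Gamma>" unfolding u_def by (rule wc[OF a])
    \<comment> \<open>Because the word is a local quasigeodesic, every continuation runs along its
      letter when seen from the branch point.\<close>
    have branch: "r - K1 - 2 * \<delta> \<le> gp (act u p) (act (u \<otimes> d k) p) (act (word (S d) n) p)"
      if d: "d \<in> paths" "word (S d) (2 * k) = u" "n \<ge> 2 * k + 2" for d n
    proof -
      have "gp (act (word (S d) (Suc (2 * k))) p) (act (word (S d) (2 * k)) p) (act (word (S d) n) p) \<le> K1 + 2 * \<delta>"
        using d by (intro admissible_gp[OF adm[OF d(1)]]) auto
      moreover have "word (S d) (Suc (2 * k)) = u \<otimes> d k" using d by (simp add: S_simps)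
      ultimately have "gp (act (u \<otimes> d k) p) (act u p) (act (word (S d) n) p) \<le> K1 + 2 * \<delta>" using d(2) by simp
      moreover have "dist (act u p) (act (u \<otimes> d k) p) = len (d k)"
        using uc Ac[OF pA[OF d(1)]] by (simp add: len_def)
      moreover have "r \<le> len (d k)" using Aa pA[OF d(1)] by blast
      ultimately show ?thesis using gp_flip[of "act u p" "act (u \<otimes> d k) p" "act (word (S d) n) p"] by simp
    qed
    have V: "gp p (act (word (S a) n) p) (act (word (S b) n) p) \<le> real (Suc k) * \<Lambda>" if n: "n \<ge> 2 * k + 2" for n
    proof -
      let ?x = "act (u \<otimes> a k) p" and ?y = "act (u \<otimes> b k) p"
      have "dist ?x ?y = dist (act (a k) p) (act (b k) p)" using uc Ac pA a b by simp
      then have "D \<le> dist ?x ?y" using sepA ne pA a b by simp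
      moreover have "dist (act u p) ?x \<le> r + 1" "dist (act u p) ?y \<le> r + 1"
        using uc Ac Aa pA[OF a] pA[OF b] by (simp_all add: len_def[symmetric])
      ultimately have "gp (act u p) ?x ?y \<le> r + 1 - D / 2" by (simp add: gromov_product_def field_simps)
      moreover have "r - K1 - 2 * \<delta> \<le> gp (act u p) ?x (act (word (S a) n) p)" using branch[OF a _ n] u_def by simp
      moreover have "r - K1 - 2 * \<delta> \<le> gp (act u p) ?y (act (word (S b) n) p)" using branch[OF b _ n] u by simp
      ultimately have "gp (act u p) (act (word (S a) n) p) (act (word (S b) n) p) \<le> r"
        using hyp3[of "act u p" ?x "act (word (S a) n) p" "act (word (S b) n) p" ?y] K1 delta_nonneg
        by (auto simp: D_def gp_commute min_def field_simps split: if_splits)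
      moreover have "gp p (act (word (S a) n) p) (act (word (S b) n) p) \<le>
          gp (act u p) (act (word (S a) n) p) (act (word (S b) n) p) + dist p (act u p)"
        by (rule gp_change_base)
      moreover have "dist p (act u p) \<le> real k * \<Lambda>" using len_even[OF a, of k] by (simp add: u_def len_def)
      ultimately show ?thesis using c by (simp add: \<Lambda>_def algebra_simps)
    qed
    have "c_lower * exp (- \<epsilon> * (real (Suc k) * \<Lambda>)) \<le> \<rho> (code a) (code b)"
      using conv[OF a] conv[OF b] V unfolding converges_to_bdry_def by (intro rho_lower) auto
    moreover have "exp (- \<epsilon> * \<Lambda>) ^ Suc k = exp (- \<epsilon> * (real (Suc k) * \<Lambda>))"
      by (simp only: exp_of_nat_mult[symmetric]) (simp add: algebra_simps)
    ultimately show "c_lower * exp (- \<epsilon> * \<Lambda>) ^ Suc k \<le> \<rho> (code a) (code b)" by simp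
  qed
qed

end

section \<open>Conical limit points\<close>

context normal_subgroup_action
begin

lemma card_ball_le_exp:
  assumes "critical_exponent p act H < ereal \<sigma>"
  shows "\<exists>C0>0. \<forall>n. real (card {g \<in> H. len g \<le> real n}) \<le> C0 * exp (\<sigma> * real n)"
proof -
  let ?c = "\<lambda>n. real (card {g \<in> H. len g \<le> real n})"
  have pos: "1 \<le> ?c n" for n :: nat
  proof -
    have "\<one> \<in> {g \<in> H. len g \<le> real n}" by simp
    then have "card {g \<in> H. len g \<le> real n} > 0" using finite_H_ball card_gt_0_iff by blast
    then show ?thesis by simp
  qed
  have "\<forall>\<^sub>F n in sequentially. ereal (ln (?c n) / real n) < ereal \<sigma>"
    using Limsup_lessD[OF assms[unfolded critical_exponent_def]] by (simp add: len_def)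
  then obtain N where N: "\<And>n. n \<ge> N \<Longrightarrow> ln (?c n) / real n < \<sigma>"
    unfolding eventually_sequentially by auto
  have late: "?c n \<le> exp (\<sigma> * real n)" if n: "n \<ge> Suc N" for n
  proof -
    have "ln (?c n) < \<sigma> * real n" using N[of n] n by (simp add: pos_divide_less_eq)
    then have "exp (ln (?c n)) \<le> exp (\<sigma> * real n)" by simp
    moreover have "exp (ln (?c n)) = ?c n" using pos[of n] by (intro exp_ln) linarith
    ultimately show ?thesis by simp
  qed
  define C0 where "C0 = 1 + (\<Sum>n\<le>N. ?c n / exp (\<sigma> * real n))"
  have "0 \<le> (\<Sum>n\<le>N. ?c n / exp (\<sigma> * real n))" by (intro sum_nonneg) auto
  then have C0: "1 \<le> C0" by (simp add: C0_def)
  have "?c n \<le> C0 * exp (\<sigma> * real n)" for n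
  proof (cases "n \<le> N")
    case True
    then have "?c n / exp (\<sigma> * real n) \<le> (\<Sum>n\<le>N. ?c n / exp (\<sigma> * real n))"
      by (intro member_le_sum) auto
    then have "?c n / exp (\<sigma> * real n) \<le> C0" by (simp add: C0_def)
    then show ?thesis by (simp add: pos_divide_le_eq)
  next
    case False
    then have "?c n \<le> 1 * exp (\<sigma> * real n)" using late by simp
    also have "\<dots> \<le> C0 * exp (\<sigma> * real n)" using C0 by (intro mult_right_mono) auto
    finally show ?thesis .
  qed
  then show ?thesis using C0 by (intro exI[of _ C0]) auto
qed

text \<open>Bounding all finite partial sums avoids an enumeration of \<open>H\<close>. Grouping by
  integer part of the length compares the series with a geometric one of ratio
  \<open>exp (\<tau> - \<sigma>)\<close>, for \<open>\<tau>\<close> between the critical exponent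
  and \<open>\<sigma>\<close>.\<close>

lemma poincare_series_bounded:
  assumes \<sigma>: "0 < \<sigma>" "critical_exponent p act H < ereal \<sigma>"
  shows "\<exists>B. \<forall>S. finite S \<longrightarrow> S \<subseteq> H \<longrightarrow> (\<Sum>h\<in>S. exp (- \<sigma> * len h)) \<le> B"
proof -
  obtain \<tau> where \<tau>: "critical_exponent p act H < ereal \<tau>" "\<tau> < \<sigma>"
    using ereal_dense2[OF \<sigma>(2)] by auto
  obtain C0 where C0: "C0 > 0" "\<And>n. real (card {g \<in> H. len g \<le> real n}) \<le> C0 * exp (\<tau> * real n)"
    using card_ball_le_exp[OF \<tau>(1)] by blast
  define q where "q = exp (\<tau> - \<sigma>)"
  have q: "0 < q" "q < 1" using \<tau> by (auto simp: q_def)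
  have "(\<Sum>h\<in>S. exp (- \<sigma> * len h)) \<le> C0 * exp \<tau> * (1 / (1 - q))" if S: "finite S" "S \<subseteq> H" for S
  proof -
    define f where "f h = nat \<lfloor>len h\<rfloor>" for h
    have f: "real (f h) \<le> len h" "len h \<le> real (Suc (f h))" for h
      using len_nonneg[of h] by (auto simp: f_def) linarith
    have "(\<Sum>h\<in>S. exp (- \<sigma> * len h)) = (\<Sum>n\<in>f ` S. \<Sum>h\<in>{x \<in> S. f x = n}. exp (- \<sigma> * len h))"
      using sum.group[OF S(1) finite_imageI[OF S(1)] order_refl, of "\<lambda>h. exp (- \<sigma> * len h)" f] by simp
    also have "\<dots> \<le> (\<Sum>n\<in>f ` S. C0 * exp \<tau> * q ^ n)"
    proof (rule sum_mono)
      fix n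
      have "(\<Sum>h\<in>{x \<in> S. f x = n}. exp (- \<sigma> * len h)) \<le> real (card {x \<in> S. f x = n}) * exp (- \<sigma> * real n)"
        using \<sigma>(1) f by (intro sum_bounded_above) auto
      also have "card {x \<in> S. f x = n} \<le> card {g \<in> H. len g \<le> real (Suc n)}"
        using S f(2) by (intro card_mono finite_H_ball) auto
      then have "real (card {x \<in> S. f x = n}) * exp (- \<sigma> * real n) \<le>
          real (card {g \<in> H. len g \<le> real (Suc n)}) * exp (- \<sigma> * real n)"
        by (intro mult_right_mono) auto
      also have "\<dots> \<le> C0 * exp (\<tau> * real (Suc n)) * exp (- \<sigma> * real n)"
        by (rule mult_right_mono[OF C0(2)]) simp
      also have "\<dots> = C0 * exp \<tau> * q ^ n"
        by (simp add: q_def exp_of_nat_mult[symmetric] exp_add[symmetric] algebra_simps)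
      finally show "(\<Sum>h\<in>{x \<in> S. f x = n}. exp (- \<sigma> * len h)) \<le> C0 * exp \<tau> * q ^ n" .
    qed
    also have "\<dots> = C0 * exp \<tau> * (\<Sum>n\<in>f ` S. q ^ n)" by (simp add: sum_distrib_left)
    also have "(\<Sum>n\<in>f ` S. q ^ n) \<le> (\<Sum>n. q ^ n)"
      using q S by (intro sum_le_suminf summable_geometric) auto
    then have "C0 * exp \<tau> * (\<Sum>n\<in>f ` S. q ^ n) \<le> C0 * exp \<tau> * (\<Sum>n. q ^ n)"
      using C0 by (intro mult_left_mono) auto
    also have "\<dots> = C0 * exp \<tau> * (1 / (1 - q))" using q by (simp add: suminf_geometric)
    finally show ?thesis .
  qed
  then show ?thesis by blast
qed

lemma countable_H: "countable H"
proof -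
  have "H \<subseteq> (\<Union>n::nat. {g \<in> H. len g \<le> real n})" by (auto intro: real_arch_simple)
  moreover have "countable (\<Union>n::nat. {g \<in> H. len g \<le> real n})"
    by (rule countable_UN) (simp_all add: countable_finite finite_H_ball)
  ultimately show ?thesis by (rule countable_subset)
qed

end

section \<open>Shadows of orbit points\<close>

context visual_action
begin

text \<open>A single ray is asked for, as in the definition of conical points, so the covering
  requires no comparison of rays with a common end point.\<close>

definition shadow :: "real \<Rightarrow> 'g \<Rightarrow> (nat \<Rightarrow> 'a) set set" where
  "shadow R h = {\<xi> \<in> gromov_boundary p. \<exists>\<gamma>. geodesic_ray p \<gamma> \<xi> \<and> (\<exists>t\<ge>0. dist (act h p) (\<gamma> t) \<le> R)}"

text \<open>Both rays come within \<open>R\<close> of the orbit point at times of at least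
  \<open>len h - R\<close>, so the product of these points is at least \<open>len h - 2 * R\<close>;
  passing to the ends costs \<open>2 * \<delta>\<close>.\<close>

lemma shadow_rho_le:
  assumes "\<xi> \<in> shadow R h" "\<eta> \<in> shadow R h"
  shows "\<rho> \<xi> \<eta> \<le> c_upper * exp (- \<epsilon> * (len h - 2 * R - 2 * \<delta>))"
proof -
  obtain \<gamma> t \<gamma>' t' where \<gamma>: "geodesic_ray p \<gamma> \<xi>" "0 \<le> t" "dist (act h p) (\<gamma> t) \<le> R"
    and \<gamma>': "geodesic_ray p \<gamma>' \<eta>" "0 \<le> t'" "dist (act h p) (\<gamma>' t') \<le> R"
    using assms unfolding shadow_def by blast
  have ray: "dist p (\<gamma> t) = t \<and> len h - R \<le> t \<and> (\<forall>n. t \<le> real n \<longrightarrow> gp p (\<gamma> (real n)) (\<gamma> t) = t)"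
    if "geodesic_ray p \<gamma> \<zeta>" "0 \<le> t" "dist (act h p) (\<gamma> t) \<le> R" for \<gamma> \<zeta> t
  proof -
    have d: "dist p (\<gamma> s) = s" if "0 \<le> s" for s
      using \<open>geodesic_ray p \<gamma> \<zeta>\<close> that unfolding geodesic_ray_def by (metis abs_of_nonneg diff_0 abs_minus_cancel order_refl)
    have "gp p (\<gamma> (real n)) (\<gamma> t) = t" if "t \<le> real n" for n
      using \<open>geodesic_ray p \<gamma> \<zeta>\<close> that \<open>0 \<le> t\<close> d[of t] d[of "real n"] unfolding geodesic_ray_def gromov_product_def by auto
    moreover have "len h - R \<le> t"
      using d[OF \<open>0 \<le> t\<close>] that(3) dist_triangle[of p "act h p" "\<gamma> t"] by (simp add: len_def dist_commute)
    ultimately show ?thesis using d \<open>0 \<le> t\<close> by blast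
  qed
  note r = ray[OF \<gamma>] and r' = ray[OF \<gamma>']
  have "dist (\<gamma> t) (\<gamma>' t') \<le> 2 * R"
    using \<gamma>(3) \<gamma>'(3) dist_triangle[of "\<gamma> t" "\<gamma>' t'" "act h p"] by (simp add: dist_commute)
  then have g: "len h - 2 * R \<le> gp p (\<gamma> t) (\<gamma>' t')" using r r' by (simp add: gromov_product_def)
  obtain N :: nat where N: "max t t' \<le> real N" using real_arch_simple by blast
  have R0: "0 \<le> R" using \<gamma>(3) zero_le_dist order_trans by blast
  have "len h - 2 * R - 2 * \<delta> \<le> gp p (\<gamma> (real n)) (\<gamma>' (real n))" if n: "n \<ge> N" for n
  proof -
    have "max t t' \<le> real n" using N n by linarith
    then have "gp p (\<gamma> (real n)) (\<gamma> t) = t" "gp p (\<gamma>' (real n)) (\<gamma>' t') = t'" using r r' by auto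
    then show ?thesis
      using hyp3[of p "\<gamma> (real n)" "\<gamma> t" "\<gamma>' t'" "\<gamma>' (real n)"] g r r' R0
      by (auto simp: gp_commute min_def split: if_splits)
  qed
  then show ?thesis
    using assms \<gamma>(1) \<gamma>'(1) unfolding shadow_def geodesic_ray_def converges_to_bdry_def
    by (intro rho_upper[where x = "\<lambda>n. \<gamma> (real n)" and y = "\<lambda>n. \<gamma>' (real n)" and N = N]) auto
qed

text \<open>The radius of a conical point depends on the point; rounding it up to an integer splits
  the conical limit set into countably many limsup sets of shadows.\<close>

lemma conical_measure_zero:
  assumes s: "0 < s" "critical_exponent p act H < ereal (\<epsilon> * s)"
  shows "hausdorff_measure \<rho> (gromov_boundary p) s (conical_limit_set p act H) = 0"
proof -
  define e where "e = from_nat_into H"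
  have e: "bij_betw e UNIV H"
    unfolding e_def by (rule bij_betw_from_nat_into[OF countable_H infinite_H])
  then have eH: "e i \<in> H" and inj_e: "inj e" for i by (auto simp: bij_betw_def)
  define A where "A R = {\<xi> \<in> conical_limit_set p act H. \<forall>m. \<exists>i\<ge>m. \<xi> \<in> shadow (real R) (e i)}" for R :: nat
  have null: "hausdorff_measure \<rho> (gromov_boundary p) s (A R) = 0" for R
  proof (rule hausdorff_null_limsup[OF _ s(1), where U = "\<lambda>i. shadow (real R) (e i)"])
    let ?b = "\<lambda>i. c_upper * exp (- \<epsilon> * (len (e i) - 2 * real R - 2 * \<delta>))"
    show "metric_on (gromov_boundary p) \<rho>" by (rule metric_rho)
    show "shadow (real R) (e i) \<subseteq> gromov_boundary p" for i by (auto simp: shadow_def)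
    show "\<rho> x y \<le> ?b i" if "x \<in> shadow (real R) (e i)" "y \<in> shadow (real R) (e i)" for i x y
      using that by (rule shadow_rho_le)
    show "0 \<le> ?b i" for i using c_upper_pos by simp
    show "\<exists>i\<ge>m. x \<in> shadow (real R) (e i)" if "x \<in> A R" for x m using that by (simp add: A_def)
    define c where "c = c_upper powr s * exp (\<epsilon> * s * (2 * real R + 2 * \<delta>))"
    have "?b i powr s = c * exp (- (\<epsilon> * s) * len (e i))" for i
    proof -
      have "?b i powr s = c_upper powr s * exp (s * (- \<epsilon> * (len (e i) - 2 * real R - 2 * \<delta>)))"
        using c_upper_pos by (simp add: powr_mult) (simp add: powr_def)
      also have "s * (- \<epsilon> * (len (e i) - 2 * real R - 2 * \<delta>)) =
          \<epsilon> * s * (2 * real R + 2 * \<delta>) + - (\<epsilon> * s) * len (e i)" by (simp add: algebra_simps)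
      finally show ?thesis unfolding c_def exp_add by simp
    qed
    moreover have "summable (\<lambda>i. exp (- (\<epsilon> * s) * len (e i)))"
    proof -
      have "0 < \<epsilon> * s" using eps_pos s by simp
      then obtain B where B: "\<And>S. finite S \<Longrightarrow> S \<subseteq> H \<Longrightarrow> (\<Sum>h\<in>S. exp (- (\<epsilon> * s) * len h)) \<le> B"
        using poincare_series_bounded s(2) by meson
      have "(\<Sum>i<n. exp (- (\<epsilon> * s) * len (e i))) \<le> B" for n
      proof -
        have "(\<Sum>i<n. exp (- (\<epsilon> * s) * len (e i))) = (\<Sum>h\<in>e ` {..<n}. exp (- (\<epsilon> * s) * len h))"
          using inj_e by (simp add: sum.reindex inj_on_subset)
        also have "\<dots> \<le> B" using eH by (intro B) auto
        finally show ?thesis .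
      qed
      then show ?thesis by (intro summableI_nonneg_bounded) auto
    qed
    ultimately show "summable (\<lambda>i. ?b i powr s)" by (simp add: summable_mult)
  qed
  have "conical_limit_set p act H \<subseteq> (\<Union>R. A R)"
  proof
    fix \<xi> assume \<xi>: "\<xi> \<in> conical_limit_set p act H"
    then obtain g R \<gamma> where R: "R > 0" and g: "\<And>n. g n \<in> H" "converges_to_bdry p (\<lambda>n. act (g n) p) \<xi>"
      and ray: "geodesic_ray p \<gamma> \<xi>" and near: "\<And>n. \<exists>t\<ge>0. dist (act (g n) p) (\<gamma> t) \<le> R"
      unfolding conical_limit_set_def by blast
    obtain R' :: nat where R': "R \<le> real R'" using real_arch_simple by blast
    have bd: "\<xi> \<in> gromov_boundary p" using g unfolding converges_to_bdry_def by blast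
    have sh: "\<xi> \<in> shadow (real R') (g n)" for n
      using bd ray near[of n] R' unfolding shadow_def by force
    have "\<exists>i\<ge>m. \<xi> \<in> shadow (real R') (e i)" for m
    proof -
      have "conv_at_infinity p (\<lambda>n. act (g n) p)"
        using g boundary_conv unfolding converges_to_bdry_def by blast
      \<comment> \<open>An element longer than the first \<open>m\<close> elements of the
        enumeration together has an index of at least \<open>m\<close>.\<close>
      then obtain n where n: "(\<Sum>i<m. len (e i)) + 1 \<le> len (g n)"
        using conv_dist_at_top unfolding len_def by blast
      obtain i where i: "g n = e i" using g(1) e unfolding bij_betw_def by blast
      have "\<not> i < m"
      proof
        assume "i < m"
        then have "len (e i) \<le> (\<Sum>i<m. len (e i))" by (intro member_le_sum) (auto simp: len_nonneg)
        then show False using n i by simp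
      qed
      then show ?thesis using sh[of n] i by (intro exI[of _ i]) auto
    qed
    then show "\<xi> \<in> (\<Union>R. A R)" using \<xi> by (auto simp: A_def)
  qed
  then show ?thesis using hausdorff_null_UN[of \<rho> "gromov_boundary p" s A, OF null] hausdorff_null_mono by blast
qed

lemma hausdorff_dim_nonconical_ge:
  "critical_exponent p act H / ereal \<epsilon> \<le> hausdorff_dim \<rho> (gromov_boundary p) (nonconical_limit_set p act H)"
  unfolding hausdorff_dim_def
proof (rule Inf_greatest, clarify)
  fix s :: real assume "0 < s" "hausdorff_measure \<rho> (gromov_boundary p) s (nonconical_limit_set p act H) = 0"
  then have "critical_exponent p act H \<le> ereal (\<epsilon> * s)" using nonconical_measure_pos not_le by blast
  then show "critical_exponent p act H / ereal \<epsilon> \<le> ereal s"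
    using eps_pos by (simp add: ereal_divide_le_pos)
qed

text \<open>Nullity of the non-conical part at \<open>s\<close> forces the critical exponent to be
  at most \<open>\<epsilon> * s\<close>, so the conical part is null at every larger exponent. The
  increment \<open>e\<close> is there because the Poincare series may diverge at the critical
  exponent.\<close>

lemma hausdorff_dim_limit_set:
  "hausdorff_dim \<rho> (gromov_boundary p) (limit_set p act H) =
   hausdorff_dim \<rho> (gromov_boundary p) (nonconical_limit_set p act H)"
proof (rule antisym)
  let ?B = "gromov_boundary p"
  show "hausdorff_dim \<rho> ?B (nonconical_limit_set p act H) \<le> hausdorff_dim \<rho> ?B (limit_set p act H)"
    unfolding hausdorff_dim_def
  proof (rule Inf_superset_mono, clarify)
    fix s :: real assume "0 < s" "hausdorff_measure \<rho> ?B s (limit_set p act H) = 0"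
    moreover have "nonconical_limit_set p act H \<subseteq> limit_set p act H" by (auto simp: nonconical_limit_set_def)
    ultimately show "\<exists>s'. ereal s = ereal s' \<and> 0 < s' \<and> hausdorff_measure \<rho> ?B s' (nonconical_limit_set p act H) = 0"
      using hausdorff_null_mono by blast
  qed
  show "hausdorff_dim \<rho> ?B (limit_set p act H) \<le> hausdorff_dim \<rho> ?B (nonconical_limit_set p act H)"
    unfolding hausdorff_dim_def[of _ _ "nonconical_limit_set p act H"]
  proof (rule Inf_greatest, clarify)
    fix s :: real assume s: "0 < s" "hausdorff_measure \<rho> ?B s (nonconical_limit_set p act H) = 0"
    have crit: "critical_exponent p act H \<le> ereal (\<epsilon> * s)" using nonconical_measure_pos s not_le by blast
    show "hausdorff_dim \<rho> ?B (limit_set p act H) \<le> ereal s"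
    proof (rule ereal_le_epsilon2)
      fix e :: real assume e: "0 < e"
      have "\<epsilon> * s < \<epsilon> * (s + e)" using eps_pos e by simp
      then have "critical_exponent p act H < ereal (\<epsilon> * (s + e))"
        using crit by (meson less_ereal.simps(1) order_le_less_trans)
      then have "hausdorff_measure \<rho> ?B (s + e) (conical_limit_set p act H) = 0"
        using s e by (intro conical_measure_zero) auto
      moreover have "hausdorff_measure \<rho> ?B (s + e) (nonconical_limit_set p act H) = 0"
        using hausdorff_null_exponent_mono[OF metric_rho s(2,1)] e by simp
      ultimately have "hausdorff_measure \<rho> ?B (s + e) (conical_limit_set p act H \<union> nonconical_limit_set p act H) = 0"
        by (rule hausdorff_null_Un)
      then have "hausdorff_measure \<rho> ?B (s + e) (limit_set p act H) = 0"
        by (rule hausdorff_null_mono) (auto simp: nonconical_limit_set_def)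
      then show "hausdorff_dim \<rho> ?B (limit_set p act H) \<le> ereal s + ereal e"
        unfolding hausdorff_dim_def using s e by (intro Inf_lower) auto
    qed
  qed
qed

end

theorem theorem5p8:
  fixes \<Gamma> :: "('g, 'm) monoid_scheme"
    and act :: "'g \<Rightarrow> 'a::heine_borel \<Rightarrow> 'a"
    and p :: 'a
    and H :: "'g set"
    and \<epsilon> C :: real
    and \<rho> :: "(nat \<Rightarrow> 'a) set \<Rightarrow> (nat \<Rightarrow> 'a) set \<Rightarrow> real"
  assumes geod: "geodesic_space TYPE('a)"
    and hyp: "\<exists>d. gromov_hyperbolic d TYPE('a)"
    and act: "isometric_action \<Gamma> act"
    and pd: "properly_discontinuous \<Gamma> act"
    and nonelem: "\<exists>a b c. {a, b, c} \<subseteq> limit_set p act (carrier \<Gamma>) \<and> a \<noteq> b \<and> b \<noteq> c \<and> a \<noteq> c"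
    and normal: "H \<lhd> \<Gamma>"
    and inf_H: "infinite H"
    and inf_index: "infinite (rcosets\<^bsub>\<Gamma>\<^esub> H)"
    and vis: "visual_metric p \<epsilon> C \<rho>"
  shows "hausdorff_dim \<rho> (gromov_boundary p) (limit_set p act H)
           = hausdorff_dim \<rho> (gromov_boundary p) (nonconical_limit_set p act H)
       \<and> hausdorff_dim \<rho> (gromov_boundary p) (nonconical_limit_set p act H)
           \<ge> critical_exponent p act H / ereal \<epsilon>"
proof -
  obtain d where d: "gromov_hyperbolic d TYPE('a)" using hyp by blast
  interpret visual_action p d \<Gamma> act H \<epsilon> C \<rho>
    by (intro visual_action.intro normal_subgroup_action.intro normal_subgroup_action_axioms.intro
      hyperbolic_action.intro hyperbolic_action_axioms.intro visual.intro visual_axioms.intro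
      hyperbolic_space.intro) (rule geod d act pd nonelem normal inf_H inf_index vis)+
  show ?thesis using hausdorff_dim_limit_set hausdorff_dim_nonconical_ge by blast
qed

end
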